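(* Let $S$ be a polynomial ring over a field $k$ and let $I \subset S$ be a monomial ideal of height $c$. If $I$ is not a complete intersection, then $$\sum_i \beta_i(S/I) \geq 2^c + 2^{c-1}.$$ Furthermore, equality holds if and only if the generating function $\sum_i \beta_i(S/I)t^i$ is either $$(1 + 3t + 2t^2)(1+t)^{c-2} \quad \text{or} \quad (1 + 5t + 5t^2 + t^3)(1+t)^{c-3}.$$
   Context: $\beta_i(S/I)$ denotes the rank of the $i$-th free module in a minimal (graded) free resolution of $S/I$ over $S$. "$I$ is a complete intersection" means $I$ is generated by a regular sequence. *)

theory Defs
  imports "HOL-Library.Poly_Mapping" "HOL-Library.Extended_Nat" "HOL-Computational_Algebra.Polynomial"
begin

definition is_ideal :: "'a::comm_ring_1 set \<Rightarrow> bool" where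
  "is_ideal J \<longleftrightarrow> 0 \<in> J \<and> (\<forall>x\<in>J. \<forall>y\<in>J. x + y \<in> J) \<and> (\<forall>r. \<forall>x\<in>J. r * x \<in> J)"

definition ideal_gen :: "'a::comm_ring_1 set \<Rightarrow> 'a set" where
  "ideal_gen A = \<Inter>{J. is_ideal J \<and> A \<subseteq> J}"

definition is_prime_ideal :: "'a::comm_ring_1 set \<Rightarrow> bool" where
  "is_prime_ideal P \<longleftrightarrow> is_ideal P \<and> P \<noteq> UNIV \<and> (\<forall>a b. a * b \<in> P \<longrightarrow> a \<in> P \<or> b \<in> P)"

definition prime_height :: "'a::comm_ring_1 set \<Rightarrow> enat" where
  "prime_height Q = Sup {enat n | n. \<exists>P :: nat \<Rightarrow> 'a set.
      (\<forall>i\<le>n. is_prime_ideal (P i)) \<and> (\<forall>i<n. P i \<subset> P (Suc i)) \<and> P n = Q}"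

text \<open>Height of an ideal: infimum of heights of primes containing it (infinite for the unit ideal).\<close>
definition ideal_height :: "'a::comm_ring_1 set \<Rightarrow> enat" where
  "ideal_height I = (INF Q\<in>{Q. is_prime_ideal Q \<and> I \<subseteq> Q}. prime_height Q)"

definition regular_sequence :: "'a::comm_ring_1 list \<Rightarrow> bool" where
  "regular_sequence fs \<longleftrightarrow> ideal_gen (set fs) \<noteq> UNIV \<and>
     (\<forall>i<length fs. \<forall>g. fs ! i * g \<in> ideal_gen (set (take i fs)) \<longrightarrow> g \<in> ideal_gen (set (take i fs)))"

definition complete_intersection :: "'a::comm_ring_1 set \<Rightarrow> bool" where
  "complete_intersection I \<longleftrightarrow> (\<exists>fs. regular_sequence fs \<and> ideal_gen (set fs) = I)"

type_synonym ('v, 'k) mpoly = "('v \<Rightarrow>\<^sub>0 nat) \<Rightarrow>\<^sub>0 'k"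

definition monomial :: "('v::finite, 'k::field) mpoly \<Rightarrow> bool" where
  "monomial f \<longleftrightarrow> (\<exists>\<alpha>. f = Poly_Mapping.single \<alpha> 1)"

definition monomial_ideal :: "('v::finite, 'k::field) mpoly set \<Rightarrow> bool" where
  "monomial_ideal I \<longleftrightarrow> (\<exists>G. (\<forall>g\<in>G. monomial g) \<and> I = ideal_gen G)"

definition mdeg :: "('v::finite \<Rightarrow>\<^sub>0 nat) \<Rightarrow> nat" where
  "mdeg \<alpha> = (\<Sum>v\<in>UNIV. Poly_Mapping.lookup \<alpha> v)"

definition max_ideal :: "('v::finite, 'k::field) mpoly set" where
  "max_ideal = {f. Poly_Mapping.lookup f 0 = 0}"

definition fvec :: "nat \<Rightarrow> (nat \<Rightarrow> 'a::comm_ring_1) set" where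
  "fvec m = {v. \<forall>j\<ge>m. v j = 0}"

definition mat_apply :: "(nat \<Rightarrow> nat \<Rightarrow> 'a::comm_ring_1) \<Rightarrow> nat \<Rightarrow> nat \<Rightarrow> (nat \<Rightarrow> 'a) \<Rightarrow> (nat \<Rightarrow> 'a)" where
  "mat_apply d n m v = (\<lambda>r. if r < n then (\<Sum>j<m. d r j * v j) else 0)"

text \<open>A minimal graded free resolution of S/I of length N:
  0 \<rightarrow> F_N \<rightarrow> ... \<rightarrow> F_1 \<rightarrow> F_0 = S, with F_i = \<oplus>_{j<b i} S(-deg i j),
  differential d i : F_i \<rightarrow> F_(i-1) given by a (b (i-1)) x (b i) matrix with homogeneous
  entries of the correct degrees, exact, with image of d 1 equal to I, and minimal
  (all matrix entries in the homogeneous maximal ideal).\<close>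
definition min_graded_free_res ::
  "('v::finite, 'k::field) mpoly set \<Rightarrow> nat \<Rightarrow> (nat \<Rightarrow> nat) \<Rightarrow> (nat \<Rightarrow> nat \<Rightarrow> nat)
     \<Rightarrow> (nat \<Rightarrow> nat \<Rightarrow> nat \<Rightarrow> ('v, 'k) mpoly) \<Rightarrow> bool" where
  "min_graded_free_res I N b deg d \<longleftrightarrow>
     b 0 = 1 \<and> deg 0 0 = 0 \<and> (\<forall>i>N. b i = 0) \<and>
     (\<forall>i\<ge>1. \<forall>r<b (i - 1). \<forall>j<b i.
         d i r j \<in> max_ideal \<and> (\<forall>\<alpha>\<in>Poly_Mapping.keys (d i r j). mdeg \<alpha> + deg (i - 1) r = deg i j)) \<and>
     (\<lambda>v. v 0) ` (mat_apply (d 1) 1 (b 1) ` fvec (b 1)) = I \<and>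
     (\<forall>i\<ge>1. {v \<in> fvec (b i). mat_apply (d i) (b (i - 1)) (b i) v = (\<lambda>_. 0)}
              = mat_apply (d (Suc i)) (b i) (b (Suc i)) ` fvec (b (Suc i)))"

end

theory Submission
  imports Defs "HOL-Library.Function_Algebras" "HOL-Library.FuncSet"
begin

text \<open>
  Comparison with the Taylor resolution expresses the Betti numbers through the sets \<open>pol g\<close> attached to the
  generators by polarization: the multidegrees are unions \<open>m\<close> of these sets, and the part of degree \<open>m\<close> is the
  homology of the sets of generators with union \<open>m\<close>.  Setting a polarized variable \<open>x\<close> to 1 gives a
  long exact sequence, from which \<open>P(G) = P(G/x) + (1 + t) K(t)\<close>, where \<open>K\<close> is the Hilbert series of the kernel of
  \<open>Tor(S/L) \<rightarrow> Tor(S/(G/x))\<close> and \<open>L\<close> is generated by the generators without \<open>x\<close>.  In particular Betti numbers do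
  not grow under such localizations, so one may assume that every further localization is a complete intersection.
  For such families a vertex \<open>x\<close> and a minimal vertex cover \<open>D\<close> of \<open>L\<close> can be chosen so that half of the \<open>2^|D|\<close>
  classes of \<open>Tor(S/L)\<close> seen at \<open>D\<close> lie in multidegrees that do not occur for \<open>G/x\<close>; they lie in the kernel, and
  \<open>|D| \<ge> c - 1\<close>.  Equality pins down \<open>K\<close>.
\<close>

section \<open>Linear algebra of finitely supported functions\<close>

text \<open>A class of \<open>L\<close> is certain to lie in the kernel when the target has nothing
  in its multidegree, so the target must be known exactly. A complete intersection has one class for
  each set of generators, placed at the union of the set; this is why everything is localized until
  each further localization is of this kind. At \<open>D\<close> the ideal \<open>L\<close> becomes
  the ideal of the variables in \<open>D\<close>, with one Koszul class for each subset of
  \<open>D\<close>. The target misses either the subsets containing a fixed \<open>d\<close>, with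
  series t(1+t)^(n-1), or those containing exactly one of \<open>d\<close> and \<open>d'\<close>,
  with series 2t(1+t)^(n-2), where n = |D|. Multiplied by 1+t and added to (1+t)^c for n = c-1, they
  give the two extremal polynomials, both of value 2^c + 2^(c-1) at 1. The obstacle is the choice of
  \<open>x\<close> and \<open>D\<close>. A minimal cover cannot be prescribed, but it can be made to
  avoid a set \<open>T\<close> that contains no generator of \<open>L\<close>, and then it has to
  contain each vertex whose addition to \<open>T\<close> completes such a generator. The height
  enters because a set of variables meeting every generator, such as \<open>x\<close> with
  \<open>D\<close>, generates a prime containing the ideal, of height at most its size.\<close>

context vector_space_pair begin

text \<open>A basis \<open>K\<close> of the kernel in \<open>V\<close> is extended to a basis
  \<open>B\<close> of \<open>V\<close>; then \<open>f\<close> is injective on the span of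
  \<open>B - K\<close> and maps it onto the image of \<open>V\<close>. The finite spanning set
  \<open>W\<close> stands for finite dimension, since the ambient space will be a space of all
  functions.\<close>

lemma rank_nullity_subspace:
  assumes f: "Vector_Spaces.linear s1 s2 f" and V: "vs1.subspace V" and W: "finite W" "V \<subseteq> vs1.span W"
  shows "vs1.dim V = vs1.dim {v\<in>V. f v = 0} + vs2.dim (f ` V)"
proof -
  interpret l: Vector_Spaces.linear s1 s2 f by (rule f)
  let ?K = "{v\<in>V. f v = 0}"
  obtain K where K: "K \<subseteq> ?K" "vs1.independent K" "?K \<subseteq> vs1.span K" "card K = vs1.dim ?K"
    using vs1.basis_exists by blast
  obtain B where B: "K \<subseteq> B" "B \<subseteq> V" "vs1.independent B" "V \<subseteq> vs1.span B"
    using vs1.maximal_independent_subset_extend[of K V] K by blast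
  have fB: "finite B"
    using vs1.independent_span_bound[OF W(1) B(3)] B(2) W(2) by blast
  have cB: "card B = vs1.dim V" using B vs1.basis_card_eq_dim by blast
  let ?C = "B - K"
  have spC: "vs1.span ?C \<subseteq> V" using B(2) V by (metis Diff_subset vs1.span_minimal subset_trans)
  have ker: "x = 0" if x: "x \<in> vs1.span ?C" "f x = 0" for x
  proof -
    have "x \<in> vs1.span K" using that spC K(3) by blast
    then obtain a where a: "x = (\<Sum>v\<in>K. s1 (a v) v)"
      using vs1.span_finite[OF finite_subset[OF B(1) fB]] by auto
    have "x \<in> range (\<lambda>u. \<Sum>v\<in>?C. s1 (u v) v)"
      using x(1) unfolding vs1.span_finite[OF finite_Diff[OF fB, of K]] .
    then obtain b where b: "x = (\<Sum>v\<in>?C. s1 (b v) v)" by (rule rangeE)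
    \<comment> \<open>A kernel vector in the span of \<open>B - K\<close> also lies in the span of
      \<open>K\<close>. The two expansions, subtracted, form a relation on \<open>B\<close>.\<close>
    let ?c = "\<lambda>v. if v \<in> K then a v else - b v"
    have "(\<Sum>v\<in>B. s1 (?c v) v) = (\<Sum>v\<in>K. s1 (?c v) v) + (\<Sum>v\<in>?C. s1 (?c v) v)"
      using sum.subset_diff[OF B(1) fB, of "\<lambda>v. s1 (?c v) v"] by (simp only: add.commute)
    also have "(\<Sum>v\<in>K. s1 (?c v) v) = x" using a by simp
    also have "(\<Sum>v\<in>?C. s1 (?c v) v) = - x" unfolding b sum_negf[symmetric]
      by (rule sum.cong) auto
    finally have "(\<Sum>v\<in>B. s1 (?c v) v) = 0" by simp
    moreover have "\<not> ((\<exists>v\<in>B. ?c v \<noteq> 0) \<and> (\<Sum>v\<in>B. s1 (?c v) v) = 0)"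
      using B(3) unfolding vs1.dependent_finite[OF fB] by (rule contrapos_nn) (rule exI)
    ultimately have "\<forall>v\<in>B. ?c v = 0" by simp
    then have "\<forall>v\<in>K. a v = 0" using B(1) by (metis (no_types, lifting) subsetD)
    then show ?thesis using a by simp
  qed
  have inj: "inj_on f (vs1.span ?C)"
    using linear_inj_on_iff_eq_0[OF f vs1.subspace_span, of ?C] ker by simp
  have ind: "vs2.independent (f ` ?C)"
    using linear_independent_injective_image[OF f vs1.independent_mono[OF B(3), of ?C] inj] by simp
  have sp: "f ` V \<subseteq> vs2.span (f ` ?C)"
  proof
    fix y assume "y \<in> f ` V"
    then obtain v where v: "v \<in> V" "y = f v" by blast
    then obtain u where u: "v = (\<Sum>w\<in>B. s1 (u w) w)"
      using vs1.span_finite[OF fB] B(4) by auto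
    have "y = (\<Sum>w\<in>B. s2 (u w) (f w))"
      unfolding v(2) u by (simp add: l.sum l.scale)
    also have "\<dots> = (\<Sum>w\<in>?C. s2 (u w) (f w))"
      using K(1) fB by (intro sum.mono_neutral_right) auto
    also have "\<dots> \<in> vs2.span (f ` ?C)"
      by (intro vs2.span_sum vs2.span_scale vs2.span_base) auto
    finally show "y \<in> vs2.span (f ` ?C)" .
  qed
  have "card (f ` ?C) = vs2.dim (f ` V)"
    using vs2.basis_card_eq_dim[OF _ sp ind] B(2) by blast
  moreover have "card (f ` ?C) = card ?C"
    by (rule card_image[OF inj_on_subset[OF inj vs1.span_superset]])
  moreover have "card ?C = card B - card K" by (rule card_Diff_subset[OF finite_subset[OF B(1) fB] B(1)])
  moreover have "card K \<le> card B" by (rule card_mono[OF fB B(1)])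
  ultimately show ?thesis using cB K(4) by linarith
qed

end

context vector_space begin

lemma dim_mono_finite:
  assumes "V \<subseteq> W" "finite F" "W \<subseteq> span F"
  shows "dim V \<le> dim W"
proof -
  obtain B where B: "B \<subseteq> V" "independent B" "V \<subseteq> span B" "card B = dim V"
    using basis_exists by blast
  obtain C where C: "B \<subseteq> C" "C \<subseteq> W" "independent C" "W \<subseteq> span C"
    using maximal_independent_subset_extend[of B W] B assms by blast
  have "finite C" using independent_span_bound[OF assms(2) C(3)] C(2) assms(3) by blast
  then show ?thesis using B C basis_card_eq_dim by (metis card_mono)
qed

lemma subspace_dim_eq_finite:
  assumes "V \<subseteq> W" "finite F" "W \<subseteq> span F" "subspace V" "dim W \<le> dim V"
  shows "V = W"
proof -
  obtain B where B: "B \<subseteq> V" "independent B" "V \<subseteq> span B" "card B = dim V"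
    using basis_exists by blast
  obtain C where C: "B \<subseteq> C" "C \<subseteq> W" "independent C" "W \<subseteq> span C"
    using maximal_independent_subset_extend[of B W] B assms by blast
  have fC: "finite C" using independent_span_bound[OF assms(2) C(3)] C(2) assms(3) by blast
  have "card C \<le> card B" using B C basis_card_eq_dim assms by metis
  then have "B = C" using C(1) fC by (simp add: card_seteq)
  then have "W \<subseteq> V" using C B assms by (metis span_minimal subset_trans)
  then show ?thesis using assms(1) by blast
qed

end

lemma sum_fun_at: "(\<Sum>x\<in>A. f x) y = (\<Sum>x\<in>A. f x y)"
  by (induction A rule: infinite_finite_induct) auto

definition fscale :: "'k::field \<Rightarrow> ('x \<Rightarrow> 'k) \<Rightarrow> 'x \<Rightarrow> 'k" where
  "fscale c f = (\<lambda>x. c * f x)"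

interpretation fv: vector_space "fscale :: 'k::field \<Rightarrow> ('x \<Rightarrow> 'k) \<Rightarrow> 'x \<Rightarrow> 'k"
  by unfold_locales (auto simp: fscale_def fun_eq_iff algebra_simps)

interpretation fvp: vector_space_pair
  "fscale :: 'k::field \<Rightarrow> ('x \<Rightarrow> 'k) \<Rightarrow> 'x \<Rightarrow> 'k" "fscale :: 'k::field \<Rightarrow> ('y \<Rightarrow> 'k) \<Rightarrow> 'y \<Rightarrow> 'k"
  ..

text \<open>Model of the free module on \<open>X\<close>. All modules with basis elements of one
  type live in one function type, so that inclusions of index sets become inclusions of
  modules.\<close>

definition fsupp :: "'x set \<Rightarrow> ('x \<Rightarrow> 'a::zero) set" where
  "fsupp X = {v. \<forall>x. x \<notin> X \<longrightarrow> v x = 0}"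

lemma fsuppD: "v \<in> fsupp X \<Longrightarrow> x \<notin> X \<Longrightarrow> v x = 0"
  by (auto simp: fsupp_def)

lemma fsupp_mono: "X \<subseteq> Y \<Longrightarrow> fsupp X \<subseteq> fsupp Y"
  by (auto simp: fsupp_def)

lemma subspace_fsupp: "fv.subspace (fsupp X :: ('x \<Rightarrow> 'k::field) set)"
  by (auto simp: fv.subspace_def fsupp_def fscale_def)

definition unit_fun :: "'x \<Rightarrow> 'x \<Rightarrow> 'a::{zero,one}" where
  "unit_fun x = (\<lambda>y. if y = x then 1 else 0)"

lemma fsupp_span:
  assumes "finite X"
  shows "fsupp X \<subseteq> fv.span (unit_fun ` X :: ('x \<Rightarrow> 'k::field) set)"
proof
  fix v :: "'x \<Rightarrow> 'k" assume v: "v \<in> fsupp X"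
  have "v = (\<Sum>x\<in>X. fscale (v x) (unit_fun x))"
  proof
    fix y
    have "(\<Sum>x\<in>X. fscale (v x) (unit_fun x)) y = (\<Sum>x\<in>X. if y = x then v x else 0)"
      unfolding sum_fun_at by (intro sum.cong) (auto simp: fscale_def unit_fun_def)
    also have "\<dots> = v y" using assms v by (auto simp: fsupp_def sum.delta)
    finally show "v y = (\<Sum>x\<in>X. fscale (v x) (unit_fun x)) y" by simp
  qed
  also have "\<dots> \<in> fv.span (unit_fun ` X)"
    by (intro fv.span_sum fv.span_scale fv.span_base) auto
  finally show "v \<in> fv.span (unit_fun ` X)" .
qed

lemma dim_fsupp:
  assumes "finite X"
  shows "fv.dim (fsupp X :: ('x \<Rightarrow> 'k::field) set) = card X"
proof -
  have inj: "inj (unit_fun :: 'x \<Rightarrow> 'x \<Rightarrow> 'k)"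
    by (metis injI unit_fun_def zero_neq_one)
  have ind: "fv.independent (unit_fun ` X :: ('x \<Rightarrow> 'k) set)"
  proof (rule fv.independent_if_scalars_zero)
    fix f :: "('x \<Rightarrow> 'k) \<Rightarrow> 'k" and u :: "'x \<Rightarrow> 'k"
    assume s: "(\<Sum>x\<in>unit_fun ` X. fscale (f x) x) = 0" and "u \<in> unit_fun ` X"
    then obtain y where y: "y \<in> X" "u = unit_fun y" by auto
    have "(\<Sum>x\<in>unit_fun ` X. fscale (f x) x) = (\<Sum>x\<in>X. fscale (f (unit_fun x)) (unit_fun x))"
      using inj by (subst sum.reindex) (auto simp: inj_on_def inj_def)
    then have "(\<Sum>x\<in>X. fscale (f (unit_fun x)) (unit_fun x)) y = 0"
      using s by simp
    moreover have "(\<Sum>x\<in>X. fscale (f (unit_fun x)) (unit_fun x)) y = (\<Sum>x\<in>X. if y = x then f (unit_fun x) else 0)"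
      unfolding sum_fun_at by (intro sum.cong) (auto simp: fscale_def unit_fun_def)
    ultimately show "f u = 0" using y assms by simp
  qed (use assms in auto)
  have "unit_fun ` X \<subseteq> (fsupp X :: ('x \<Rightarrow> 'k) set)"
    by (auto simp: unit_fun_def fsupp_def)
  then have "fv.dim (fsupp X :: ('x \<Rightarrow> 'k) set) = card (unit_fun ` X :: ('x \<Rightarrow> 'k) set)"
    using fv.basis_card_eq_dim[OF _ fsupp_span[OF assms] ind] by simp
  also have "\<dots> = card X" using inj by (metis card_image inj_on_subset subset_UNIV)
  finally show ?thesis .
qed

lemma fv_dim_mono:
  assumes "V \<subseteq> W" "finite X" "W \<subseteq> fsupp X"
  shows "fv.dim V \<le> fv.dim W"
  by (rule fv.dim_mono_finite[OF assms(1) finite_imageI[OF assms(2)] order_trans[OF assms(3) fsupp_span[OF assms(2)]]])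

lemma fv_subspace_eq:
  assumes "V \<subseteq> W" "finite X" "W \<subseteq> fsupp X" "fv.subspace V" "fv.dim W \<le> fv.dim V"
  shows "V = W"
  by (rule fv.subspace_dim_eq_finite[OF assms(1) finite_imageI[OF assms(2)] order_trans[OF assms(3) fsupp_span[OF assms(2)]] assms(4,5)])

lemma fv_rank_nullity:
  fixes f :: "('x \<Rightarrow> 'k::field) \<Rightarrow> 'y \<Rightarrow> 'k"
  assumes "Vector_Spaces.linear fscale fscale f" "fv.subspace V" "finite X" "V \<subseteq> fsupp X"
  shows "fv.dim V = fv.dim {v\<in>V. f v = 0} + fv.dim (f ` V)"
  by (rule fvp.rank_nullity_subspace[OF assms(1,2) finite_imageI[OF assms(3)] order_trans[OF assms(4) fsupp_span[OF assms(3)]]])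

lemma fv_dim_le_card:
  fixes V :: "('x \<Rightarrow> 'k::field) set"
  assumes "finite X" "V \<subseteq> fsupp X"
  shows "fv.dim V \<le> card X"
  using fv_dim_mono[OF assms(2) assms(1) order_refl] dim_fsupp[OF assms(1), where 'k='k] by simp

lemma fv_dim_zero: "fv.dim {0 :: 'x \<Rightarrow> 'k::field} = 0"
  using fv.basis_card_eq_dim[of "{}" "{0 :: 'x \<Rightarrow> 'k}"] by (simp add: fv.independent_empty)

lemma linear_fscaleI:
  assumes "\<And>u v x. f (\<lambda>y. u y + v y) x = f u x + f v x" "\<And>c v x. f (\<lambda>y. c * v y) x = c * f v x"
  shows "Vector_Spaces.linear fscale fscale f"
  using assms by unfold_locales (auto simp: fun_eq_iff fscale_def plus_fun_def)

section \<open>Complexes of finite sets\<close>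

text \<open>The incidence number of oriented simplices, with vertices ordered as natural numbers. It
  is polymorphic in the ring because the same signs serve the Taylor differential over the
  polynomial ring and the boundary map over the field.\<close>

definition inc :: "nat set \<Rightarrow> nat set \<Rightarrow> 'a::comm_ring_1" where
  "inc \<tau> \<sigma> = (if \<tau> \<subseteq> \<sigma> \<and> card (\<sigma> - \<tau>) = 1 then (-1) ^ card {h\<in>\<tau>. h < the_elem (\<sigma> - \<tau>)} else 0)"

lemma inc_insert: "g \<notin> \<tau> \<Longrightarrow> inc \<tau> (insert g \<tau>) = (-1) ^ card {h\<in>\<tau>. h < g}"
  by (auto simp: inc_def insert_Diff_if)

lemma inc_nonzeroE:
  assumes "inc \<tau> \<sigma> \<noteq> 0"
  obtains g where "g \<notin> \<tau>" "\<sigma> = insert g \<tau>"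
proof -
  have "\<tau> \<subseteq> \<sigma>" "card (\<sigma> - \<tau>) = 1" using assms by (auto simp: inc_def split: if_splits)
  then obtain g where "\<sigma> - \<tau> = {g}" using card_1_singletonE by blast
  then have "g \<notin> \<tau>" "\<sigma> = insert g \<tau>" using \<open>\<tau> \<subseteq> \<sigma>\<close> by auto
  then show ?thesis by (rule that)
qed

lemma inc_sq: "g \<notin> \<tau> \<Longrightarrow> inc \<tau> (insert g \<tau>) * inc \<tau> (insert g \<tau>) = (1 :: 'a::comm_ring_1)"
  by (simp add: inc_insert power_add[symmetric] mult_2[symmetric])

text \<open>Inserting the smaller vertex \<open>a\<close> first puts one more element below
  \<open>b\<close>, whereas \<open>b\<close> is never counted for \<open>a\<close>. The two routes
  therefore differ by one sign.\<close>

lemma inc_anticommute_less: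
  assumes "finite \<tau>" "a \<notin> \<tau>" "b \<notin> \<tau>" "a < b"
  shows "inc \<tau> (insert a \<tau>) * inc (insert a \<tau>) (insert b (insert a \<tau>)) =
         - (inc \<tau> (insert b \<tau>) * inc (insert b \<tau>) (insert a (insert b \<tau>)) :: 'a::comm_ring_1)"
proof -
  have 1: "{h \<in> insert a \<tau>. h < b} = insert a {h\<in>\<tau>. h < b}" using assms by auto
  have 2: "{h \<in> insert b \<tau>. h < a} = {h\<in>\<tau>. h < a}" using assms by auto
  have "inc (insert a \<tau>) (insert b (insert a \<tau>)) = (-1 :: 'a) ^ Suc (card {h\<in>\<tau>. h < b})"
    using inc_insert[of b "insert a \<tau>"] assms unfolding 1 by simp
  moreover have "inc (insert b \<tau>) (insert a (insert b \<tau>)) = (-1 :: 'a) ^ card {h\<in>\<tau>. h < a}"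
    using inc_insert[of a "insert b \<tau>"] assms unfolding 2 by simp
  ultimately show ?thesis using assms by (simp add: inc_insert mult.commute)
qed

lemma inc_anticommute:
  assumes "finite \<tau>" "a \<notin> \<tau>" "b \<notin> \<tau>" "a \<noteq> b"
  shows "inc \<tau> (insert a \<tau>) * inc (insert a \<tau>) (insert b (insert a \<tau>)) =
         - (inc \<tau> (insert b \<tau>) * inc (insert b \<tau>) (insert a (insert b \<tau>)) :: 'a::comm_ring_1)"
proof (cases "a < b")
  case True
  then show ?thesis by (rule inc_anticommute_less[OF assms(1-3)])
next
  case False
  then have "b < a" using assms(4) by simp
  show ?thesis unfolding inc_anticommute_less[OF assms(1,3,2) \<open>b < a\<close>, where 'a='a] minus_minus ..
qed

text \<open>Convexity in the lattice of sets is what makes the truncated boundary square to zero. It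
  covers simplicial complexes, differences of them (relative chains), and the sets of generators
  with a prescribed union.\<close>

definition interval_closed :: "nat set set \<Rightarrow> bool" where
  "interval_closed X \<longleftrightarrow> finite X \<and> (\<forall>\<sigma>\<in>X. finite \<sigma>) \<and>
     (\<forall>\<tau>\<in>X. \<forall>\<sigma>\<in>X. \<forall>\<rho>. \<tau> \<subseteq> \<rho> \<longrightarrow> \<rho> \<subseteq> \<sigma> \<longrightarrow> \<rho> \<in> X)"

lemma finite_interval_closed: "interval_closed X \<Longrightarrow> finite X"
  by (simp add: interval_closed_def)

lemma finite_interval_closed_elem: "interval_closed X \<Longrightarrow> \<sigma> \<in> X \<Longrightarrow> finite \<sigma>"
  by (simp add: interval_closed_def)

lemma interval_closedD:
  assumes "interval_closed X" "\<tau> \<in> X" "\<sigma> \<in> X" "\<tau> \<subseteq> \<rho>" "\<rho> \<subseteq> \<sigma>"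
  shows "\<rho> \<in> X"
proof -
  have "\<forall>\<tau>\<in>X. \<forall>\<sigma>\<in>X. \<forall>\<rho>. \<tau> \<subseteq> \<rho> \<longrightarrow> \<rho> \<subseteq> \<sigma> \<longrightarrow> \<rho> \<in> X"
    using assms(1) unfolding interval_closed_def by (elim conjE)
  from this[rule_format, OF assms(2-5)] show ?thesis .
qed

lemma sum_pair: "x \<noteq> y \<Longrightarrow> sum f {x, y} = f x + f y"
  by simp

text \<open>Two intermediate sets lie between sets that differ by two vertices; convexity puts both
  into \<open>X\<close>, and their contributions are opposite. In every other situation each summand
  vanishes.\<close>

lemma inc_inc_sum:
  assumes X: "interval_closed X" and t: "\<tau> \<in> X" and s: "\<sigma> \<in> X"
  shows "(\<Sum>\<rho>\<in>X. inc \<tau> \<rho> * inc \<rho> \<sigma> :: 'a::comm_ring_1) = 0"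
proof (cases "\<exists>a b. a \<notin> \<tau> \<and> b \<notin> \<tau> \<and> a \<noteq> b \<and> \<sigma> = insert b (insert a \<tau>)")
  case True
  then obtain a b where ab: "a \<notin> \<tau>" "b \<notin> \<tau>" "a \<noteq> b" "\<sigma> = insert b (insert a \<tau>)" by blast
  have ft: "finite \<tau>" by (rule finite_interval_closed_elem[OF X t])
  have mem: "insert a \<tau> \<in> X" "insert b \<tau> \<in> X"
    by (rule interval_closedD[OF X t s]; use ab(4) in auto)+
  have ne: "insert a \<tau> \<noteq> insert b \<tau>" using ab by blast
  have "(\<Sum>\<rho>\<in>X. inc \<tau> \<rho> * inc \<rho> \<sigma> :: 'a) = (\<Sum>\<rho>\<in>{insert a \<tau>, insert b \<tau>}. inc \<tau> \<rho> * inc \<rho> \<sigma>)"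
  proof (rule sum.mono_neutral_right)
    show "\<forall>\<rho>\<in>X - {insert a \<tau>, insert b \<tau>}. inc \<tau> \<rho> * inc \<rho> \<sigma> = (0 :: 'a)"
    proof (intro ballI, rule ccontr)
      fix \<rho> assume r: "\<rho> \<in> X - {insert a \<tau>, insert b \<tau>}" and "inc \<tau> \<rho> * inc \<rho> \<sigma> \<noteq> (0 :: 'a)"
      then have "inc \<tau> \<rho> \<noteq> (0::'a)" "inc \<rho> \<sigma> \<noteq> (0::'a)" by auto
      then obtain c d where c: "c \<notin> \<tau>" "\<rho> = insert c \<tau>" "\<sigma> = insert d \<rho>" by (metis inc_nonzeroE)
      then have "c \<in> insert b (insert a \<tau>)" using ab(4) by (metis insertI1 insertI2)
      then have "c = a \<or> c = b" using c(1) by auto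
      then show False using r c(2) by auto
    qed
  qed (use finite_interval_closed[OF X] mem in auto)
  also have "\<dots> = inc \<tau> (insert a \<tau>) * inc (insert a \<tau>) \<sigma> + inc \<tau> (insert b \<tau>) * inc (insert b \<tau>) \<sigma>"
    by (rule sum_pair[OF ne])
  also have "inc \<tau> (insert a \<tau>) * inc (insert a \<tau>) \<sigma> = - (inc \<tau> (insert b \<tau>) * inc (insert b \<tau>) \<sigma> :: 'a)"
  proof -
    have "\<sigma> = insert a (insert b \<tau>)" unfolding ab(4) by (rule insert_commute)
    then show ?thesis using inc_anticommute[OF ft ab(1,2,3), where 'a='a] ab(4) by (simp only:)
  qed
  also have "- (inc \<tau> (insert b \<tau>) * inc (insert b \<tau>) \<sigma>) + inc \<tau> (insert b \<tau>) * inc (insert b \<tau>) \<sigma> = (0 :: 'a)"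
    by simp
  finally show ?thesis .
next
  case False
  show ?thesis
  proof (rule sum.neutral, intro ballI, rule ccontr)
    fix \<rho> assume "inc \<tau> \<rho> * inc \<rho> \<sigma> \<noteq> (0 :: 'a)"
    then have "inc \<tau> \<rho> \<noteq> (0::'a)" "inc \<rho> \<sigma> \<noteq> (0::'a)" by auto
    then obtain c d where "c \<notin> \<tau>" "\<rho> = insert c \<tau>" "d \<notin> \<rho>" "\<sigma> = insert d \<rho>" by (metis inc_nonzeroE)
    then have "c \<notin> \<tau> \<and> d \<notin> \<tau> \<and> c \<noteq> d \<and> \<sigma> = insert d (insert c \<tau>)" by simp
    then show False using False by (metis (no_types))
  qed
qed

definition bd :: "nat set set \<Rightarrow> (nat set \<Rightarrow> 'a::comm_ring_1) \<Rightarrow> nat set \<Rightarrow> 'a" where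
  "bd X v = (\<lambda>\<tau>. if \<tau> \<in> X then \<Sum>\<sigma>\<in>X. inc \<tau> \<sigma> * v \<sigma> else 0)"

lemma linear_bd: "Vector_Spaces.linear fscale fscale (bd X :: (nat set \<Rightarrow> 'k::field) \<Rightarrow> _)"
  by (rule linear_fscaleI) (auto simp: bd_def algebra_simps sum.distrib sum_distrib_left)

lemma bd_bd:
  assumes "interval_closed X"
  shows "bd X (bd X v) = 0"
proof
  fix \<tau>
  show "bd X (bd X v) \<tau> = 0 \<tau>"
  proof (cases "\<tau> \<in> X")
    case True
    have "bd X (bd X v) \<tau> = (\<Sum>\<sigma>\<in>X. inc \<tau> \<sigma> * (\<Sum>\<rho>\<in>X. inc \<sigma> \<rho> * v \<rho>))"
      using True by (auto simp: bd_def intro!: sum.cong)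
    also have "\<dots> = (\<Sum>\<rho>\<in>X. (\<Sum>\<sigma>\<in>X. inc \<tau> \<sigma> * inc \<sigma> \<rho>) * v \<rho>)"
      unfolding sum_distrib_left sum_distrib_right
      by (subst sum.swap) (simp add: mult.assoc)
    also have "\<dots> = 0"
      by (rule sum.neutral) (simp add: inc_inc_sum[OF assms True])
    finally show ?thesis by simp
  qed (simp add: bd_def)
qed

text \<open>Toggling the vertex \<open>g\<close> contracts every complex that is invariant under it.\<close>

definition cone :: "nat \<Rightarrow> (nat set \<Rightarrow> 'a::comm_ring_1) \<Rightarrow> nat set \<Rightarrow> 'a" where
  "cone g v = (\<lambda>\<sigma>. if g \<in> \<sigma> then inc (\<sigma> - {g}) \<sigma> * v (\<sigma> - {g}) else 0)"

text \<open>Cancellation for the homotopy formula: \<open>p\<close> and \<open>s\<close> are signs,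
  and the third assumption is the anticommutation of two insertions.\<close>

lemma sign_cancel:
  fixes p :: "'a::comm_ring_1"
  assumes "p * p = 1" "s * s = 1" "p * q = - (r * s)"
  shows "q * (s * w) + p * (r * w) = 0"
proof -
  have "q * s = (p * p) * (q * s)" using assms(1) by simp
  also have "\<dots> = p * (p * q) * s" by (simp only: ac_simps)
  also have "\<dots> = - (p * r * (s * s))" unfolding assms(3) by (simp add: ac_simps)
  finally have "q * s = - (p * r)" using assms(2) by simp
  then show ?thesis by (simp add: mult.assoc[symmetric])
qed

text \<open>The formula dh + hd = id. If \<open>g\<close> is not in \<open>\<tau>\<close>, only the
  coface \<open>insert g \<tau>\<close> contributes, with its sign squared. If \<open>g\<close> is
  in \<open>\<tau>\<close>, the term of \<open>\<tau>\<close> itself survives from hd, and the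
  others cancel against dh by anticommutation.\<close>

lemma bd_cone:
  fixes v :: "nat set \<Rightarrow> 'a::comm_ring_1"
  assumes X: "finite X" "\<And>\<sigma>. \<sigma> \<in> X \<Longrightarrow> finite \<sigma>"
    and tog: "\<And>\<sigma>. \<sigma> \<in> X \<Longrightarrow> insert g \<sigma> \<in> X" "\<And>\<sigma>. \<sigma> \<in> X \<Longrightarrow> \<sigma> - {g} \<in> X"
    and t: "\<tau> \<in> X"
  shows "bd X (cone g v) \<tau> + cone g (bd X v) \<tau> = v \<tau>"
proof (cases "g \<in> \<tau>")
  case False
  have "bd X (cone g v) \<tau> = (\<Sum>\<sigma>\<in>X. inc \<tau> \<sigma> * cone g v \<sigma>)" using t by (simp add: bd_def)
  also have "\<dots> = (\<Sum>\<sigma>\<in>{insert g \<tau>}. inc \<tau> \<sigma> * cone g v \<sigma>)"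
  proof (rule sum.mono_neutral_right)
    show "\<forall>\<sigma>\<in>X - {insert g \<tau>}. inc \<tau> \<sigma> * cone g v \<sigma> = 0"
    proof (intro ballI, rule ccontr)
      fix \<sigma> assume s: "\<sigma> \<in> X - {insert g \<tau>}" and n: "inc \<tau> \<sigma> * cone g v \<sigma> \<noteq> 0"
      then have "inc \<tau> \<sigma> \<noteq> (0::'a)" "g \<in> \<sigma>" by (auto simp: cone_def split: if_splits)
      then show False using False s by (metis Diff_iff inc_nonzeroE insertE insertI1)
    qed
  qed (use X tog t in auto)
  also have "\<dots> = v \<tau>" using False inc_sq[OF False, where 'a='a] by (simp add: cone_def mult.assoc[symmetric])
  finally show ?thesis using False by (simp add: cone_def)
next
  case True
  let ?r = "\<tau> - {g}"
  have rX: "?r \<in> X" using tog(2) t by blast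
  have ft: "finite \<tau>" using X t by auto
  have rt: "insert g ?r = \<tau>" using True by auto
  have 1: "bd X (cone g v) \<tau> = (\<Sum>\<sigma>\<in>{\<sigma>\<in>X. g \<in> \<sigma>}. inc \<tau> \<sigma> * (inc (\<sigma> - {g}) \<sigma> * v (\<sigma> - {g})))"
    unfolding bd_def cone_def using t X
    by (simp, intro sum.mono_neutral_cong_right) auto
  also have "\<dots> = (\<Sum>\<sigma>\<in>{\<sigma>\<in>X. g \<notin> \<sigma>}. inc \<tau> (insert g \<sigma>) * (inc \<sigma> (insert g \<sigma>) * v \<sigma>))"
  proof (rule sum.reindex_bij_witness[of _ "insert g" "\<lambda>\<sigma>. \<sigma> - {g}"])
    fix a assume "a \<in> {\<sigma> \<in> X. g \<in> \<sigma>}"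
    then show "insert g (a - {g}) = a" "a - {g} \<in> {\<sigma> \<in> X. g \<notin> \<sigma>}"
      "inc \<tau> (insert g (a - {g})) * (inc (a - {g}) (insert g (a - {g})) * v (a - {g})) =
         inc \<tau> a * (inc (a - {g}) a * v (a - {g}))"
      using tog by (auto simp: insert_absorb)
  next
    fix b assume "b \<in> {\<sigma> \<in> X. g \<notin> \<sigma>}"
    then show "insert g b - {g} = b" "insert g b \<in> {\<sigma> \<in> X. g \<in> \<sigma>}" using tog by auto
  qed
  finally have L: "bd X (cone g v) \<tau> = (\<Sum>\<sigma>\<in>{\<sigma>\<in>X. g \<notin> \<sigma>}. inc \<tau> (insert g \<sigma>) * (inc \<sigma> (insert g \<sigma>) * v \<sigma>))" .
  have "cone g (bd X v) \<tau> = inc ?r \<tau> * (\<Sum>\<sigma>\<in>X. inc ?r \<sigma> * v \<sigma>)"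
    using True rX by (simp add: cone_def bd_def)
  also have "(\<Sum>\<sigma>\<in>X. inc ?r \<sigma> * v \<sigma>) = inc ?r \<tau> * v \<tau> + (\<Sum>\<sigma>\<in>X - {\<tau>}. inc ?r \<sigma> * v \<sigma>)"
    using X t by (simp add: sum.remove)
  also have "(\<Sum>\<sigma>\<in>X - {\<tau>}. inc ?r \<sigma> * v \<sigma>) = (\<Sum>\<sigma>\<in>{\<sigma>\<in>X. g \<notin> \<sigma>}. inc ?r \<sigma> * v \<sigma>)"
  proof (rule sum.mono_neutral_right)
    show "\<forall>\<sigma>\<in>X - {\<tau>} - {\<sigma> \<in> X. g \<notin> \<sigma>}. inc ?r \<sigma> * v \<sigma> = 0"
    proof (intro ballI, rule ccontr)
      fix \<sigma> assume s: "\<sigma> \<in> X - {\<tau>} - {\<sigma> \<in> X. g \<notin> \<sigma>}" and n: "inc ?r \<sigma> * v \<sigma> \<noteq> 0"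
      then have "inc ?r \<sigma> \<noteq> (0::'a)" "g \<in> \<sigma>" by auto
      then obtain c where "c \<notin> ?r" "\<sigma> = insert c ?r" by (metis inc_nonzeroE)
      moreover have "c = g" using \<open>g \<in> \<sigma>\<close> \<open>\<sigma> = insert c ?r\<close> by blast
      ultimately show False using s rt by blast
    qed
  qed (use X True in auto)
  finally have R: "cone g (bd X v) \<tau> = v \<tau> + inc ?r \<tau> * (\<Sum>\<sigma>\<in>{\<sigma>\<in>X. g \<notin> \<sigma>}. inc ?r \<sigma> * v \<sigma>)"
    using inc_sq[of g ?r, where 'a='a] rt by (simp add: algebra_simps)
  have "(\<Sum>\<sigma>\<in>{\<sigma>\<in>X. g \<notin> \<sigma>}. inc \<tau> (insert g \<sigma>) * (inc \<sigma> (insert g \<sigma>) * v \<sigma>))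
      + inc ?r \<tau> * (\<Sum>\<sigma>\<in>{\<sigma>\<in>X. g \<notin> \<sigma>}. inc ?r \<sigma> * v \<sigma>) = 0"
    unfolding sum_distrib_left sum.distrib[symmetric]
  proof (rule sum.neutral, intro ballI)
    fix \<sigma> assume s: "\<sigma> \<in> {\<sigma>\<in>X. g \<notin> \<sigma>}"
    show "inc \<tau> (insert g \<sigma>) * (inc \<sigma> (insert g \<sigma>) * v \<sigma>) + inc ?r \<tau> * (inc ?r \<sigma> * v \<sigma>) = 0"
    proof (cases "\<exists>c. c \<notin> ?r \<and> c \<noteq> g \<and> \<sigma> = insert c ?r")
      case T: True
      then obtain c where c: "c \<notin> ?r" "c \<noteq> g" "\<sigma> = insert c ?r" by blast
      have a: "inc ?r (insert g ?r) * inc (insert g ?r) (insert c (insert g ?r)) =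
         - (inc ?r (insert c ?r) * inc (insert c ?r) (insert g (insert c ?r)) :: 'a)"
        by (rule inc_anticommute) (use ft c in auto)
      have q1: "inc ?r \<tau> * inc ?r \<tau> = (1::'a)" using inc_sq[of g ?r, where 'a='a] rt by simp
      have a': "inc ?r \<tau> * inc \<tau> (insert g \<sigma>) = - (inc ?r \<sigma> * inc \<sigma> (insert g \<sigma>) :: 'a)"
        using a unfolding rt c(3) insert_commute[of g c] .
      have q3: "inc \<sigma> (insert g \<sigma>) * inc \<sigma> (insert g \<sigma>) = (1::'a)"
        using inc_sq[of g \<sigma>] s by auto
      show ?thesis by (rule sign_cancel[OF q1 q3 a'])
    next
      case F: False
      have "inc ?r \<sigma> = (0::'a)"
      proof (rule ccontr)
        assume "inc ?r \<sigma> \<noteq> (0::'a)"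
        then obtain c where "c \<notin> ?r" "\<sigma> = insert c ?r" by (metis inc_nonzeroE)
        then show False using F s rt by auto
      qed
      moreover have "inc \<tau> (insert g \<sigma>) = (0::'a)"
      proof (rule ccontr)
        assume "inc \<tau> (insert g \<sigma>) \<noteq> (0::'a)"
        then obtain c where c: "c \<notin> \<tau>" "insert g \<sigma> = insert c \<tau>" by (metis inc_nonzeroE)
        then have "\<sigma> = insert c ?r" "c \<noteq> g" using s True by auto
        then show False using F c by auto
      qed
      ultimately show ?thesis by simp
    qed
  qed
  then show ?thesis unfolding L R by (simp only: add_eq_0_iff) (simp add: algebra_simps)
qed

section \<open>Homology graded by cardinality\<close>

definition level :: "nat set set \<Rightarrow> nat \<Rightarrow> nat set set" where
  "level X i = {\<sigma>\<in>X. card \<sigma> = i}"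

definition cycles :: "nat set set \<Rightarrow> nat \<Rightarrow> (nat set \<Rightarrow> 'k::field) set" where
  "cycles X i = {v \<in> fsupp (level X i). bd X v = 0}"

text \<open>Indexed by the source: these chains sit one level below \<open>i\<close>, so that the
  boundaries among the cycles of degree \<open>i\<close> have index \<open>Suc i\<close>.\<close>

definition bounds :: "nat set set \<Rightarrow> nat \<Rightarrow> (nat set \<Rightarrow> 'k::field) set" where
  "bounds X i = bd X ` fsupp (level X i)"

text \<open>The degree is the cardinality, not the dimension, of a simplex, and thus agrees with the
  homological degree in Tor. Integer values allow exact sequences to be rearranged without truncated
  subtraction.\<close>

definition hdim :: "'k::field itself \<Rightarrow> nat set set \<Rightarrow> nat \<Rightarrow> int" where
  "hdim _ X i = int (fv.dim (cycles X i :: (nat set \<Rightarrow> 'k) set)) - int (fv.dim (bounds X (Suc i) :: (nat set \<Rightarrow> 'k) set))"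

lemma level_subset: "level X i \<subseteq> X" by (auto simp: level_def)

lemma bd_fsupp_level:
  assumes X: "interval_closed X" and v: "v \<in> fsupp (level X (Suc i))"
  shows "bd X v \<in> fsupp (level X i)"
  unfolding fsupp_def
proof (intro CollectI allI impI, rule ccontr)
  fix \<tau> assume t: "\<tau> \<notin> level X i" and n: "bd X v \<tau> \<noteq> 0"
  then have tX: "\<tau> \<in> X" by (auto simp: bd_def split: if_splits)
  with n obtain \<sigma> where s: "\<sigma> \<in> X" "inc \<tau> \<sigma> * v \<sigma> \<noteq> 0"
    by (auto simp: bd_def dest: sum.not_neutral_contains_not_neutral)
  then have "card \<sigma> = Suc i" using v by (auto simp: fsupp_def level_def)
  moreover obtain g where "g \<notin> \<tau>" "\<sigma> = insert g \<tau>" using s by (metis inc_nonzeroE mult_zero_left)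
  moreover have "finite \<tau>" by (rule finite_interval_closed_elem[OF X tX])
  ultimately show False using t tX by (auto simp: level_def)
qed

lemma bd_level_0:
  assumes X: "interval_closed X" and v: "v \<in> fsupp (level X 0)"
  shows "bd X v = 0"
proof
  fix \<tau> show "bd X v \<tau> = 0 \<tau>"
  proof (rule ccontr)
    assume n: "bd X v \<tau> \<noteq> 0 \<tau>"
    then have tX: "\<tau> \<in> X" by (auto simp: bd_def split: if_splits)
    with n obtain \<sigma> where s: "\<sigma> \<in> X" "inc \<tau> \<sigma> * v \<sigma> \<noteq> 0"
      by (auto simp: bd_def dest: sum.not_neutral_contains_not_neutral)
    then have "card \<sigma> = 0" using v by (auto simp: fsupp_def level_def)
    moreover obtain g where "g \<notin> \<tau>" "\<sigma> = insert g \<tau>" using s by (metis inc_nonzeroE mult_zero_left)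
    moreover have "finite \<sigma>" by (rule finite_interval_closed_elem[OF X s(1)])
    ultimately show False by auto
  qed
qed

lemma subspace_cycles: "fv.subspace (cycles X i :: (nat set \<Rightarrow> 'k::field) set)"
proof -
  interpret l: Vector_Spaces.linear fscale fscale "bd X :: (nat set \<Rightarrow> 'k) \<Rightarrow> _" by (rule linear_bd)
  show ?thesis unfolding fv.subspace_def cycles_def
    using subspace_fsupp[of "level X i", where 'k='k]
    by (auto simp: fv.subspace_def l.add l.scale l.zero)
qed

lemma subspace_bounds: "fv.subspace (bounds X i)"
  unfolding bounds_def by (rule fvp.linear_subspace_image[OF linear_bd subspace_fsupp])

lemma cycles_fsupp: "(cycles X i :: (nat set \<Rightarrow> 'k::field) set) \<subseteq> fsupp X"
  unfolding cycles_def using subsetD[OF fsupp_mono[OF level_subset[of X i]]] by auto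

lemma bounds_fsupp: "bounds X i \<subseteq> fsupp X"
  unfolding bounds_def by (rule image_subsetI) (simp add: fsupp_def bd_def)

lemma bounds_Suc_cycles: "interval_closed X \<Longrightarrow> (bounds X (Suc i) :: (nat set \<Rightarrow> 'k::field) set) \<subseteq> cycles X i"
proof
  fix w :: "nat set \<Rightarrow> 'k" assume X: "interval_closed X" and "w \<in> bounds X (Suc i)"
  then obtain v where v: "v \<in> fsupp (level X (Suc i))" "w = bd X v" unfolding bounds_def by (elim imageE)
  then show "w \<in> cycles X i" by (simp add: cycles_def bd_bd[OF X] bd_fsupp_level[OF X])
qed

lemma hdim_nonneg:
  assumes "interval_closed X"
  shows "hdim TYPE('k::field) X i \<ge> 0"
proof -
  have "fv.dim (bounds X (Suc i) :: (nat set \<Rightarrow> 'k) set) \<le> fv.dim (cycles X i :: (nat set \<Rightarrow> 'k) set)"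
    by (rule fv_dim_mono[OF bounds_Suc_cycles[OF assms] finite_interval_closed[OF assms] cycles_fsupp])
  then show ?thesis by (simp add: hdim_def)
qed

lemma hdim_zeroD:
  assumes "interval_closed X" "hdim TYPE('k::field) X i = 0"
  shows "bounds X (Suc i) = (cycles X i :: (nat set \<Rightarrow> 'k) set)"
  by (rule fv_subspace_eq[OF bounds_Suc_cycles[OF assms(1)] finite_interval_closed[OF assms(1)]
        cycles_fsupp subspace_bounds]) (use assms(2) in \<open>simp add: hdim_def\<close>)

lemma rank_nullity_level:
  assumes "interval_closed X"
  shows "card (level X i) = fv.dim (cycles X i :: (nat set \<Rightarrow> 'k::field) set) + fv.dim (bounds X i :: (nat set \<Rightarrow> 'k) set)"
proof -
  have "finite (level X i)" by (rule finite_subset[OF level_subset finite_interval_closed[OF assms]])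
  from fv_rank_nullity[OF linear_bd[where 'k='k] subspace_fsupp this order_refl, of X] dim_fsupp[OF this, where 'k='k]
  show ?thesis by (simp add: cycles_def bounds_def)
qed

text \<open>The numbers \<open>kap X Y\<close> are the dimensions of the kernels of \<open>H(Y) \<rightarrow> H(X)\<close>, shifted by one.\<close>

definition kap :: "'k::field itself \<Rightarrow> nat set set \<Rightarrow> nat set set \<Rightarrow> nat \<Rightarrow> int" where
  "kap _ X Y i = int (fv.dim (bounds X i \<inter> fsupp Y :: (nat set \<Rightarrow> 'k) set)) - int (fv.dim (bounds Y i :: (nat set \<Rightarrow> 'k) set))"

section \<open>Subcomplexes and the long exact sequence\<close>

definition proj :: "'x set \<Rightarrow> ('x \<Rightarrow> 'a::zero) \<Rightarrow> 'x \<Rightarrow> 'a" where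
  "proj W v = (\<lambda>x. if x \<in> W then v x else 0)"

lemma linear_proj: "Vector_Spaces.linear fscale fscale (proj W :: ('x \<Rightarrow> 'k::field) \<Rightarrow> _)"
  by (rule linear_fscaleI) (simp_all add: proj_def)

text \<open>As a lower set of \<open>X\<close>, the family \<open>Y\<close> carries a subcomplex,
  and \<open>X - Y\<close> with its own boundary is the quotient complex;
  \<open>proj (X - Y)\<close> is the quotient map.\<close>

locale subcomplex =
  fixes X Y :: "nat set set"
  assumes X: "interval_closed X" and YX: "Y \<subseteq> X"
    and down: "\<And>\<sigma> \<tau>. \<sigma> \<in> Y \<Longrightarrow> \<tau> \<in> X \<Longrightarrow> \<tau> \<subseteq> \<sigma> \<Longrightarrow> \<tau> \<in> Y"
begin

lemma Y: "interval_closed Y"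
  unfolding interval_closed_def
proof (intro conjI ballI allI impI)
  show "finite Y" by (rule finite_subset[OF YX finite_interval_closed[OF X]])
  show "finite \<sigma>" if "\<sigma> \<in> Y" for \<sigma> using finite_interval_closed_elem[OF X] YX that by auto
  show "\<rho> \<in> Y" if "\<tau> \<in> Y" "\<sigma> \<in> Y" "\<tau> \<subseteq> \<rho>" "\<rho> \<subseteq> \<sigma>" for \<tau> \<sigma> \<rho>
  proof -
    have "\<tau> \<in> X" "\<sigma> \<in> X" using that YX by auto
    then have "\<rho> \<in> X" using interval_closedD[OF X _ _ that(3,4)] by simp
    then show ?thesis using down that by blast
  qed
qed

lemma W: "interval_closed (X - Y)"
  unfolding interval_closed_def
proof (intro conjI ballI allI impI)
  show "finite (X - Y)" using finite_interval_closed[OF X] by simp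
  show "finite \<sigma>" if "\<sigma> \<in> X - Y" for \<sigma> using finite_interval_closed_elem[OF X] that by auto
  show "\<rho> \<in> X - Y" if "\<tau> \<in> X - Y" "\<sigma> \<in> X - Y" "\<tau> \<subseteq> \<rho>" "\<rho> \<subseteq> \<sigma>" for \<tau> \<sigma> \<rho>
  proof -
    have "\<rho> \<in> X" using interval_closedD[OF X _ _ that(3,4)] that(1,2) by simp
    then show ?thesis using down that by blast
  qed
qed

lemma bd_fsupp: "bd X v \<in> fsupp X"
  by (simp add: bd_def fsupp_def)

lemma bd_sub:
  assumes "v \<in> fsupp Y"
  shows "bd X v = bd Y v"
proof
  fix \<tau>
  have fX: "finite X" by (rule finite_interval_closed[OF X])
  have "(\<Sum>\<sigma>\<in>X. inc \<tau> \<sigma> * v \<sigma>) = (\<Sum>\<sigma>\<in>Y. inc \<tau> \<sigma> * v \<sigma>)"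
    using assms YX fX by (intro sum.mono_neutral_right) (auto simp: fsupp_def)
  moreover have "(\<Sum>\<sigma>\<in>Y. inc \<tau> \<sigma> * v \<sigma>) = 0" if "\<tau> \<in> X" "\<tau> \<notin> Y"
    by (rule sum.neutral) (metis down inc_nonzeroE mult_zero_left subset_insertI that)
  ultimately show "bd X v \<tau> = bd Y v \<tau>" using YX unfolding bd_def by (metis subsetD)
qed

text \<open>Faces in \<open>X\<close> of a set in \<open>Y\<close> stay in \<open>Y\<close>, so the
  part of a chain on \<open>Y\<close> contributes nothing on \<open>X - Y\<close>.\<close>

lemma bd_quot: "proj (X - Y) (bd X v) = bd (X - Y) (proj (X - Y) v)"
proof
  fix \<tau>
  have fX: "finite X" by (rule finite_interval_closed[OF X])
  show "proj (X - Y) (bd X v) \<tau> = bd (X - Y) (proj (X - Y) v) \<tau>"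
  proof (cases "\<tau> \<in> X - Y")
    case True
    have "inc \<tau> \<sigma> * v \<sigma> = 0" if "\<sigma> \<in> Y" for \<sigma>
      by (metis True down inc_nonzeroE mult_zero_left subset_insertI that DiffD1 DiffD2)
    then have "(\<Sum>\<sigma>\<in>X. inc \<tau> \<sigma> * v \<sigma>) = (\<Sum>\<sigma>\<in>X-Y. inc \<tau> \<sigma> * v \<sigma>)"
      using fX by (intro sum.mono_neutral_right) auto
    also have "\<dots> = (\<Sum>\<sigma>\<in>X-Y. inc \<tau> \<sigma> * proj (X - Y) v \<sigma>)"
      by (rule sum.cong) (auto simp: proj_def)
    finally have "(\<Sum>\<sigma>\<in>X. inc \<tau> \<sigma> * v \<sigma>) = \<dots>" .
    moreover have "proj (X - Y) (bd X v) \<tau> = (\<Sum>\<sigma>\<in>X. inc \<tau> \<sigma> * v \<sigma>)"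
      using True by (simp add: proj_def bd_def)
    moreover have "bd (X - Y) (proj (X - Y) v) \<tau> = (\<Sum>\<sigma>\<in>X-Y. inc \<tau> \<sigma> * proj (X - Y) v \<sigma>)"
      using True by (simp add: bd_def)
    ultimately show ?thesis by simp
  next
    case False
    then show ?thesis unfolding bd_def proj_def by (simp only: if_False)
  qed
qed

lemma proj_eq_0_iff:
  assumes "v \<in> fsupp X"
  shows "proj (X - Y) v = 0 \<longleftrightarrow> v \<in> fsupp Y"
proof -
  have "proj (X - Y) v = 0 \<longleftrightarrow> (\<forall>x. x \<in> X - Y \<longrightarrow> v x = 0)"
    by (simp add: proj_def fun_eq_iff)
  also have "\<dots> \<longleftrightarrow> (\<forall>x. x \<notin> Y \<longrightarrow> v x = 0)" using fsuppD[OF assms] by blast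
  finally show ?thesis by (simp add: fsupp_def)
qed

lemma kap_nonneg: "kap TYPE('k::field) X Y i \<ge> 0"
proof -
  have "bounds Y i \<subseteq> (bounds X i \<inter> fsupp Y :: (nat set \<Rightarrow> 'k) set)"
  proof
    fix w :: "nat set \<Rightarrow> 'k" assume "w \<in> bounds Y i"
    then obtain v where v: "v \<in> fsupp (level Y i)" "w = bd Y v" by (auto simp: bounds_def)
    then have "v \<in> fsupp (level X i)" "v \<in> fsupp Y" using YX by (auto simp: fsupp_def level_def)
    then have "w = bd X v" using v bd_sub by metis
    moreover have "w \<in> fsupp Y" using v by (auto simp: bd_def fsupp_def)
    ultimately show "w \<in> bounds X i \<inter> fsupp Y" using \<open>v \<in> fsupp (level X i)\<close> by (auto simp: bounds_def)
  qed
  from fv_dim_mono[OF this finite_interval_closed[OF Y]] show ?thesis by (simp add: kap_def)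
qed

text \<open>Every cycle of \<open>Y\<close> in degree \<open>i\<close> bounds in \<open>X\<close>,
  so the kernel is all of the homology of \<open>Y\<close>.\<close>

lemma kap_eq_hdim:
  assumes "hdim TYPE('k::field) X i = 0"
  shows "kap TYPE('k) X Y (Suc i) = hdim TYPE('k) Y i"
proof -
  have b: "bounds X (Suc i) = (cycles X i :: (nat set \<Rightarrow> 'k) set)" by (rule hdim_zeroD[OF X assms])
  have "cycles X i \<inter> fsupp Y = (cycles Y i :: (nat set \<Rightarrow> 'k) set)"
  proof -
    have "v \<in> fsupp (level Y i) \<longleftrightarrow> v \<in> fsupp (level X i) \<and> v \<in> fsupp Y" for v :: "nat set \<Rightarrow> 'k"
      using YX by (auto simp: fsupp_def level_def)
    then show ?thesis using bd_sub unfolding cycles_def by fastforce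
  qed
  then show ?thesis by (simp add: kap_def hdim_def b)
qed

text \<open>The long exact sequence in numerical form: \<open>kap\<close> at \<open>i\<close> is the
  rank of the connecting map out of degree \<open>i\<close> of the quotient, and \<open>kap\<close>
  at \<open>Suc i\<close> corrects the rank of the map from \<open>Y\<close> to \<open>X\<close>.
  The proof counts dimensions of chain spaces and never forms the connecting map.\<close>

theorem hdim_exact:
  "hdim TYPE('k::field) (X - Y) i + hdim TYPE('k) Y i =
    hdim TYPE('k) X i + kap TYPE('k) X Y i + kap TYPE('k) X Y (Suc i)"
proof -
  have fX: "finite X" by (rule finite_interval_closed[OF X])
  have fY: "finite (level Y i)" using finite_subset[OF level_subset finite_interval_closed[OF Y]] .
  have B: "fv.dim (bounds X i :: (nat set \<Rightarrow> 'k) set) =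
      fv.dim (bounds X i \<inter> fsupp Y :: (nat set \<Rightarrow> 'k) set) + fv.dim (bounds (X - Y) i :: (nat set \<Rightarrow> 'k) set)" for i
  proof -
    have "{v \<in> bounds X i. proj (X - Y) v = 0} = (bounds X i \<inter> fsupp Y :: (nat set \<Rightarrow> 'k) set)"
      using proj_eq_0_iff subsetD[OF bounds_fsupp[of X i]] by (auto simp del: One_nat_def)
    moreover have "proj (X - Y) ` bounds X i = (bounds (X - Y) i :: (nat set \<Rightarrow> 'k) set)"
    proof
      show "proj (X - Y) ` bounds X i \<subseteq> (bounds (X - Y) i :: (nat set \<Rightarrow> 'k) set)"
      proof
        fix w :: "nat set \<Rightarrow> 'k" assume "w \<in> proj (X - Y) ` bounds X i"
        then obtain v where v: "v \<in> fsupp (level X i)" "w = proj (X - Y) (bd X v)" by (auto simp: bounds_def)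
        have "proj (X - Y) v \<in> fsupp (level (X - Y) i)" using v(1) by (auto simp: fsupp_def proj_def level_def)
        then show "w \<in> bounds (X - Y) i" using v(2) bd_quot by (auto simp: bounds_def)
      qed
      show "bounds (X - Y) i \<subseteq> (proj (X - Y) ` bounds X i :: (nat set \<Rightarrow> 'k) set)"
      proof
        fix w :: "nat set \<Rightarrow> 'k" assume "w \<in> bounds (X - Y) i"
        then obtain v where v: "v \<in> fsupp (level (X - Y) i)" "w = bd (X - Y) v" by (auto simp: bounds_def)
        have "proj (X - Y) v = v" "v \<in> fsupp (level X i)" using v(1) by (auto simp: fsupp_def proj_def level_def fun_eq_iff)
        then have "w = proj (X - Y) (bd X v)" "bd X v \<in> bounds X i" using v(2) bd_quot[of v] by (auto simp: bounds_def)
        then show "w \<in> proj (X - Y) ` bounds X i" by (rule image_eqI)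
      qed
    qed
    ultimately show ?thesis using fv_rank_nullity[of "proj (X - Y)" "bounds X i :: (nat set \<Rightarrow> 'k) set" X, OF linear_proj subspace_bounds fX bounds_fsupp] by simp
  qed
  \<comment> \<open>Chains of \<open>X\<close> whose boundary lies in \<open>Y\<close>, the relative
    cycles. Their dimension is computed twice, through the projection to \<open>X - Y\<close> and
    through the boundary map.\<close>
  let ?Z = "{v \<in> fsupp (level X i). bd X v \<in> fsupp Y} :: (nat set \<Rightarrow> 'k) set"
  have ZX: "?Z \<subseteq> fsupp X" using subsetD[OF fsupp_mono[OF level_subset[of X i]]] by auto
  have sZ: "fv.subspace ?Z"
  proof -
    interpret l: Vector_Spaces.linear fscale fscale "bd X :: (nat set \<Rightarrow> 'k) \<Rightarrow> _" by (rule linear_bd)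
    show ?thesis unfolding fv.subspace_def
      using subspace_fsupp[of "level X i", where 'k='k] subspace_fsupp[of Y, where 'k='k]
      by (auto simp: fv.subspace_def l.add l.scale l.zero)
  qed
  have Z1: "fv.dim ?Z = card (level Y i) + fv.dim (cycles (X - Y) i :: (nat set \<Rightarrow> 'k) set)"
  proof -
    have "{v \<in> ?Z. proj (X - Y) v = 0} = fsupp (level Y i)"
    proof -
      have l1: "v \<in> fsupp (level Y i) \<longleftrightarrow> v \<in> fsupp (level X i) \<and> v \<in> fsupp Y" for v :: "nat set \<Rightarrow> 'k"
        using YX by (auto simp: fsupp_def level_def)
      have l2: "bd X v \<in> fsupp Y" if "v \<in> fsupp Y" for v :: "nat set \<Rightarrow> 'k"
        unfolding bd_sub[OF that] by (auto simp: bd_def fsupp_def)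
      have l3: "v \<in> fsupp X" if "v \<in> fsupp (level X i)" for v :: "nat set \<Rightarrow> 'k"
        using that fsupp_mono[OF level_subset[of X i]] by (rule subsetD[rotated])
      show ?thesis
      proof (intro set_eqI iffI)
        fix v assume v: "v \<in> {v \<in> ?Z. proj (X - Y) v = 0}"
        then have "v \<in> fsupp (level X i)" "proj (X - Y) v = 0" by simp_all
        then have "v \<in> fsupp Y" using proj_eq_0_iff[OF l3[of v]] by simp
        then show "v \<in> fsupp (level Y i)" using v l1 by simp
      next
        fix v :: "nat set \<Rightarrow> 'k" assume v: "v \<in> fsupp (level Y i)"
        then have "v \<in> fsupp (level X i)" "v \<in> fsupp Y" using l1 by auto
        then show "v \<in> {v \<in> ?Z. proj (X - Y) v = 0}" using l2[of v] proj_eq_0_iff[OF l3[of v]] by simp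
      qed
    qed
    moreover have "proj (X - Y) ` ?Z = cycles (X - Y) i"
    proof
      show "proj (X - Y) ` ?Z \<subseteq> cycles (X - Y) i"
      proof
        fix w assume "w \<in> proj (X - Y) ` ?Z"
        then obtain v where v: "v \<in> ?Z" "w = proj (X - Y) v" by (rule imageE)
        have "bd (X - Y) w = proj (X - Y) (bd X v)" by (simp add: v(2) bd_quot)
        also have "\<dots> = 0" using v(1) proj_eq_0_iff[OF bd_fsupp[of v]] by simp
        finally have "bd (X - Y) w = 0" .
        moreover have "w \<in> fsupp (level (X - Y) i)"
          using v(1) unfolding v(2) by (auto simp: fsupp_def proj_def level_def)
        ultimately show "w \<in> cycles (X - Y) i" by (simp add: cycles_def)
      qed
      show "cycles (X - Y) i \<subseteq> proj (X - Y) ` ?Z"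
      proof
        fix w :: "nat set \<Rightarrow> 'k" assume w: "w \<in> cycles (X - Y) i"
        then have p: "proj (X - Y) w = w" "w \<in> fsupp (level X i)"
          unfolding cycles_def by (auto simp: fsupp_def proj_def level_def intro!: ext)
        have "proj (X - Y) (bd X w) = 0" using bd_quot[of w] p w by (simp add: cycles_def)
        then have "bd X w \<in> fsupp Y" using proj_eq_0_iff[OF bd_fsupp[of w]] by simp
        then have "w \<in> ?Z" using p by simp
        then show "w \<in> proj (X - Y) ` ?Z" using p(1) by (intro image_eqI[of _ "proj (X - Y)" w]) simp_all
      qed
    qed
    ultimately show ?thesis
      using fv_rank_nullity[of "proj (X - Y)", OF linear_proj sZ fX ZX] dim_fsupp[OF fY, where 'k='k] by (simp only:)
  qed
  have Z2: "fv.dim ?Z = fv.dim (cycles X i :: (nat set \<Rightarrow> 'k) set) + fv.dim (bounds X i \<inter> fsupp Y :: (nat set \<Rightarrow> 'k) set)"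
  proof -
    have "0 \<in> (fsupp Y :: (nat set \<Rightarrow> 'k) set)" by (simp add: fsupp_def)
    then have "{v \<in> ?Z. bd X v = 0} = cycles X i" unfolding cycles_def by (intro set_eqI) auto
    moreover have "bd X ` ?Z = bounds X i \<inter> fsupp Y" unfolding bounds_def by (intro set_eqI) auto
    ultimately show ?thesis using fv_rank_nullity[of "bd X", OF linear_bd sZ fX ZX] by (simp only:)
  qed
  show ?thesis using B[of "Suc i"] Z1 Z2 rank_nullity_level[OF Y, of i, where 'k='k]
    by (simp add: hdim_def kap_def)
qed

end

section \<open>Families with complete intersection localizations\<close>

definition min_sets :: "'a set set \<Rightarrow> 'a set set" where
  "min_sets S = {g\<in>S. \<forall>h\<in>S. h \<subseteq> g \<longrightarrow> h = g}"

definition pairwise_disjoint :: "'a set set \<Rightarrow> bool" where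
  "pairwise_disjoint S \<longleftrightarrow> (\<forall>f\<in>S. \<forall>g\<in>S. f \<noteq> g \<longrightarrow> f \<inter> g = {})"

lemma pairwise_disjointD: "pairwise_disjoint S \<Longrightarrow> f \<in> S \<Longrightarrow> g \<in> S \<Longrightarrow> v \<in> f \<Longrightarrow> v \<in> g \<Longrightarrow> f = g"
  unfolding pairwise_disjoint_def by blast

lemma min_sets_below:
  assumes "finite S" "g \<in> S"
  obtains f where "f \<in> min_sets S" "f \<subseteq> g"
proof -
  have "finite {h\<in>S. h \<subseteq> g}" "{h\<in>S. h \<subseteq> g} \<noteq> {}" using assms by auto
  from finite_has_minimal[OF this] obtain f where f: "f \<in> S" "f \<subseteq> g"
    and m: "\<forall>h\<in>{h\<in>S. h \<subseteq> g}. h \<subseteq> f \<longrightarrow> f = h" by auto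
  have "f \<in> min_sets S" unfolding min_sets_def using f m by auto
  then show ?thesis using f(2) that by blast
qed

definition contract :: "'a \<Rightarrow> 'a set set \<Rightarrow> 'a set set" where
  "contract x G = min_sets ((\<lambda>g. g - {x}) ` G)"

text \<open>A minimal vertex cover of the generators avoiding \<open>x\<close>, which generate
  \<open>L\<close>. The last clause gives each \<open>d\<close> a private generator; because of it,
  \<open>L\<close> localized at \<open>D\<close> is the ideal of all variables in
  \<open>D\<close>.\<close>

definition min_cover :: "'a set set \<Rightarrow> 'a \<Rightarrow> 'a set \<Rightarrow> bool" where
  "min_cover G x D \<longleftrightarrow> finite D \<and> x \<notin> D \<and> (\<forall>g\<in>G. x \<notin> g \<longrightarrow> g \<inter> D \<noteq> {}) \<and>
     (\<forall>d\<in>D. \<exists>g\<in>G. x \<notin> g \<and> g \<inter> D = {d})"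

text \<open>The set \<open>T\<close> is a device for forcing vertices into the cover. It contains no
  generator avoiding \<open>x\<close>, so a cover exists outside \<open>T\<close>, and a minimal one
  is taken; if \<open>T\<close> and one vertex \<open>d\<close> contain such a generator, only
  \<open>d\<close> can cover it.\<close>

lemma min_cover_exists:
  assumes fG: "finite G" "\<And>g. g \<in> G \<Longrightarrow> finite g" and ind: "\<And>g. g \<in> G \<Longrightarrow> x \<notin> g \<Longrightarrow> \<not> g \<subseteq> T"
  obtains D where "min_cover G x D" "\<And>d h. h \<in> G \<Longrightarrow> x \<notin> h \<Longrightarrow> h \<subseteq> insert d T \<Longrightarrow> d \<in> D"
proof -
  let ?S = "\<Union>{g\<in>G. x \<notin> g} - T"
  let ?C = "{D. D \<subseteq> ?S \<and> (\<forall>g\<in>G. x \<notin> g \<longrightarrow> g \<inter> D \<noteq> {})}"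
  have fS: "finite ?S"
    by (rule finite_Diff, rule finite_Union) (simp_all add: fG)
  then have fC: "finite ?C" by (rule finite_subset[rotated, OF finite_Pow_iff[THEN iffD2]]) auto
  have "?S \<in> ?C"
  proof (intro CollectI conjI ballI impI order_refl)
    fix g assume "g \<in> G" "x \<notin> g"
    then show "g \<inter> ?S \<noteq> {}" using ind[of g] by blast
  qed
  then have "?C \<noteq> {}" by blast
  from finite_has_minimal[OF fC this] obtain D where D: "D \<in> ?C" and m: "\<forall>E\<in>?C. E \<subseteq> D \<longrightarrow> D = E"
    by auto
  have x: "x \<notin> D" using D by auto
  have fD: "finite D" by (rule finite_subset[OF _ fS]) (use D in blast)
  have T: "D \<inter> T = {}" using D by auto
  have c: "g \<inter> D \<noteq> {}" if "g \<in> G" "x \<notin> g" for g using D that by auto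
  have p: "\<exists>g\<in>G. x \<notin> g \<and> g \<inter> D = {d}" if d: "d \<in> D" for d
  proof -
    have "D - {d} \<notin> ?C"
    proof
      assume "D - {d} \<in> ?C"
      then have "D = D - {d}" using m by (meson Diff_subset)
      then show False using d by auto
    qed
    moreover have "D - {d} \<subseteq> ?S" using D by blast
    ultimately obtain g where g: "g \<in> G" "x \<notin> g" "g \<inter> (D - {d}) = {}" by blast
    then have "g \<inter> D = {d}" using c[OF g(1,2)] by auto
    then show ?thesis using g by blast
  qed
  have "min_cover G x D" unfolding min_cover_def using fD x c p by auto
  moreover have "d \<in> D" if "h \<in> G" "x \<notin> h" "h \<subseteq> insert d T" for d h
    using c[OF that(1,2)] that(3) T by auto
  ultimately show ?thesis using that by blast
qed

text \<open>The minimal generators of an ideal that is not a complete intersection but becomes one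
  whenever an occurring variable is inverted. A variable that is itself a generator is excepted, as
  inverting it gives the unit ideal.\<close>

locale nearly_ci =
  fixes G :: "'a set set"
  assumes finG: "finite G" and fin: "\<And>g. g \<in> G \<Longrightarrow> finite g" and ne: "{} \<notin> G"
    and anti: "\<And>g h. g \<in> G \<Longrightarrow> h \<in> G \<Longrightarrow> g \<subseteq> h \<Longrightarrow> g = h"
    and meet: "\<not> pairwise_disjoint G"
    and contract_disjoint: "\<And>x. x \<in> \<Union>G \<Longrightarrow> {x} \<notin> G \<Longrightarrow> pairwise_disjoint (contract x G)"
begin

text \<open>Three ways for half of the subsets \<open>B\<close> of \<open>D\<close> to be missed by
  the contraction. A missing \<open>d\<close> excludes every degree containing \<open>d\<close>. Two
  vertices of one generator \<open>f\<close> occur in a degree only together. If the contraction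
  consists of variables, a class of homological degree |B| above \<open>B\<close> sits at
  \<open>B\<close> itself, and there a class of \<open>L\<close> would require each variable of
  \<open>B\<close> to be a generator.\<close>

definition good :: "'a \<Rightarrow> 'a set \<Rightarrow> bool" where
  "good x D \<longleftrightarrow> (\<exists>d\<in>D. d \<notin> \<Union>(contract x G)) \<or>
     (\<exists>f\<in>contract x G. \<exists>d d'. d \<noteq> d' \<and> d \<in> D \<and> d' \<in> D \<and> d \<in> f \<and> d' \<in> f) \<or>
     ((\<forall>f\<in>contract x G. \<exists>v. f = {v}) \<and> (\<exists>d\<in>D. {d} \<notin> G))"

text \<open>The vertices that can be inverted without producing the unit ideal.\<close>

definition V where "V = {v\<in>\<Union>G. {v} \<notin> G}"

lemma V_edge: "v \<in> g \<Longrightarrow> g \<in> G \<Longrightarrow> u \<in> g \<Longrightarrow> u \<noteq> v \<Longrightarrow> v \<in> V"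
  unfolding V_def using anti[of "{v}" g] by auto

lemma V_pair: "{a, b} \<in> G \<Longrightarrow> a \<noteq> b \<Longrightarrow> a \<in> V \<and> b \<in> V"
  using V_edge[of a "{a,b}" b] V_edge[of b "{a,b}" a] by auto

lemma VD: "v \<in> V \<Longrightarrow> v \<in> \<Union>G" "v \<in> V \<Longrightarrow> {v} \<notin> G"
  by (auto simp: V_def)

lemma contract_minus: "f \<in> contract x G \<Longrightarrow> \<exists>g\<in>G. f = g - {x}"
  by (auto simp: contract_def min_sets_def)

lemma contract_min: "f \<in> contract x G \<Longrightarrow> g \<in> G \<Longrightarrow> g - {x} \<subseteq> f \<Longrightarrow> g - {x} = f"
  by (auto simp: contract_def min_sets_def)

lemma contractI: "g \<in> G \<Longrightarrow> (\<And>e. e \<in> G \<Longrightarrow> e - {x} \<subseteq> g - {x} \<Longrightarrow> e - {x} = g - {x}) \<Longrightarrow> g - {x} \<in> contract x G"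
  by (auto simp: contract_def min_sets_def)

lemma minus_nonempty: "x \<in> V \<Longrightarrow> g \<in> G \<Longrightarrow> g - {x} \<noteq> {}"
  using VD(2)[of x] ne by (metis Diff_eq_empty_iff subset_singletonD)

lemma contract_nonempty: "x \<in> V \<Longrightarrow> f \<in> contract x G \<Longrightarrow> f \<noteq> {}"
  using contract_minus minus_nonempty by metis

lemma contract_single:
  assumes "x \<in> V" "g \<in> G" "g - {x} = {v}"
  shows "{v} \<in> contract x G"
proof -
  have "g - {x} \<in> contract x G"
  proof (rule contractI[OF assms(2)])
    fix e assume "e \<in> G" "e - {x} \<subseteq> g - {x}"
    then show "e - {x} = g - {x}" using minus_nonempty[OF assms(1), of e] assms(3) by auto
  qed
  then show ?thesis using assms(3) by simp
qed

lemma contract_adj: "x \<in> V \<Longrightarrow> {x, v} \<in> G \<Longrightarrow> v \<noteq> x \<Longrightarrow> {v} \<in> contract x G"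
  by (rule contract_single[of x "{x, v}"]) auto

lemma contract_vertex: "x \<in> V \<Longrightarrow> {v} \<in> G \<Longrightarrow> {v} \<in> contract x G"
  by (rule contract_single[of x "{v}"]) (use VD(2)[of x] in auto)

lemma contract_eq: "x \<in> V \<Longrightarrow> f \<in> contract x G \<Longrightarrow> f' \<in> contract x G \<Longrightarrow> v \<in> f \<Longrightarrow> v \<in> f' \<Longrightarrow> f = f'"
  using pairwise_disjointD[OF contract_disjoint] VD by metis

text \<open>Contraction at a common vertex \<open>y\<close> keeps all generators through
  \<open>y\<close> minimal, so their remainders are equal or disjoint; a second common vertex makes
  them equal.\<close>

lemma inter_le_one:
  assumes "g \<in> G" "h \<in> G" "g \<noteq> h" "y \<in> g" "y \<in> h" "w \<in> g" "w \<in> h"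
  shows "y = w"
proof (rule ccontr)
  assume n: "y \<noteq> w"
  have y: "y \<in> V" by (rule V_edge[OF assms(4,1,6)]) (use n in auto)
  have *: "k - {y} \<in> contract y G" if k: "k \<in> G" "y \<in> k" for k
  proof (rule contractI[OF k(1)])
    fix e assume e: "e \<in> G" "e - {y} \<subseteq> k - {y}"
    then have "e \<subseteq> k" using k by auto
    then show "e - {y} = k - {y}" using anti[OF e(1) k(1)] by simp
  qed
  have "g - {y} = h - {y}"
    by (rule contract_eq[OF y *[OF assms(1,4)] *[OF assms(2,5)], of w]) (use n assms in auto)
  then have "g = h" using assms(4,5) by (metis insert_Diff)
  then show False using assms(3) by simp
qed

text \<open>Some \<open>e\<close> falls strictly inside \<open>g\<close> when \<open>y\<close> is
  removed. It contains \<open>y\<close> and \<open>g\<close> does not; since \<open>e\<close> and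
  \<open>g\<close> share at most one vertex, \<open>e\<close> is a pair.\<close>

lemma adj_of_not_minimal:
  assumes "g \<in> G" "y \<in> V" "g - {y} \<notin> contract y G"
  shows "y \<notin> g \<and> (\<exists>a\<in>g. {y, a} \<in> G)"
proof -
  obtain e where e: "e \<in> G" "e - {y} \<subseteq> g - {y}" "e - {y} \<noteq> g - {y}"
    using contractI[OF assms(1)] assms(3) by metis
  have ye: "y \<in> e"
  proof (rule ccontr)
    assume "y \<notin> e"
    then have "e \<subseteq> g" using e(2) by auto
    then show False using anti[OF e(1) assms(1)] e(3) by simp
  qed
  have yg: "y \<notin> g"
  proof
    assume "y \<in> g"
    then have "e \<subseteq> g" using e(2) by auto
    then show False using anti[OF e(1) assms(1)] e(3) by simp
  qed
  obtain a where a: "a \<in> e" "a \<noteq> y" using minus_nonempty[OF assms(2) e(1)] by auto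
  have ag: "a \<in> g" using a e(2) by auto
  have "e \<subseteq> {y, a}"
  proof
    fix b assume b: "b \<in> e"
    show "b \<in> {y, a}"
    proof (cases "b = y")
      case False
      then have "b \<in> g" using b e(2) by auto
      then have "b = a" using inter_le_one[OF e(1) assms(1) _ b _ a(1) ag] ye yg by auto
      then show ?thesis by simp
    qed simp
  qed
  then have "e = {y, a}" using ye a by auto
  then show ?thesis using yg ag e(1) by auto
qed

text \<open>If \<open>g\<close> and \<open>h\<close> both survived the contraction at
  \<open>y\<close>, they would still share \<open>w\<close>, and disjointness would identify them.
  So a pair through \<open>y\<close> destroys one of them.\<close>

lemma adj:
  assumes "g \<in> G" "h \<in> G" "g \<noteq> h" "w \<in> g" "w \<in> h" "y \<in> V" "y \<noteq> w"
  shows "(y \<notin> g \<and> (\<exists>a\<in>g. {y, a} \<in> G)) \<or> (y \<notin> h \<and> (\<exists>a\<in>h. {y, a} \<in> G))"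
proof (cases "g - {y} \<in> contract y G \<and> h - {y} \<in> contract y G")
  case True
  then have eq: "g - {y} = h - {y}"
    using contract_eq[OF assms(6), of "g - {y}" "h - {y}" w] assms(4,5,7) by auto
  have "g \<subseteq> h \<or> h \<subseteq> g" using eq by blast
  then show ?thesis using anti assms(1-3) by metis
next
  case False
  then show ?thesis using adj_of_not_minimal assms by blast
qed

section \<open>Choice of the vertex and the cover\<close>

lemma pair_distinct: "v \<in> V \<Longrightarrow> {v, a} \<in> G \<Longrightarrow> a \<noteq> v"
  using VD(2)[of v] by auto

text \<open>The vertex is \<open>w\<close>; two vertices are adjacent if they form a generator. A
  vertex outside \<open>g\<close> adjacent to one element of \<open>g\<close> is adjacent to all of
  them; such vertices form \<open>Z\<close>, and a chosen \<open>z\<close> in \<open>Z\<close> is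
  adjacent to every vertex of \<open>V - Z\<close>. Keeping \<open>z\<close> out of the cover forces
  all of \<open>V - Z - {w}\<close> into it.\<close>

lemma big_case:
  assumes g: "g \<in> G" "3 \<le> card g" and h: "h \<in> G" "h \<noteq> g" "w \<in> g" "w \<in> h"
  shows "\<exists>x D. x \<in> V \<and> min_cover G x D \<and> good x D"
proof -
  have nopair: False if "{a, b} \<in> G" "a \<in> g" "b \<in> g" for a b
  proof -
    have "{a, b} = g" using anti[OF that(1) g(1)] that by auto
    moreover have "card {a, b} \<le> 2" by (simp add: card_insert_if)
    ultimately show False using g(2) by simp
  qed
  have two: "\<exists>b\<in>g. b \<noteq> a" for a
  proof (rule ccontr)
    assume "\<not> ?thesis"
    then have "g \<subseteq> {a}" by auto
    then have "card g \<le> card {a}" by (intro card_mono) auto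
    then show False using g(2) by simp
  qed
  have gV: "u \<in> V" if "u \<in> g" for u using two[of u] V_edge[OF that g(1)] by auto
  have conn: "{u, v} \<in> G" if v: "v \<notin> g" "{v, a} \<in> G" "a \<in> g" "u \<in> g" for u v a
  proof (cases "u = a")
    case True then show ?thesis using v by (simp add: insert_commute)
  next
    case False
    have "(u \<notin> g \<and> (\<exists>b\<in>g. {u, b} \<in> G)) \<or> (u \<notin> {v, a} \<and> (\<exists>b\<in>{v, a}. {u, b} \<in> G))"
      by (rule adj[OF g(1) v(2), of a]) (use v False gV in auto)
    then have "{u, v} \<in> G \<or> {u, a} \<in> G" using v by auto
    then show ?thesis using nopair v by blast
  qed
  define Z where "Z = {z\<in>\<Union>G. z \<notin> g \<and> (\<forall>u\<in>g. {u, z} \<in> G)}"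
  obtain y where y: "y \<in> g" "y \<noteq> w" using two by blast
  have "(y \<notin> g \<and> (\<exists>a\<in>g. {y, a} \<in> G)) \<or> (y \<notin> h \<and> (\<exists>a\<in>h. {y, a} \<in> G))"
    by (rule adj[OF g(1) h(1) _ h(3,4)]) (use h y gV in auto)
  then obtain z where z: "z \<in> h" "{y, z} \<in> G" using y by auto
  have zw: "z \<noteq> w" using nopair[of y w] z y h by auto
  have zg: "z \<notin> g" using inter_le_one[OF g(1) h(1) _ _ z(1) h(3,4)] h(2) zw by auto
  have "{u, z} \<in> G" if "u \<in> g" for u using conn[OF zg _ y(1) that] z(2) by (simp add: insert_commute)
  then have zZ: "z \<in> Z" unfolding Z_def using zg z h by auto
  have zV: "z \<in> V" using V_pair[OF z(2)] y zg by auto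
  have comp: "{v, z} \<in> G" if v: "v \<in> V" "v \<notin> Z" for v
  proof (cases "v \<in> g")
    case True then show ?thesis using zZ by (auto simp: Z_def)
  next
    case False
    have nog: "{v, a} \<notin> G" if a: "a \<in> g" for a
    proof
      assume "{v, a} \<in> G"
      then have "v \<in> Z" unfolding Z_def using conn[OF False _ a] False VD(1)[OF v(1)] by auto
      then show False using v by simp
    qed
    have "(v \<notin> g \<and> (\<exists>b\<in>g. {v, b} \<in> G)) \<or> (v \<notin> {y, z} \<and> (\<exists>b\<in>{y, z}. {v, b} \<in> G))"
      by (rule adj[OF g(1) z(2), of y]) (use v y False zg in auto)
    then show ?thesis using nog y by auto
  qed
  have noT: "\<not> e \<subseteq> {z}" if "e \<in> G" for e
    using that ne VD(2)[OF zV] by (metis subset_singletonD)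
  obtain D where D: "min_cover G w D" and Dd: "\<And>d h. h \<in> G \<Longrightarrow> w \<notin> h \<Longrightarrow> h \<subseteq> insert d {z} \<Longrightarrow> d \<in> D"
    using min_cover_exists[of G w "{z}"] finG fin noT by metis
  have wV: "w \<in> V" using gV h by auto
  let ?W = "V - Z - {w}"
  have WD: "v \<in> D" if "v \<in> ?W" for v
    by (rule Dd[OF comp[of v]]) (use that zw in auto)
  have yW: "y \<in> ?W" using y gV by (auto simp: Z_def)
  have "good w D"
  \<comment> \<open>When \<open>?W\<close> yields neither of the first two alternatives, the
    contraction consists of single vertices: a set containing a vertex outside \<open>?W\<close>
    contains a generator variable or a neighbour of \<open>w\<close>, and a set inside
    \<open>?W\<close> has just one element.\<close>
  proof (cases "?W \<subseteq> \<Union>(contract w G) \<and> (\<forall>f\<in>contract w G. \<forall>d\<in>f. \<forall>d'\<in>f. d \<in> ?W \<longrightarrow> d' \<in> ?W \<longrightarrow> d = d')")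
    case False
    then show ?thesis unfolding good_def using WD by blast
  next
    case True
    have "\<exists>v. f = {v}" if f: "f \<in> contract w G" for f
    proof (cases "\<exists>v\<in>f. v \<notin> ?W")
      case True
      then obtain v where v: "v \<in> f" "v \<notin> ?W" by blast
      obtain e where e: "e \<in> G" "f = e - {w}" using contract_minus[OF f] by blast
      have "{v} \<in> contract w G"
      proof (cases "{v} \<in> G")
        case True then show ?thesis by (rule contract_vertex[OF wV])
      next
        case False
        then have "v \<in> Z" using v e by (auto simp: V_def)
        then have "{w, v} \<in> G" using h by (auto simp: Z_def)
        then show ?thesis using contract_adj[OF wV] v e by auto
      qed
      then have "f = {v}" using contract_eq[OF wV f _ v(1)] by auto
      then show ?thesis by blast
    next
      case False
      obtain v where "v \<in> f" using contract_nonempty[OF wV f] by blast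
      then have "f = {v}" using True f False by blast
      then show ?thesis by blast
    qed
    moreover have "y \<in> D" "{y} \<notin> G" using WD[OF yW] VD(2) yW by auto
    ultimately show ?thesis unfolding good_def by blast
  qed
  then show ?thesis using wV D by blast
qed

text \<open>A neighbour \<open>n\<close> of \<open>z\<close> is kept out of the cover. This forces
  in \<open>z\<close>, which does not occur in the contraction.\<close>

lemma outside_case:
  assumes x: "x \<in> V" and z: "z \<in> V" "z \<noteq> x" "z \<notin> \<Union>(contract x G)"
    and pairs: "\<And>g. g \<in> G \<Longrightarrow> v \<in> g \<Longrightarrow> v \<in> V \<Longrightarrow> \<exists>u. g = {v, u}"
    and n: "{z, n} \<in> G"
  shows "\<exists>x D. x \<in> V \<and> min_cover G x D \<and> good x D"
proof -
  have nz: "n \<noteq> z" using pair_distinct[OF z(1) n] .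
  have nx: "n \<noteq> x" using contract_adj[OF x, of z] n z by (auto simp: insert_commute)
  have nV: "n \<in> V" using V_pair[OF n] nz by auto
  have noT: "\<not> e \<subseteq> {n}" if "e \<in> G" for e
    using that ne VD(2)[OF nV] by (metis subset_singletonD)
  obtain D where D: "min_cover G x D" and Dd: "\<And>d h. h \<in> G \<Longrightarrow> x \<notin> h \<Longrightarrow> h \<subseteq> insert d {n} \<Longrightarrow> d \<in> D"
    using min_cover_exists[of G x "{n}"] finG fin noT by metis
  have "z \<in> D" by (rule Dd[OF n]) (use z nx in auto)
  then show ?thesis using x D z(3) unfolding good_def by blast
qed

text \<open>The generators through \<open>V\<close> are edges of a graph. If there is no good pair,
  the non-neighbours of any vertex are perfectly matched by edges (\<open>partner\<close>,
  \<open>unique\<close>). A non-neighbour of \<open>w\<close> then leads to a contradiction. If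
  \<open>w\<close> has none, an edge away from \<open>w\<close> gives the third alternative of
  \<open>good\<close>, and otherwise the graph is a star, which is excluded directly.\<close>

lemma graph_case:
  assumes pairs: "\<And>g v. g \<in> G \<Longrightarrow> v \<in> g \<Longrightarrow> v \<in> V \<Longrightarrow> \<exists>u. g = {v, u}"
    and w: "w \<in> V" "{w, a0} \<in> G" "{w, b0} \<in> G" "a0 \<noteq> b0"
  shows "\<exists>x D. x \<in> V \<and> min_cover G x D \<and> good x D"
proof (rule ccontr)
  assume no: "\<not> ?thesis"
  have nbr: "\<exists>n. {v, n} \<in> G" if "v \<in> V" for v
    using pairs[of _ v] VD(1)[OF that] that by (metis UnionE)
  have sym: "{a, b} \<in> G \<longleftrightarrow> {b, a} \<in> G" for a b by (simp add: insert_commute)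
  have inU: "\<exists>f\<in>contract x G. z \<in> f" if "x \<in> V" "z \<in> V" "z \<noteq> x" for x z
  proof (rule ccontr)
    assume "\<not> ?thesis"
    then have "z \<notin> \<Union>(contract x G)" by blast
    then show False using outside_case[OF that(1,2,3)] pairs nbr[OF that(2)] no by blast
  qed
  have partner: "\<exists>q. {z, q} \<in> G \<and> {z, q} \<in> contract x G \<and> {x, q} \<notin> G \<and> q \<noteq> x"
    if x: "x \<in> V" and z: "z \<in> V" "z \<noteq> x" "{x, z} \<notin> G" for x z
  proof -
    obtain f where f: "f \<in> contract x G" "z \<in> f" using inU[OF x z(1,2)] by blast
    obtain e where e: "e \<in> G" "f = e - {x}" using contract_minus[OF f(1)] by blast
    obtain q where q: "e = {z, q}" using pairs[OF e(1) _ z(1)] f(2) e(2) by auto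
    have qz: "q \<noteq> z" using pair_distinct[OF z(1)] e(1) q by simp
    have qx: "q \<noteq> x" using e(1) q z(3) sym by auto
    have fe: "f = {z, q}" using e(2) q qx z(2) by auto
    have "{x, q} \<notin> G"
    proof
      assume "{x, q} \<in> G"
      then have "{q} \<in> contract x G" using contract_adj[OF x] qx by auto
      then have "f = {q}" using contract_eq[OF x f(1), of "{q}" q] fe by auto
      then show False using fe qz by auto
    qed
    then show ?thesis using e(1) q f(1) fe qx by auto
  qed
  have unique: "q = q'"
    if x: "x \<in> V" and z: "z \<in> V" "z \<noteq> x" "{x, z} \<notin> G"
      and q: "{z, q} \<in> G" "{x, q} \<notin> G" "q \<noteq> x" and q': "{z, q'} \<in> G" "{x, q'} \<notin> G" "q' \<noteq> x" for x z q q'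
  proof -
    have *: "{z, r} \<in> contract x G" if r: "{z, r} \<in> G" "{x, r} \<notin> G" "r \<noteq> x" for r
    proof -
      have "{z, r} - {x} \<in> contract x G"
      proof (rule contractI[OF r(1)])
        fix e assume e: "e \<in> G" "e - {x} \<subseteq> {z, r} - {x}"
        have rz: "r \<noteq> z" using pair_distinct[OF z(1) r(1)] .
        have rV: "r \<in> V" using V_pair[OF r(1)] rz by auto
        show "e - {x} = {z, r} - {x}"
        proof (cases "x \<in> e")
          case False
          then have "e \<subseteq> {z, r}" using e(2) by auto
          then show ?thesis using anti[OF e(1) r(1)] by simp
        next
          case True
          obtain u where u: "e = {x, u}" using pairs[OF e(1) True x] by blast
          have "u \<noteq> x" using pair_distinct[OF x] e(1) u by simp
          then have "u = z \<or> u = r" using e(2) u by auto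
          then show ?thesis using e(1) u z(3) r(2) by auto
        qed
      qed
      moreover have "{z, r} - {x} = {z, r}" using z(2) r(3) by auto
      ultimately show ?thesis by simp
    qed
    have "{z, q} = {z, q'}" by (rule contract_eq[OF x *[OF q] *[OF q'], of z]) auto
    then show ?thesis using pair_distinct[OF z(1) q(1)] by (auto simp: doubleton_eq_iff)
  qed
  have aV: "a0 \<in> V" "b0 \<in> V" using w V_pair pair_distinct by metis+
  have wa: "a0 \<noteq> w" "b0 \<noteq> w" using w pair_distinct by metis+
  show False
  proof (cases "\<exists>p\<in>V. p \<noteq> w \<and> {w, p} \<notin> G")
    case True
    then obtain p where p: "p \<in> V" "p \<noteq> w" "{w, p} \<notin> G" by blast
    obtain q where q: "{p, q} \<in> G" "{p, q} \<in> contract w G" "{w, q} \<notin> G" "q \<noteq> w"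
      using partner[OF w(1) p] by blast
    have qp: "q \<noteq> p" using pair_distinct[OF p(1) q(1)] .
    have qV: "q \<in> V" using V_pair[OF q(1)] qp by auto
    \<comment> \<open>Otherwise a cover avoiding \<open>n1\<close> and \<open>n2\<close> exists and
      contains both \<open>p\<close> and \<open>q\<close>, which lie in one set
      \<open>{p, q}\<close> of the contraction: the second alternative.\<close>
    have C: "n1 \<noteq> n2 \<and> {n1, n2} \<in> G" if n: "{p, n1} \<in> G" "{w, n1} \<in> G" "{q, n2} \<in> G" "{w, n2} \<in> G" for n1 n2
    proof (rule ccontr)
      assume nn: "\<not> ?thesis"
      have nw: "n1 \<noteq> w" "n2 \<noteq> w" using n(2,4) pair_distinct[OF w(1)] by auto
      have nV: "n1 \<in> V" "n2 \<in> V" using n(2,4) V_pair nw by blast+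
      have noT: "\<not> e \<subseteq> {n1, n2}" if e: "e \<in> G" for e
      proof
        assume s: "e \<subseteq> {n1, n2}"
        have "e \<noteq> {n1}" "e \<noteq> {n2}" "e \<noteq> {}" using e VD(2) nV ne by auto
        then have "e = {n1, n2}" "n1 \<noteq> n2" using s by auto
        then show False using nn e by auto
      qed
      obtain D where D: "min_cover G w D" and Dd: "\<And>d h. h \<in> G \<Longrightarrow> w \<notin> h \<Longrightarrow> h \<subseteq> insert d {n1, n2} \<Longrightarrow> d \<in> D"
        using min_cover_exists[of G w "{n1, n2}"] finG fin noT by metis
      have "p \<in> D" by (rule Dd[OF n(1)]) (use p nw in auto)
      moreover have "q \<in> D" by (rule Dd[OF n(3)]) (use q nw in auto)
      ultimately have "good w D" unfolding good_def using q(2) qp by blast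
      then show False using no D w(1) by blast
    qed
    \<comment> \<open>Without a common neighbour, \<open>a0\<close> and \<open>b0\<close> would be
      two partners of \<open>w\<close> from the point of view of \<open>r\<close>.\<close>
    have one: "\<exists>a. {w, a} \<in> G \<and> {r, a} \<in> G" if r: "r \<in> V" "r \<noteq> w" "{w, r} \<notin> G" for r
    proof (rule ccontr)
      assume n: "\<not> ?thesis"
      then have "{r, a0} \<notin> G" "{r, b0} \<notin> G" using w by blast+
      moreover have "a0 \<noteq> r" "b0 \<noteq> r" using r w by auto
      ultimately have "a0 = b0" using unique[OF r(1) w(1), of a0 b0] r w sym by auto
      then show False using w by simp
    qed
    obtain a where a: "{w, a} \<in> G" "{p, a} \<in> G" using one[OF p] by blast
    have qa: "{a, q} \<notin> G" using C[OF a(2,1) _ a(1)] sym by auto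
    have aw: "a \<noteq> w" using pair_distinct[OF w(1) a(1)] .
    have aV': "a \<in> V" using V_pair[OF a(1)] aw by auto
    have aq: "q \<noteq> a" using a q by auto
    \<comment> \<open>The partner of \<open>q\<close> from the point of view of \<open>a\<close>.
      Uniqueness at \<open>w\<close> makes \<open>r\<close> a neighbour of \<open>w\<close>, and
      then \<open>C\<close> makes it adjacent to \<open>a\<close>, contrary to its choice.\<close>
    obtain r where r: "{q, r} \<in> G" "{a, r} \<notin> G" "r \<noteq> a"
      using partner[OF aV' qV aq qa] by blast
    have rp: "r \<noteq> p" using r a sym by auto
    have rw: "r \<noteq> w" using r q sym by auto
    have "{w, r} \<in> G"
    proof (rule ccontr)
      assume "{w, r} \<notin> G"
      then have "r = p" using unique[OF w(1) qV q(4,3) r(1), of p] p q sym rw by auto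
      then show False using rp by simp
    qed
    then show False using C[OF a(2,1) r(1)] r by auto
  next
    case False
    then have all: "{w, v} \<in> G" if "v \<in> V" "v \<noteq> w" for v using that by blast
    show False
    proof (cases "\<exists>d n. d \<in> V \<and> d \<noteq> w \<and> n \<noteq> w \<and> {d, n} \<in> G")
      case True
      then obtain d n where d: "d \<in> V" "d \<noteq> w" "n \<noteq> w" "{d, n} \<in> G" by blast
      have dn: "n \<noteq> d" using pair_distinct[OF d(1,4)] .
      have nV: "n \<in> V" using V_pair[OF d(4)] dn by auto
      have noT: "\<not> e \<subseteq> {n}" if "e \<in> G" for e
        using that ne VD(2)[OF nV] by (metis subset_singletonD)
      obtain D where D: "min_cover G w D" and Dd: "\<And>d h. h \<in> G \<Longrightarrow> w \<notin> h \<Longrightarrow> h \<subseteq> insert d {n} \<Longrightarrow> d \<in> D"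
        using min_cover_exists[of G w "{n}"] finG fin noT by metis
      have dD: "d \<in> D" by (rule Dd[OF d(4)]) (use d in auto)
      have "\<exists>v. f = {v}" if f: "f \<in> contract w G" for f
      proof -
        obtain v where v: "v \<in> f" using contract_nonempty[OF w(1) f] by blast
        obtain e where e: "e \<in> G" "f = e - {w}" using contract_minus[OF f] by blast
        have "{v} \<in> contract w G"
        proof (cases "{v} \<in> G")
          case True then show ?thesis by (rule contract_vertex[OF w(1)])
        next
          case False
          then have "v \<in> V" "v \<noteq> w" using v e by (auto simp: V_def)
          then show ?thesis using contract_adj[OF w(1) all] by auto
        qed
        then have "f = {v}" using contract_eq[OF w(1) f _ v] by auto
        then show ?thesis by blast
      qed
      then have "good w D" unfolding good_def using dD VD(2)[OF d(1)] by blast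
      then show False using no D w(1) by blast
    next
      case F: False
      \<comment> \<open>The star with centre \<open>w\<close>: \<open>b0\<close> can occur in the
        contraction at the leaf \<open>a0\<close> only through \<open>{b0, w}\<close>, which is not
        disjoint from \<open>{w}\<close>.\<close>
      obtain f where f: "f \<in> contract a0 G" "b0 \<in> f" using inU[OF aV] w by auto
      obtain e where e: "e \<in> G" "f = e - {a0}" using contract_minus[OF f(1)] by blast
      obtain u where u: "e = {b0, u}" using pairs[OF e(1) _ aV(2)] f(2) e(2) by auto
      have "u = w" using F aV(2) wa(2) e(1) u by auto
      then have "f = {b0, w}" using e(2) u w(4) wa by auto
      moreover have "{w} \<in> contract a0 G" using contract_adj[OF aV(1), of w] w(2) wa(1) sym by auto
      ultimately have "f = {w}" using contract_eq[OF aV(1) f(1), of "{w}" w] by auto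
      then show False using \<open>f = {b0, w}\<close> wa by auto
    qed
  qed
qed

text \<open>If no generator with three or more elements meets another one, two meeting generators
  are edges at a vertex \<open>w\<close>. A larger generator cannot contain a vertex of
  \<open>V\<close>: by \<open>adj\<close> that vertex would lie on an edge as well. So every
  generator through \<open>V\<close> is an edge.\<close>

theorem good_vertex_exists:
  "\<exists>x D. x \<in> \<Union>G \<and> {x} \<notin> G \<and> min_cover G x D \<and> good x D"
proof -
  have "\<exists>x D. x \<in> V \<and> min_cover G x D \<and> good x D"
  proof (cases "\<exists>g\<in>G. 3 \<le> card g \<and> (\<exists>h\<in>G. h \<noteq> g \<and> g \<inter> h \<noteq> {})")
    case True
    then obtain g h w where "g \<in> G" "3 \<le> card g" "h \<in> G" "h \<noteq> g" "w \<in> g" "w \<in> h" by auto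
    then show ?thesis by (rule big_case)
  next
    case False
    obtain g h w where g: "g \<in> G" "h \<in> G" "g \<noteq> h" "w \<in> g" "w \<in> h"
      using meet unfolding pairwise_disjoint_def by blast
    have w: "w \<in> V"
    proof -
      have "{w} \<notin> G" using anti[of "{w}" g] anti[of "{w}" h] g by auto
      then show ?thesis using g by (auto simp: V_def)
    qed
    have two: "\<exists>a. e = {w, a} \<and> a \<noteq> w" if e: "e \<in> G" "w \<in> e" "e' \<in> G" "e' \<noteq> e" "w \<in> e'" for e e'
    proof -
      have "\<not> 3 \<le> card e" using False e by blast
      moreover have "e \<noteq> {w}" using VD(2)[OF w] e by auto
      then obtain a where a: "a \<in> e" "a \<noteq> w" using e by blast
      moreover have "e = {w, a}"
      proof (rule ccontr)
        assume "e \<noteq> {w, a}"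
        then obtain b where "b \<in> e" "b \<noteq> w" "b \<noteq> a" using a e by blast
        then have "{w, a, b} \<subseteq> e" "card {w, a, b} = 3" using a e by auto
        then have "3 \<le> card e" using card_mono[OF fin[OF e(1)]] by metis
        then show False using calculation(1) by simp
      qed
      ultimately show ?thesis by blast
    qed
    obtain a where a: "g = {w, a}" "a \<noteq> w" using two[OF g(1,4,2) _ g(5)] g by auto
    obtain b where b: "h = {w, b}" "b \<noteq> w" using two[OF g(2,5,1) _ g(4)] g by auto
    have pairs: "\<exists>u. e = {v, u}" if e: "e \<in> G" "v \<in> e" "v \<in> V" for e v
    proof (rule ccontr)
      assume n: "\<not> ?thesis"
      have "e \<noteq> {v}" using VD(2)[OF e(3)] e by auto
      then obtain p where p: "p \<in> e" "p \<noteq> v" using e by blast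
      then obtain r where r: "r \<in> e" "r \<noteq> v" "r \<noteq> p" using n e by blast
      then have "{v, p, r} \<subseteq> e" "card {v, p, r} = 3" using p e by auto
      then have c3: "3 \<le> card e" using card_mono[OF fin[OF e(1)]] by metis
      then have alone: "e \<inter> k = {}" if "k \<in> G" "k \<noteq> e" for k using False e that by blast
      have c2: "k \<noteq> e" if "k = {x, y}" for k x y
      proof
        assume "k = e"
        then have "card e \<le> card {x, y}" using that by simp
        also have "\<dots> \<le> 2" by (simp add: card_insert_if)
        finally show False using c3 by simp
      qed
      have "v \<noteq> w" using alone[OF g(1)] c2[OF a(1)] g(4) e by auto
      then have "(v \<notin> g \<and> (\<exists>a\<in>g. {v, a} \<in> G)) \<or> (v \<notin> h \<and> (\<exists>a\<in>h. {v, a} \<in> G))"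
        using adj[OF g e(3)] by simp
      then obtain x where x: "{v, x} \<in> G" by blast
      then show False using alone[OF x] c2[of "{v, x}"] e by auto
    qed
    show ?thesis
      by (rule graph_case[OF pairs w, of a b]) (use g a b in auto)
  qed
  then show ?thesis using VD by blast
qed

end

section \<open>Monomial ideals\<close>

abbreviation lkp where "lkp \<equiv> Poly_Mapping.lookup"

text \<open>Divisibility of the corresponding monomials.\<close>

definition ple :: "('v \<Rightarrow>\<^sub>0 nat) \<Rightarrow> ('v \<Rightarrow>\<^sub>0 nat) \<Rightarrow> bool" where
  "ple a b \<longleftrightarrow> (\<forall>v. lkp a v \<le> lkp b v)"

lemma ple_diff_add: "ple a b \<Longrightarrow> b - a + a = b"
  by (intro poly_mapping_eqI) (simp add: lookup_add lookup_minus ple_def)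

lemma ple_add: "ple a (a + b)"
  by (simp add: ple_def lookup_add)

lemma lookup_times_sum:
  fixes f g :: "('a::monoid_add) \<Rightarrow>\<^sub>0 'b::semiring_0"
  shows "lkp (f * g) k = (\<Sum>l\<in>Poly_Mapping.keys f. \<Sum>q\<in>Poly_Mapping.keys g. if k = l + q then lkp f l * lkp g q else 0)"
proof -
  have i: "(\<Sum>q. lkp g q when k = l + q) = (\<Sum>q\<in>Poly_Mapping.keys g. lkp g q when k = l + q)" for l
    by (rule Sum_any.expand_superset) (auto simp: in_keys_iff)
  have "lkp (f * g) k = (\<Sum>l. lkp f l * (\<Sum>q\<in>Poly_Mapping.keys g. lkp g q when k = l + q))"
    unfolding lookup_mult i ..
  also have "\<dots> = (\<Sum>l\<in>Poly_Mapping.keys f. lkp f l * (\<Sum>q\<in>Poly_Mapping.keys g. lkp g q when k = l + q))"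
    by (rule Sum_any.expand_superset) (auto simp: in_keys_iff)
  also have "\<dots> = (\<Sum>l\<in>Poly_Mapping.keys f. \<Sum>q\<in>Poly_Mapping.keys g. if k = l + q then lkp f l * lkp g q else 0)"
    unfolding sum_distrib_left by (intro sum.cong) (auto simp: when_def)
  finally show ?thesis .
qed

lemma lookup_single_times:
  fixes p :: "('v \<Rightarrow>\<^sub>0 nat) \<Rightarrow>\<^sub>0 'k::semiring_1"
  shows "lkp (Poly_Mapping.single a c * p) \<gamma> = (if ple a \<gamma> then c * lkp p (\<gamma> - a) else 0)"
proof (cases "c = 0")
  case True
  then show ?thesis by simp
next
  case c: False
  have e: "\<gamma> = a + q \<longleftrightarrow> ple a \<gamma> \<and> q = \<gamma> - a" for q
    using ple_diff_add[of a \<gamma>] ple_add[of a q] by (auto simp: add.commute)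
  have "lkp (Poly_Mapping.single a c * p) \<gamma> = (\<Sum>q\<in>Poly_Mapping.keys p. if \<gamma> = a + q then c * lkp p q else 0)"
  proof -
    have ks: "Poly_Mapping.keys (Poly_Mapping.single a c) = {a}" using c by (simp only: keys_single if_False)
    have sing: "sum F {a} = F a" for F :: "_ \<Rightarrow> 'k" by simp
    show ?thesis unfolding lookup_times_sum ks sing lookup_single_eq ..
  qed
  also have "\<dots> = (\<Sum>q\<in>Poly_Mapping.keys p. if q = \<gamma> - a then (if ple a \<gamma> then c * lkp p (\<gamma> - a) else 0) else 0)"
    by (intro sum.cong refl) (auto simp: e)
  also have "\<dots> = (if ple a \<gamma> then c * lkp p (\<gamma> - a) else 0)"
    by (simp add: in_keys_iff)
  finally show ?thesis .
qed

lemma poly_mapping_sum_single: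
  "f = (\<Sum>\<gamma>\<in>Poly_Mapping.keys f. Poly_Mapping.single \<gamma> (lkp f \<gamma>))"
  by (rule poly_mapping_eqI) (simp add: lookup_sum lookup_single when_def in_keys_iff sum.delta')

section \<open>Ideals generated by monomials\<close>

lemma is_ideal_ideal_gen: "is_ideal (ideal_gen A)"
  by (auto simp: is_ideal_def ideal_gen_def)

lemma ideal_gen_superset: "A \<subseteq> ideal_gen A"
  by (auto simp: ideal_gen_def)

lemma ideal_gen_least: "is_ideal J \<Longrightarrow> A \<subseteq> J \<Longrightarrow> ideal_gen A \<subseteq> J"
  by (auto simp: ideal_gen_def)

lemma ideal_0: "is_ideal J \<Longrightarrow> 0 \<in> J"
  and ideal_add: "is_ideal J \<Longrightarrow> x \<in> J \<Longrightarrow> y \<in> J \<Longrightarrow> x + y \<in> J"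
  and ideal_mult: "is_ideal J \<Longrightarrow> x \<in> J \<Longrightarrow> r * x \<in> J"
  by (auto simp: is_ideal_def)

lemma ideal_sum: "is_ideal J \<Longrightarrow> (\<And>i. i \<in> S \<Longrightarrow> f i \<in> J) \<Longrightarrow> sum f S \<in> J"
  by (induction S rule: infinite_finite_induct) (auto simp: ideal_0 ideal_add)

lemma ideal_diff: "is_ideal J \<Longrightarrow> x \<in> J \<Longrightarrow> y \<in> J \<Longrightarrow> x - y \<in> J"
  using ideal_add[of J x "- 1 * y"] ideal_mult[of J y "- 1"] by simp

lemma is_ideal_up_closed:
  assumes "\<And>a b. a \<in> S \<Longrightarrow> b + a \<in> S"
  shows "is_ideal {f :: ('v, 'k::field) mpoly. Poly_Mapping.keys f \<subseteq> S}"
  unfolding is_ideal_def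
proof (intro conjI ballI allI)
  show "(0 :: ('v, 'k) mpoly) \<in> {f. Poly_Mapping.keys f \<subseteq> S}" by simp
next
  fix x y :: "('v, 'k) mpoly" assume "x \<in> {f. Poly_Mapping.keys f \<subseteq> S}" "y \<in> {f. Poly_Mapping.keys f \<subseteq> S}"
  then show "x + y \<in> {f. Poly_Mapping.keys f \<subseteq> S}" using Poly_Mapping.keys_add[of x y] by auto
next
  fix r x :: "('v, 'k) mpoly" assume x: "x \<in> {f. Poly_Mapping.keys f \<subseteq> S}"
  show "r * x \<in> {f. Poly_Mapping.keys f \<subseteq> S}"
  proof (intro CollectI subsetI)
    fix k assume "k \<in> Poly_Mapping.keys (r * x)"
    then obtain a b where "k = a + b" "b \<in> Poly_Mapping.keys x" using keys_mult[of r x] by auto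
    then show "k \<in> S" using x assms by auto
  qed
qed

definition mon :: "('v \<Rightarrow>\<^sub>0 nat) \<Rightarrow> ('v, 'k::field) mpoly" where
  "mon \<alpha> = Poly_Mapping.single \<alpha> 1"

text \<open>Polynomials supported on an upward closed set of exponents form an ideal, which gives
  one direction. Conversely, each term is a multiple of a generator that divides it.\<close>

theorem monomial_ideal_mem:
  "(f :: ('v, 'k::field) mpoly) \<in> ideal_gen (mon ` G) \<longleftrightarrow> (\<forall>\<gamma>\<in>Poly_Mapping.keys f. \<exists>\<alpha>\<in>G. ple \<alpha> \<gamma>)"
proof
  let ?S = "{\<gamma>. \<exists>\<alpha>\<in>G. ple \<alpha> \<gamma>}"
  have up: "b + a \<in> ?S" if "a \<in> ?S" for a b
    using that by (auto simp: ple_def lookup_add intro: trans_le_add2)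
  have "mon ` G \<subseteq> {f :: ('v, 'k) mpoly. Poly_Mapping.keys f \<subseteq> ?S}"
    by (auto simp: mon_def ple_def)
  from ideal_gen_least[OF is_ideal_up_closed[OF up] this]
  show "f \<in> ideal_gen (mon ` G) \<Longrightarrow> \<forall>\<gamma>\<in>Poly_Mapping.keys f. \<exists>\<alpha>\<in>G. ple \<alpha> \<gamma>" by auto
next
  assume h: "\<forall>\<gamma>\<in>Poly_Mapping.keys f. \<exists>\<alpha>\<in>G. ple \<alpha> \<gamma>"
  have "(\<Sum>\<gamma>\<in>Poly_Mapping.keys f. Poly_Mapping.single \<gamma> (lkp f \<gamma>)) \<in> ideal_gen (mon ` G)"
  proof (rule ideal_sum[OF is_ideal_ideal_gen])
    fix \<gamma> assume "\<gamma> \<in> Poly_Mapping.keys f"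
    then obtain \<alpha> where a: "\<alpha> \<in> G" "ple \<alpha> \<gamma>" using h by blast
    have "Poly_Mapping.single \<gamma> (lkp f \<gamma>) = Poly_Mapping.single (\<gamma> - \<alpha>) (lkp f \<gamma>) * mon \<alpha>"
      by (simp add: mon_def mult_single ple_diff_add[OF a(2)])
    also have "\<dots> \<in> ideal_gen (mon ` G)"
      by (rule ideal_mult[OF is_ideal_ideal_gen]) (use a(1) ideal_gen_superset[of "mon ` G"] in auto)
    finally show "Poly_Mapping.single \<gamma> (lkp f \<gamma>) \<in> ideal_gen (mon ` G)" .
  qed
  then show "f \<in> ideal_gen (mon ` G)" using poly_mapping_sum_single[of f] by simp
qed

text \<open>Multiplication by a monomial only shifts exponents. So an earlier generator divides the
  new monomial times any given term of \<open>g\<close>, and by coprimality it divides the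
  term.\<close>

theorem coprime_complete_intersection:
  assumes E: "finite E" and cop: "\<And>\<alpha> \<beta> v. \<alpha> \<in> E \<Longrightarrow> \<beta> \<in> E \<Longrightarrow> \<alpha> \<noteq> \<beta> \<Longrightarrow> lkp \<alpha> v = 0 \<or> lkp \<beta> v = 0"
    and proper: "ideal_gen (mon ` E) \<noteq> (UNIV :: ('v::finite, 'k::field) mpoly set)"
  shows "complete_intersection (ideal_gen (mon ` E) :: ('v, 'k) mpoly set)"
proof -
  obtain xs where xs: "set xs = E" "distinct xs" using finite_distinct_list[OF E] by blast
  let ?fs = "map mon xs :: ('v, 'k) mpoly list"
  have "regular_sequence ?fs" unfolding regular_sequence_def
  proof (intro conjI allI impI)
    show "ideal_gen (set ?fs) \<noteq> UNIV" using proper xs by simp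
    fix i and g :: "('v, 'k) mpoly"
    assume i: "i < length ?fs" and g: "?fs ! i * g \<in> ideal_gen (set (take i ?fs))"
    have t: "set (take i ?fs) = mon ` set (take i xs)" by (simp add: take_map)
    have fi: "?fs ! i = mon (xs ! i)" using i by simp
    show "g \<in> ideal_gen (set (take i ?fs))"
      unfolding t monomial_ideal_mem
    proof
      fix \<gamma> assume k: "\<gamma> \<in> Poly_Mapping.keys g"
      have "lkp (mon (xs ! i) * g) (xs ! i + \<gamma>) = lkp g \<gamma>"
        by (simp add: mon_def lookup_single_times ple_add)
      then have "xs ! i + \<gamma> \<in> Poly_Mapping.keys (mon (xs ! i) * g)" using k by (simp add: in_keys_iff)
      moreover have "\<forall>\<gamma>\<in>Poly_Mapping.keys (mon (xs ! i) * g). \<exists>\<alpha>\<in>set (take i xs). ple \<alpha> \<gamma>"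
        using g unfolding t fi monomial_ideal_mem .
      ultimately obtain \<beta> where b: "\<beta> \<in> set (take i xs)" "ple \<beta> (xs ! i + \<gamma>)" by blast
      obtain j where j: "j < i" "j < length xs" "\<beta> = xs ! j" using b(1) unfolding in_set_conv_nth by auto
      have "\<beta> \<noteq> xs ! i" using j i xs(2) by (simp add: nth_eq_iff_index_eq)
      moreover have "\<beta> \<in> E" "xs ! i \<in> E" using j i xs(1) nth_mem by auto
      ultimately have c: "lkp \<beta> v = 0 \<or> lkp (xs ! i) v = 0" for v by (intro cop)
      have "ple \<beta> \<gamma>" unfolding ple_def
      proof
        fix v
        have "lkp \<beta> v \<le> lkp (xs ! i) v + lkp \<gamma> v" using b(2) by (simp add: ple_def lookup_add)
        then show "lkp \<beta> v \<le> lkp \<gamma> v" using c[of v] by auto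
      qed
      then show "\<exists>\<alpha>\<in>set (take i xs). ple \<alpha> \<gamma>" using b(1) by blast
    qed
  qed
  then show ?thesis unfolding complete_intersection_def using xs by (intro exI[of _ ?fs]) simp
qed

text \<open>Takes the place of Dickson's lemma: for each of the finitely many terms of a finite
  generating set one monomial generator dividing it is kept. The finite set will come from the first
  matrix of the given resolution.\<close>

lemma monomial_ideal_finite:
  assumes m: "monomial_ideal (I :: ('v::finite, 'k::field) mpoly set)" and g: "I = ideal_gen (set fs)"
  obtains E where "finite E" "I = ideal_gen (mon ` E)"
proof -
  obtain M where M: "\<forall>g\<in>M. monomial g" "I = ideal_gen M" using m by (auto simp: monomial_ideal_def)
  define G where "G = {\<alpha>. (mon \<alpha> :: ('v, 'k) mpoly) \<in> M}"
  have "M = mon ` G" using M(1) by (auto simp: G_def monomial_def mon_def)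
  then have I: "I = ideal_gen (mon ` G)" using M by simp
  let ?K = "\<Union>f\<in>set fs. Poly_Mapping.keys f"
  have "\<forall>\<gamma>\<in>?K. \<exists>\<alpha>\<in>G. ple \<alpha> \<gamma>"
  proof
    fix \<gamma> assume "\<gamma> \<in> ?K"
    then obtain f where f: "f \<in> set fs" "\<gamma> \<in> Poly_Mapping.keys f" by blast
    have "f \<in> I" using f(1) g ideal_gen_superset by blast
    then show "\<exists>\<alpha>\<in>G. ple \<alpha> \<gamma>" using f(2) unfolding I monomial_ideal_mem by blast
  qed
  then have "\<forall>\<gamma>\<in>?K. \<exists>\<alpha>. \<alpha> \<in> G \<and> ple \<alpha> \<gamma>" by blast
  from bchoice[OF this] obtain h where h: "\<forall>\<gamma>\<in>?K. h \<gamma> \<in> G \<and> ple (h \<gamma>) \<gamma>" ..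
  let ?E = "h ` ?K"
  have "finite ?E" by simp
  moreover have "I = ideal_gen (mon ` ?E)"
  proof
    have "set fs \<subseteq> ideal_gen (mon ` ?E)"
    proof
      fix f assume f: "f \<in> set fs"
      show "f \<in> ideal_gen (mon ` ?E)" unfolding monomial_ideal_mem
      proof
        fix \<gamma> assume "\<gamma> \<in> Poly_Mapping.keys f"
        then have k: "\<gamma> \<in> ?K" using f by blast
        show "\<exists>\<alpha>\<in>?E. ple \<alpha> \<gamma>" using imageI[OF k, of h] h k by blast
      qed
    qed
    then show "I \<subseteq> ideal_gen (mon ` ?E)" unfolding g by (rule ideal_gen_least[OF is_ideal_ideal_gen])
    have "?E \<subseteq> G" using h by blast
    then have "mon ` ?E \<subseteq> ideal_gen (mon ` G :: ('v, 'k) mpoly set)"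
      using ideal_gen_superset[of "mon ` G"] by (meson image_mono order_trans)
    then show "ideal_gen (mon ` ?E) \<subseteq> I" unfolding I by (rule ideal_gen_least[OF is_ideal_ideal_gen])
  qed
  ultimately show ?thesis by (rule that)
qed

section \<open>The height of an ideal of variables\<close>

text \<open>The prime generated by the variables in \<open>A\<close>, described by exponents so that
  membership is tested term by term.\<close>

definition var_prime :: "'v set \<Rightarrow> ('v, 'k::field) mpoly set" where
  "var_prime A = {f. Poly_Mapping.keys f \<subseteq> {\<gamma>. \<exists>v\<in>A. lkp \<gamma> v > 0}}"

lemma is_ideal_var_prime: "is_ideal (var_prime A)"
  unfolding var_prime_def by (rule is_ideal_up_closed) (auto simp: lookup_add)

text \<open>The variables carry no order. An embedding into the natural numbers moves exponents to a
  type with a linear order compatible with addition and so supplies a monomial order.\<close>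

definition to_nat_exp :: "('v::finite \<Rightarrow>\<^sub>0 nat) \<Rightarrow> (nat \<Rightarrow>\<^sub>0 nat)" where
  "to_nat_exp \<alpha> = (\<Sum>v\<in>UNIV. Poly_Mapping.single ((SOME e :: 'v \<Rightarrow> nat. inj e) v) (lkp \<alpha> v))"

lemma to_nat_exp_add: "to_nat_exp (\<alpha> + \<beta>) = to_nat_exp \<alpha> + to_nat_exp \<beta>"
  by (simp add: to_nat_exp_def lookup_add single_add sum.distrib)

lemma inj_to_nat_exp: "inj (to_nat_exp :: ('v::finite \<Rightarrow>\<^sub>0 nat) \<Rightarrow> _)"
proof (rule injI)
  fix \<alpha> \<beta> :: "'v \<Rightarrow>\<^sub>0 nat" assume eq: "to_nat_exp \<alpha> = to_nat_exp \<beta>"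
  let ?e = "SOME e :: 'v \<Rightarrow> nat. inj e"
  have "\<exists>e :: 'v \<Rightarrow> nat. inj e" using finite_imp_inj_to_nat_seg[of "UNIV :: 'v set"] by auto
  then have e: "inj ?e" by (rule someI_ex)
  have *: "lkp (to_nat_exp \<gamma>) (?e v) = lkp \<gamma> v" for \<gamma> :: "'v \<Rightarrow>\<^sub>0 nat" and v
  proof -
    have "lkp (to_nat_exp \<gamma>) (?e v) = (\<Sum>u\<in>UNIV. if u = v then lkp \<gamma> u else 0)"
      unfolding to_nat_exp_def lookup_sum lookup_single when_def using inj_eq[OF e] by (intro sum.cong) auto
    then show ?thesis by simp
  qed
  show "\<alpha> = \<beta>" by (rule poly_mapping_eqI) (metis * eq)
qed

lemma leading_key:
  assumes "finite S" "S \<noteq> {}"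
  obtains m :: "'v::finite \<Rightarrow>\<^sub>0 nat" where "m \<in> S" "\<And>a. a \<in> S \<Longrightarrow> to_nat_exp a \<le> to_nat_exp m"
proof -
  have "Max (to_nat_exp ` S) \<in> to_nat_exp ` S" using assms by (intro Max_in) auto
  then obtain m where m: "m \<in> S" "to_nat_exp m = Max (to_nat_exp ` S)" by auto
  then have "to_nat_exp a \<le> to_nat_exp m" if "a \<in> S" for a using assms that by simp
  then show ?thesis using m(1) that by blast
qed

text \<open>A leading term argument restricted to the exponents that vanish on \<open>A\<close>: the
  product has a nonzero coefficient at the sum of the two leading exponents of this kind.\<close>

lemma is_prime_var_prime: "is_prime_ideal (var_prime A :: ('v::finite, 'k::field) mpoly set)"
  unfolding is_prime_ideal_def
proof (intro conjI allI impI)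
  show "is_ideal (var_prime A :: ('v, 'k) mpoly set)" by (rule is_ideal_var_prime)
  have "(1 :: ('v, 'k) mpoly) \<notin> var_prime A" by (simp add: var_prime_def)
  then show "var_prime A \<noteq> (UNIV :: ('v, 'k) mpoly set)" by blast
  fix a b :: "('v, 'k) mpoly" assume ab: "a * b \<in> var_prime A"
  show "a \<in> var_prime A \<or> b \<in> var_prime A"
  proof (rule ccontr)
    assume n: "\<not> ?thesis"
    let ?N = "{\<gamma>. \<forall>v\<in>A. lkp \<gamma> v = 0}"
    have ne: "Poly_Mapping.keys a \<inter> ?N \<noteq> {}" "Poly_Mapping.keys b \<inter> ?N \<noteq> {}"
      using n by (auto simp: var_prime_def)
    obtain p where p: "p \<in> Poly_Mapping.keys a \<inter> ?N" and pm: "\<And>x. x \<in> Poly_Mapping.keys a \<inter> ?N \<Longrightarrow> to_nat_exp x \<le> to_nat_exp p"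
      using leading_key[OF _ ne(1)] by auto
    obtain q where q: "q \<in> Poly_Mapping.keys b \<inter> ?N" and qm: "\<And>x. x \<in> Poly_Mapping.keys b \<inter> ?N \<Longrightarrow> to_nat_exp x \<le> to_nat_exp q"
      using leading_key[OF _ ne(2)] by auto
    have u: "p + q = l + r \<longleftrightarrow> l = p \<and> r = q" if l: "l \<in> Poly_Mapping.keys a" and r: "r \<in> Poly_Mapping.keys b" for l r
    proof
      assume e: "p + q = l + r"
      have "lkp l v + lkp r v = 0" if "v \<in> A" for v
        using that p q e[symmetric] by (simp add: lookup_add[symmetric]) (simp add: lookup_add)
      then have "l \<in> ?N" "r \<in> ?N" by auto
      then have le: "to_nat_exp l \<le> to_nat_exp p" "to_nat_exp r \<le> to_nat_exp q" using l r pm qm by auto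
      have s: "to_nat_exp l + to_nat_exp r = to_nat_exp p + to_nat_exp q" using e by (metis to_nat_exp_add)
      have "to_nat_exp l = to_nat_exp p"
      proof (rule ccontr)
        assume "to_nat_exp l \<noteq> to_nat_exp p"
        then have "to_nat_exp l + to_nat_exp r < to_nat_exp p + to_nat_exp q"
          using le by (intro add_less_le_mono) auto
        then show False using s by simp
      qed
      then have lp: "l = p" by (rule injD[OF inj_to_nat_exp])
      then show "l = p \<and> r = q" using e by simp
    qed simp
    have "lkp (a * b) (p + q) = (\<Sum>l\<in>Poly_Mapping.keys a. \<Sum>r\<in>Poly_Mapping.keys b. if r = q then (if l = p then lkp a p * lkp b q else 0) else 0)"
      unfolding lookup_times_sum using u by (intro sum.cong refl) auto
    also have "\<dots> = lkp a p * lkp b q" using p q by simp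
    finally have "lkp (a * b) (p + q) \<noteq> 0" using p q by (simp add: in_keys_iff)
    then have "p + q \<in> Poly_Mapping.keys (a * b)" by (simp add: in_keys_iff)
    then obtain v where "v \<in> A" "lkp (p + q) v > 0" using ab by (auto simp: var_prime_def)
    then show False using p q by (simp add: lookup_add)
  qed
qed

section \<open>Growth of independent families modulo a prime\<close>

definition box :: "'v set \<Rightarrow> nat \<Rightarrow> ('v \<Rightarrow>\<^sub>0 nat) set" where
  "box A D = {\<gamma>. (\<forall>v. lkp \<gamma> v \<le> D) \<and> (\<forall>v\<in>A. lkp \<gamma> v = 0)}"

lemma box_bij:
  "bij_betw (\<lambda>\<gamma>. restrict (lkp \<gamma>) (- A)) (box A D) (PiE (- A :: 'v::finite set) (\<lambda>_. {..D}))"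
proof (rule bij_betw_byWitness[where f' = "\<lambda>h. Abs_poly_mapping (\<lambda>v. if v \<in> A then 0 else h v)"])
  have l: "lkp (Abs_poly_mapping h) = h" for h :: "'v \<Rightarrow> nat" by (simp add: lookup_Abs_poly_mapping)
  show "\<forall>\<gamma>\<in>box A D. Abs_poly_mapping (\<lambda>v. if v \<in> A then 0 else restrict (lkp \<gamma>) (- A) v) = \<gamma>"
  proof
    fix \<gamma> assume g: "\<gamma> \<in> box A D"
    show "Abs_poly_mapping (\<lambda>v. if v \<in> A then 0 else restrict (lkp \<gamma>) (- A) v) = \<gamma>"
      by (rule poly_mapping_eqI) (use g in \<open>auto simp: l box_def\<close>)
  qed
  show "\<forall>h\<in>PiE (- A) (\<lambda>_. {..D}). restrict (lkp (Abs_poly_mapping (\<lambda>v. if v \<in> A then 0 else h v))) (- A) = h"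
    unfolding l by (auto simp: restrict_def PiE_def extensional_def fun_eq_iff)
  show "(\<lambda>\<gamma>. restrict (lkp \<gamma>) (- A)) ` box A D \<subseteq> PiE (- A) (\<lambda>_. {..D})" by (auto simp: box_def)
  show "(\<lambda>h. Abs_poly_mapping (\<lambda>v. if v \<in> A then 0 else h v)) ` PiE (- A) (\<lambda>_. {..D}) \<subseteq> box A D"
    unfolding box_def by (auto simp: l PiE_def Pi_def)
qed

lemma finite_box: "finite (box (A :: 'v::finite set) D)"
  using bij_betw_finite[OF box_bij[of A D]] by (simp add: finite_PiE)

lemma card_box: "card (box (A :: 'v::finite set) D) = Suc D ^ card (- A)"
  using bij_betw_same_card[OF box_bij[of A D]] by (simp add: card_PiE)

text \<open>States that the Hilbert function of the quotient by \<open>P\<close>, with degrees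
  bounded by \<open>E\<close> in each variable separately, is at least \<open>N\<close>;
  \<open>c\<close> ranges over scalars.\<close>

definition indep_mod :: "('v::finite, 'k::field) mpoly set \<Rightarrow> nat \<Rightarrow> nat \<Rightarrow> bool" where
  "indep_mod P N E \<longleftrightarrow> (\<exists>u :: nat \<Rightarrow> ('v, 'k) mpoly. (\<forall>j<N. Poly_Mapping.keys (u j) \<subseteq> box {} E) \<and>
     (\<forall>c. (\<Sum>j<N. Poly_Mapping.single 0 (c j) * u j) \<in> P \<longrightarrow> (\<forall>j<N. c j = 0)))"

lemma keys_mult_box:
  fixes p :: "('v::finite, 'k::field) mpoly"
  assumes "Poly_Mapping.keys p \<subseteq> box {} a" "Poly_Mapping.keys q \<subseteq> box {} b"
  shows "Poly_Mapping.keys (p * q) \<subseteq> box {} (a + b)"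
proof
  fix k assume "k \<in> Poly_Mapping.keys (p * q)"
  then obtain x y where k: "k = x + y" "x \<in> Poly_Mapping.keys p" "y \<in> Poly_Mapping.keys q" using keys_mult[of p q] by auto
  then have "x \<in> box {} a" "y \<in> box {} b" using assms by auto
  then show "k \<in> box {} (a + b)" unfolding k(1) box_def by (simp add: lookup_add add_mono)
qed

lemma keys_power_box:
  fixes p :: "('v::finite, 'k::field) mpoly"
  assumes "Poly_Mapping.keys p \<subseteq> box {} a"
  shows "Poly_Mapping.keys (p ^ n) \<subseteq> box {} (n * a)"
proof (induction n)
  case 0
  then show ?case by (simp add: box_def)
next
  case (Suc n)
  then show ?case using keys_mult_box[OF assms Suc] by simp
qed

lemma box_mono: "a \<le> b \<Longrightarrow> box A a \<subseteq> box A b"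
  by (auto simp: box_def intro: order_trans)

lemma sum_lessThan_add: "(\<Sum>j<a + b. g j) = (\<Sum>j<a. g j) + (\<Sum>j<b. g (a + j :: nat))"
  by (induction b) (auto simp: add.assoc)

text \<open>In a relation modulo \<open>P\<close> between the products of powers of \<open>f\<close>
  with the \<open>u\<close>, reduction modulo \<open>Q\<close> shows that the coefficients at the
  power 0 vanish; the rest is divisible by \<open>f\<close>, which cancels because \<open>P\<close>
  is prime. Quotient and remainder of \<open>j\<close> by \<open>N\<close> encode the power and the
  index of \<open>u\<close>.\<close>

lemma independence_powers:
  fixes f :: "('v::finite, 'k::field) mpoly"
  assumes P: "is_prime_ideal P" and Q: "is_ideal Q" and PQ: "P \<subseteq> Q" and f: "f \<in> Q" "f \<notin> P" and N: "N > 0"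
    and u: "\<And>c. (\<Sum>j<N. Poly_Mapping.single 0 (c j) * u j) \<in> Q \<Longrightarrow> \<forall>j<N. c j = 0"
  shows "(\<Sum>j<Suc D * N. Poly_Mapping.single 0 (c j) * (f ^ (j div N) * u (j mod N))) \<in> P \<Longrightarrow> \<forall>j<Suc D * N. c j = 0"
proof (induction D arbitrary: c)
  case 0
  have "(\<Sum>j<N. Poly_Mapping.single 0 (c j) * u j) = (\<Sum>j<Suc 0 * N. Poly_Mapping.single 0 (c j) * (f ^ (j div N) * u (j mod N)))"
    by (intro sum.cong) auto
  then have "(\<Sum>j<N. Poly_Mapping.single 0 (c j) * u j) \<in> Q" using 0 PQ by auto
  then show ?case using u[of c] by simp
next
  case (Suc D)
  let ?t = "\<lambda>j. Poly_Mapping.single 0 (c j) * (f ^ (j div N) * u (j mod N))"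
  let ?g = "\<Sum>j<N. Poly_Mapping.single 0 (c j) * u j"
  let ?R = "\<Sum>j<Suc D * N. Poly_Mapping.single 0 (c (N + j)) * (f ^ (j div N) * u (j mod N))"
  have "(\<Sum>j<Suc (Suc D) * N. ?t j) = (\<Sum>j<N + Suc D * N. ?t j)" by simp
  also have "\<dots> = (\<Sum>j<N. ?t j) + (\<Sum>j<Suc D * N. ?t (N + j))" by (rule sum_lessThan_add)
  also have "(\<Sum>j<N. ?t j) = ?g" by (intro sum.cong) auto
  also have "(\<Sum>j<Suc D * N. ?t (N + j)) = f * ?R"
    unfolding sum_distrib_left using N by (intro sum.cong refl) (simp add: mult_ac)
  finally have tot: "?g + f * ?R \<in> P" using Suc.prems by simp
  have "f * ?R \<in> Q" using ideal_mult[OF Q f(1), of ?R] by (simp add: mult.commute)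
  then have "(?g + f * ?R) - f * ?R \<in> Q" using tot PQ by (intro ideal_diff[OF Q]) auto
  then have "?g \<in> Q" by simp
  then have c0: "\<forall>j<N. c j = 0" by (rule u)
  then have "?g = 0" by simp
  then have "f * ?R \<in> P" using tot by simp
  then have "?R \<in> P" using P f(2) unfolding is_prime_ideal_def by blast
  then have c1: "\<forall>j<Suc D * N. c (N + j) = 0" by (rule Suc.IH)
  show ?case
  proof (intro allI impI)
    fix j assume j: "j < Suc (Suc D) * N"
    show "c j = 0"
    proof (cases "j < N")
      case False
      then have "j - N < Suc D * N" using j by simp
      then show ?thesis using c1[rule_format, of "j - N"] False by simp
    qed (use c0 in simp)
  qed
qed

lemma indep_mod_step:
  fixes f :: "('v::finite, 'k::field) mpoly"
  assumes "is_prime_ideal P" "is_ideal Q" "P \<subseteq> Q" "f \<in> Q" "f \<notin> P" "Poly_Mapping.keys f \<subseteq> box {} e"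
    and "indep_mod Q N E" "N > 0"
  shows "indep_mod P (Suc D * N) (D * e + E)"
proof -
  obtain u where u: "\<And>j. j < N \<Longrightarrow> Poly_Mapping.keys (u j) \<subseteq> box {} E"
    "\<And>c. (\<Sum>j<N. Poly_Mapping.single 0 (c j) * u j) \<in> Q \<Longrightarrow> \<forall>j<N. c j = 0"
    using assms(7) unfolding indep_mod_def by blast
  show ?thesis unfolding indep_mod_def
  proof (intro exI[of _ "\<lambda>j. f ^ (j div N) * u (j mod N)"] conjI allI impI)
    fix j assume "j < Suc D * N"
    then have d: "j div N \<le> D" using assms(8) by (metis div_less_iff_less_mult less_Suc_eq_le)
    have "Poly_Mapping.keys (f ^ (j div N) * u (j mod N)) \<subseteq> box {} ((j div N) * e + E)"
      by (rule keys_mult_box[OF keys_power_box[OF assms(6)] u(1)]) (use assms(8) in simp)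
    also have "\<dots> \<subseteq> box {} (D * e + E)" using d by (intro box_mono) simp
    finally show "Poly_Mapping.keys (f ^ (j div N) * u (j mod N)) \<subseteq> box {} (D * e + E)" .
  next
    fix c j assume "(\<Sum>j<Suc D * N. Poly_Mapping.single 0 (c j) * (f ^ (j div N) * u (j mod N))) \<in> P" "j < Suc D * N"
    then show "c j = 0" using independence_powers[OF assms(1-5,8) u(2), where D=D and c=c] by blast
  qed
qed

lemma keys_box_exists:
  fixes f :: "('v::finite, 'k::field) mpoly"
  shows "\<exists>e. Poly_Mapping.keys f \<subseteq> box {} e"
proof -
  let ?S = "(\<lambda>(\<gamma>, v). lkp \<gamma> v) ` (Poly_Mapping.keys f \<times> (UNIV :: 'v set))"
  have "finite ?S" by simp
  then have "lkp \<gamma> v \<le> Max ?S" if "\<gamma> \<in> Poly_Mapping.keys f" for \<gamma> v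
    using that by (intro Max_ge) auto
  then show ?thesis by (intro exI[of _ "Max ?S"]) (auto simp: box_def)
qed

text \<open>Each step of the chain multiplies the count by \<open>Suc D\<close>, while the degree
  bound grows linearly in \<open>D\<close>. The slope \<open>C\<close> adds up the degree bounds of
  the elements separating consecutive primes, so it depends on the chain alone and can be fixed
  before \<open>D\<close>.\<close>

lemma indep_mod_chain:
  fixes P :: "nat \<Rightarrow> ('v::finite, 'k::field) mpoly set"
  shows "(\<forall>i\<le>n. is_prime_ideal (P i)) \<Longrightarrow> (\<forall>i<n. P i \<subset> P (Suc i)) \<Longrightarrow>
    \<exists>C. \<forall>D N E. indep_mod (P n) N E \<longrightarrow> N > 0 \<longrightarrow> indep_mod (P 0) (Suc D ^ n * N) (D * C + E)"
proof (induction n)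
  case 0
  show ?case by (rule exI[of _ 0]) simp
next
  case (Suc n)
  then obtain C where C: "\<And>D N E. indep_mod (P n) N E \<Longrightarrow> N > 0 \<Longrightarrow> indep_mod (P 0) (Suc D ^ n * N) (D * C + E)"
    by auto
  obtain f where f: "f \<in> P (Suc n)" "f \<notin> P n" using Suc.prems(2) by blast
  obtain e where e: "Poly_Mapping.keys f \<subseteq> box {} e" using keys_box_exists by blast
  have pr: "is_prime_ideal (P n)" "is_ideal (P (Suc n))" "P n \<subseteq> P (Suc n)"
    using Suc.prems by (auto simp: is_prime_ideal_def)
  have "indep_mod (P 0) (Suc D ^ Suc n * N) (D * (C + e) + E)" if i: "indep_mod (P (Suc n)) N E" "N > 0" for D N E
  proof -
    have "indep_mod (P n) (Suc D * N) (D * e + E)" by (rule indep_mod_step[OF pr f e i])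
    from C[OF this, of D] i(2) show ?thesis by (simp add: algebra_simps)
  qed
  then show ?case by blast
qed

lemma indep_mod_var_prime:
  "indep_mod (var_prime A :: ('v::finite, 'k::field) mpoly set) (Suc D ^ card (- A)) D"
proof -
  let ?N = "Suc D ^ card (- A)"
  obtain e where e: "bij_betw e {..<?N} (box A D)"
    using ex_bij_betw_nat_finite[OF finite_box[of A D]] by (auto simp: card_box lessThan_atLeast0)
  have eb: "e j \<in> box A D" if "j < ?N" for j using e that by (auto simp: bij_betw_def)
  show ?thesis unfolding indep_mod_def
  proof (intro exI[of _ "\<lambda>j. mon (e j)"] conjI allI impI)
    fix j assume "j < ?N"
    then show "Poly_Mapping.keys (mon (e j) :: ('v, 'k) mpoly) \<subseteq> box {} D" using eb[of j] by (auto simp: mon_def box_def)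
  next
    fix c j assume s: "(\<Sum>j<?N. Poly_Mapping.single 0 (c j) * mon (e j)) \<in> (var_prime A :: ('v, 'k) mpoly set)" and j: "j < ?N"
    have "lkp (\<Sum>i<?N. Poly_Mapping.single 0 (c i) * mon (e i)) (e j) = (\<Sum>i<?N. if i = j then c i else 0)"
      unfolding lookup_sum mon_def mult_single lookup_single when_def
      using e j by (intro sum.cong) (auto simp: bij_betw_def inj_on_def)
    then have l: "lkp (\<Sum>i<?N. Poly_Mapping.single 0 (c i) * mon (e i)) (e j) = c j" using j by simp
    show "c j = 0"
    proof (rule ccontr)
      assume "c j \<noteq> 0"
      then have "e j \<in> Poly_Mapping.keys (\<Sum>i<?N. Poly_Mapping.single 0 (c i) * mon (e i) :: ('v, 'k) mpoly)"
        using l by (simp add: in_keys_iff)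
      then obtain v where "v \<in> A" "lkp (e j) v > 0" using s unfolding var_prime_def by blast
      then show False using eb[OF j] by (auto simp: box_def)
    qed
  qed
qed

lemma indep_mod_bound:
  assumes "indep_mod (P :: ('v::finite, 'k::field) mpoly set) N E" "0 \<in> P"
  shows "N \<le> Suc E ^ card (UNIV :: 'v set)"
proof -
  obtain u where u: "\<And>j. j < N \<Longrightarrow> Poly_Mapping.keys (u j) \<subseteq> box {} E"
    "\<And>c. (\<Sum>j<N. Poly_Mapping.single 0 (c j) * u j) \<in> P \<Longrightarrow> \<forall>j<N. c j = 0"
    using assms(1) unfolding indep_mod_def by blast
  define L where "L = (\<lambda>(c :: nat \<Rightarrow> 'k) \<gamma>. \<Sum>j<N. c j * lkp (u j) \<gamma>)"
  have lin: "Vector_Spaces.linear fscale fscale L"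
    unfolding L_def by (rule linear_fscaleI) (auto simp: algebra_simps sum.distrib sum_distrib_left)
  let ?V = "fsupp {..<N} :: (nat \<Rightarrow> 'k) set"
  have "{c \<in> ?V. L c = 0} = {0}"
  proof (intro equalityI subsetI)
    fix c assume c: "c \<in> {c \<in> ?V. L c = 0}"
    have "(\<Sum>j<N. Poly_Mapping.single 0 (c j) * u j) = 0"
    proof (rule poly_mapping_eqI)
      fix \<gamma>
      have "lkp (\<Sum>j<N. Poly_Mapping.single 0 (c j) * u j) \<gamma> = L c \<gamma>"
        unfolding L_def lookup_sum lookup_single_times by (intro sum.cong refl) (simp add: ple_def)
      then show "lkp (\<Sum>j<N. Poly_Mapping.single 0 (c j) * u j) \<gamma> = lkp 0 \<gamma>" using c by simp
    qed
    then have "\<forall>j<N. c j = 0" using u(2)[of c] assms(2) by simp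
    then have "c x = 0" for x using c fsuppD[of c "{..<N}" x] by (cases "x < N") auto
    then show "c \<in> {0}" by (simp add: fun_eq_iff)
  next
    fix c :: "nat \<Rightarrow> 'k" assume "c \<in> {0}"
    then show "c \<in> {c \<in> ?V. L c = 0}" by (simp add: fsupp_def L_def fun_eq_iff)
  qed
  then have "fv.dim ?V = fv.dim (L ` ?V)"
    using fv_rank_nullity[OF lin subspace_fsupp[of "{..<N}"] _ order_refl] fv_dim_zero[where 'k='k and 'x=nat] by simp
  also have "\<dots> \<le> card (box ({} :: 'v set) E)"
  proof (rule fv_dim_le_card[OF finite_box])
    show "L ` ?V \<subseteq> fsupp (box {} E)"
    proof (rule image_subsetI)
      fix c
      have "L c \<gamma> = 0" if "\<gamma> \<notin> box {} E" for \<gamma>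
        unfolding L_def
      proof (rule sum.neutral, intro ballI)
        fix j assume "j \<in> {..<N}"
        then have "\<gamma> \<notin> Poly_Mapping.keys (u j)" using u(1)[of j] that by auto
        then show "c j * lkp (u j) \<gamma> = 0" by (simp add: in_keys_iff)
      qed
      then show "L c \<in> fsupp (box {} E)" by (simp add: fsupp_def)
    qed
  qed
  finally show ?thesis using dim_fsupp[of "{..<N}", where 'k='k] card_box[of "{} :: 'v set" E] by simp
qed

text \<open>A chain of length \<open>n\<close> yields independent polynomials whose number grows in
  \<open>D\<close> with exponent \<open>n + card (- A)\<close>, inside a space that grows with
  exponent the number of variables. Hence \<open>n\<close> is at most \<open>card A\<close>.\<close>

theorem prime_height_var_prime:
  "prime_height (var_prime A :: ('v::finite, 'k::field) mpoly set) \<le> enat (card A)"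
  unfolding prime_height_def
proof (rule Sup_least)
  fix x assume "x \<in> {enat n |n. \<exists>P :: nat \<Rightarrow> ('v, 'k) mpoly set.
      (\<forall>i\<le>n. is_prime_ideal (P i)) \<and> (\<forall>i<n. P i \<subset> P (Suc i)) \<and> P n = var_prime A}"
  then obtain n and P :: "nat \<Rightarrow> ('v, 'k) mpoly set" where x: "x = enat n"
    and P: "\<forall>i\<le>n. is_prime_ideal (P i)" "\<forall>i<n. P i \<subset> P (Suc i)" "P n = var_prime A" by blast
  obtain C where C: "\<And>D N E. indep_mod (P n) N E \<Longrightarrow> N > 0 \<Longrightarrow> indep_mod (P 0) (Suc D ^ n * N) (D * C + E)"
    using indep_mod_chain[OF P(1,2)] by blast
  have z: "0 \<in> P 0" using P(1) by (auto simp: is_prime_ideal_def is_ideal_def)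
  \<comment> \<open>With v variables, linear degree growth can inflate the count by the factor
    \<open>Suc C\<close> to the power v. This choice lets one additional factor \<open>Suc M\<close>
    exceed it.\<close>
  define M where "M = Suc C ^ card (UNIV :: 'v set)"
  have bound: "Suc M ^ n * Suc M ^ card (- A) \<le> Suc (M * C + M) ^ card (UNIV :: 'v set)"
    by (rule indep_mod_bound[OF C z]) (use indep_mod_var_prime[of A M] P(3) in simp_all)
  show "x \<le> enat (card A)"
  proof (rule ccontr)
    assume "\<not> ?thesis"
    then have n: "card A < n" using x by simp
    have cA: "card (- A) = card (UNIV :: 'v set) - card A" by (simp add: Compl_eq_Diff_UNIV card_Diff_subset)
    have "card A \<le> card (UNIV :: 'v set)" by (simp add: card_mono)
    then have "Suc (card (UNIV :: 'v set)) \<le> n + card (- A)" using n cA by simp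
    then have "Suc M ^ Suc (card (UNIV :: 'v set)) \<le> Suc M ^ (n + card (- A))" by (intro power_increasing) auto
    also have "\<dots> \<le> Suc (M * C + M) ^ card (UNIV :: 'v set)" using bound by (simp add: power_add)
    also have "\<dots> \<le> (Suc C * Suc M) ^ card (UNIV :: 'v set)" by (intro power_mono) auto
    also have "\<dots> = M * Suc M ^ card (UNIV :: 'v set)" by (simp only: power_mult_distrib M_def)
    finally show False by simp
  qed
qed

section \<open>Comparison of free resolutions\<close>

definition mm :: "'z set \<Rightarrow> ('y \<Rightarrow> 'z \<Rightarrow> 'a::comm_ring_1) \<Rightarrow> ('z \<Rightarrow> 'x \<Rightarrow> 'a) \<Rightarrow> 'y \<Rightarrow> 'x \<Rightarrow> 'a" where
  "mm Z A B = (\<lambda>y x. \<Sum>z\<in>Z. A y z * B z x)"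

lemma mm_assoc: "mm Z A (mm W B C) = mm W (mm Z A B) C"
proof (intro ext)
  fix y x
  have "mm Z A (mm W B C) y x = (\<Sum>z\<in>Z. \<Sum>w\<in>W. A y z * B z w * C w x)"
    by (simp add: mm_def sum_distrib_left mult.assoc)
  also have "\<dots> = (\<Sum>w\<in>W. \<Sum>z\<in>Z. A y z * B z w * C w x)" by (rule sum.swap)
  also have "\<dots> = mm W (mm Z A B) C y x" by (simp add: mm_def sum_distrib_right)
  finally show "mm Z A (mm W B C) y x = mm W (mm Z A B) C y x" .
qed

lemma mm_0_right [simp]: "mm Z A 0 = 0" and mm_0_left [simp]: "mm Z 0 B = 0"
  by (simp_all add: mm_def fun_eq_iff)

lemma mm_diff_right: "mm Z A (B - C) = mm Z A B - mm Z A C"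
  by (simp add: mm_def fun_eq_iff algebra_simps sum_subtractf)

lemma mm_diff_left: "mm Z (A - B) C = mm Z A C - mm Z B C"
  by (simp add: mm_def fun_eq_iff algebra_simps sum_subtractf)

definition msupp :: "'y set \<Rightarrow> 'x set \<Rightarrow> ('y \<Rightarrow> 'x \<Rightarrow> 'a::comm_ring_1) set" where
  "msupp Y X = {A. \<forall>y x. y \<notin> Y \<or> x \<notin> X \<longrightarrow> A y x = 0}"

lemma msupp_mm: "A \<in> msupp Y Z \<Longrightarrow> B \<in> msupp W X \<Longrightarrow> mm Z' A B \<in> msupp Y X"
  unfolding msupp_def mm_def by (auto intro!: sum.neutral)

lemma msupp_diff: "A \<in> msupp Y Z \<Longrightarrow> B \<in> msupp Y Z \<Longrightarrow> A - B \<in> msupp Y Z"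
  unfolding msupp_def by auto

lemma msupp_row: "A \<in> msupp Y X \<Longrightarrow> y \<notin> Y \<Longrightarrow> A y x = 0"
  and msupp_col: "A \<in> msupp Y X \<Longrightarrow> x \<notin> X \<Longrightarrow> A y x = 0"
  unfolding msupp_def by auto

definition idm :: "'x set \<Rightarrow> 'x \<Rightarrow> 'x \<Rightarrow> 'a::comm_ring_1" where
  "idm X = (\<lambda>y x. if y = x \<and> x \<in> X then 1 else 0)"

lemma idm_msupp: "idm X \<in> msupp X X" by (auto simp: idm_def msupp_def)

lemma mm_idm_left: "finite X \<Longrightarrow> B \<in> msupp X W \<Longrightarrow> mm X (idm X) B = B"
proof (intro ext)
  fix y x assume "finite X" and B: "B \<in> msupp X W"
  have "mm X (idm X) B y x = (\<Sum>z\<in>X. if z = y then B y x else 0)"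
    unfolding mm_def idm_def by (intro sum.cong) auto
  also have "\<dots> = B y x" using \<open>finite X\<close> msupp_row[OF B, of y x] by auto
  finally show "mm X (idm X) B y x = B y x" .
qed

lemma mm_idm_right: "finite X \<Longrightarrow> B \<in> msupp W X \<Longrightarrow> mm X B (idm X) = B"
proof (intro ext)
  fix y x assume "finite X" and B: "B \<in> msupp W X"
  have "mm X B (idm X) y x = (\<Sum>z\<in>X. if z = x then B y x else 0)"
    unfolding mm_def idm_def by (intro sum.cong) auto
  also have "\<dots> = B y x" using \<open>finite X\<close> msupp_col[OF B, of x y] by auto
  finally show "mm X B (idm X) y x = B y x" .
qed

text \<open>\<open>X i\<close> indexes a basis of the module F_i, and \<open>D i\<close> is the
  matrix of the map from F_(i+1) to F_i, so that \<open>D 0\<close> presents \<open>I\<close>. The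
  bases are arbitrary finite sets because the given resolution is indexed by numbers and the Taylor
  resolution by sets.\<close>

locale free_res =
  fixes X :: "nat \<Rightarrow> 'x set" and D :: "nat \<Rightarrow> 'x \<Rightarrow> 'x \<Rightarrow> 'a::comm_ring_1" and I :: "'a set" and p :: 'x
  assumes fin: "\<And>i. finite (X i)" and X0: "X 0 = {p}"
    and Dsupp: "\<And>i. D i \<in> msupp (X i) (X (Suc i))"
    and DD: "\<And>i. mm (X (Suc i)) (D i) (D (Suc i)) = 0"
    and I0: "0 \<in> I" and DI: "\<And>x. D 0 p x \<in> I"
    and exact0: "\<And>f. f \<in> I \<Longrightarrow> \<exists>w\<in>fsupp (X 1). (\<Sum>x\<in>X 1. D 0 p x * w x) = f"
    and exact: "\<And>i v. v \<in> fsupp (X (Suc i)) \<Longrightarrow> (\<And>y. (\<Sum>x\<in>X (Suc i). D i y x * v x) = 0) \<Longrightarrow>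
      \<exists>w\<in>fsupp (X (Suc (Suc i))). \<forall>y. (\<Sum>x\<in>X (Suc (Suc i)). D (Suc i) y x * w x) = v y"
begin

text \<open>The vectors that lift through \<open>D i\<close>. In degree 0 the map to the quotient
  ring takes the place of a matrix, and being a cycle means having the entry in
  \<open>I\<close>.\<close>

definition cyc :: "nat \<Rightarrow> ('x \<Rightarrow> 'a) \<Rightarrow> bool" where
  "cyc i v \<longleftrightarrow> v \<in> fsupp (X i) \<and> (case i of 0 \<Rightarrow> v p \<in> I | Suc j \<Rightarrow> \<forall>y. (\<Sum>x\<in>X (Suc j). D j y x * v x) = 0)"

lemma lift_vec:
  assumes "cyc i v"
  shows "\<exists>w\<in>fsupp (X (Suc i)). \<forall>y. (\<Sum>x\<in>X (Suc i). D i y x * w x) = v y"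
proof (cases i)
  case 0
  then have v: "v \<in> fsupp {p}" "v p \<in> I" using assms X0 by (auto simp: cyc_def)
  obtain w where w: "w \<in> fsupp (X 1)" "(\<Sum>x\<in>X 1. D 0 p x * w x) = v p" using exact0[OF v(2)] by blast
  have "(\<Sum>x\<in>X (Suc 0). D 0 y x * w x) = v y" for y
  proof (cases "y = p")
    case False
    then have "D 0 y x = 0" for x using msupp_row[OF Dsupp[of 0], of y x] X0 by auto
    then show ?thesis using fsuppD[OF v(1), of y] False by simp
  qed (use w in simp)
  then show ?thesis using w(1) 0 by auto
next
  case (Suc j)
  then show ?thesis using assms exact[of v j] by (auto simp: cyc_def)
qed

lemma lift_mat:
  fixes B :: "'x \<Rightarrow> 'b \<Rightarrow> 'a"
  assumes B: "B \<in> msupp (X i) W" and c: "\<And>x. x \<in> W \<Longrightarrow> cyc i (\<lambda>z. B z x)"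
  shows "\<exists>C\<in>msupp (X (Suc i)) W. mm (X (Suc i)) (D i) C = B"
proof -
  have "\<forall>x\<in>W. \<exists>w. w \<in> fsupp (X (Suc i)) \<and> (\<forall>y. (\<Sum>z\<in>X (Suc i). D i y z * w z) = B y x)"
    using lift_vec[OF c] by blast
  from bchoice[OF this] obtain w where w: "\<forall>x\<in>W. w x \<in> fsupp (X (Suc i)) \<and> (\<forall>y. (\<Sum>z\<in>X (Suc i). D i y z * w x z) = B y x)" ..
  let ?C = "\<lambda>z x. if x \<in> W then w x z else 0"
  have "?C \<in> msupp (X (Suc i)) W" using w by (auto simp: msupp_def fsupp_def)
  moreover have "mm (X (Suc i)) (D i) ?C = B"
  proof (intro ext)
    fix y x
    show "mm (X (Suc i)) (D i) ?C y x = B y x"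
      using w msupp_col[OF B, of x y] by (cases "x \<in> W") (auto simp: mm_def)
  qed
  ultimately show ?thesis by blast
qed

text \<open>The recursion lifts \<open>t (Suc n)\<close> minus \<open>h n\<close> times
  \<open>D n\<close> to obtain \<open>h (Suc n)\<close>; the invariant carried along says that this
  difference is a cycle. It starts at zero, which is admissible because
  \<open>t 0 = 0\<close>.\<close>

lemma homotopy:
  assumes s: "\<And>i. t i \<in> msupp (X i) (X i)" and t0: "t 0 = 0"
    and comm: "\<And>i. mm (X (Suc i)) (D i) (t (Suc i)) = mm (X i) (t i) (D i)"
  shows "\<exists>h. (\<forall>i. h i \<in> msupp (X (Suc i)) (X i)) \<and>
    (\<forall>i. mm (X (Suc (Suc i))) (D (Suc i)) (h (Suc i)) = t (Suc i) - mm (X i) (h i) (D i))"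
proof -
  let ?P = "\<lambda>n h. h \<in> msupp (X (Suc n)) (X n) \<and> mm (X (Suc n)) (D n) (t (Suc n) - mm (X n) h (D n)) = 0"
  let ?Q = "\<lambda>n h h'. mm (X (Suc (Suc n))) (D (Suc n)) h' = t (Suc n) - mm (X n) h (D n)"
  have "\<exists>f. \<forall>n. ?P n (f n) \<and> ?Q n (f n) (f (Suc n))"
  proof (rule dependent_nat_choice)
    show "\<exists>h. ?P 0 h" by (rule exI[of _ 0]) (simp add: comm t0 msupp_def)
  next
    fix h n assume h: "?P n h"
    let ?B = "t (Suc n) - mm (X n) h (D n)"
    have Bs: "?B \<in> msupp (X (Suc n)) (X (Suc n))"
      by (rule msupp_diff[OF s msupp_mm[OF conjunct1[OF h] Dsupp]])
    have "cyc (Suc n) (\<lambda>z. ?B z x)" for x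
    proof -
      have "(\<lambda>z. ?B z x) \<in> fsupp (X (Suc n))" using msupp_row[OF Bs] unfolding fsupp_def by simp
      moreover have "(\<Sum>z\<in>X (Suc n). D n y z * ?B z x) = 0" for y
      proof -
        have "mm (X (Suc n)) (D n) ?B y x = 0" using conjunct2[OF h] by (simp only: zero_fun_apply)
        then show ?thesis by (simp only: mm_def)
      qed
      ultimately show ?thesis by (simp add: cyc_def)
    qed
    from lift_mat[OF Bs this] obtain h' where h': "h' \<in> msupp (X (Suc (Suc n))) (X (Suc n))" "?Q n h h'" by blast
    have "mm (X (Suc (Suc n))) (D (Suc n)) (t (Suc (Suc n)) - mm (X (Suc n)) h' (D (Suc n))) =
      mm (X (Suc n)) (t (Suc n)) (D (Suc n)) - mm (X (Suc n)) (t (Suc n) - mm (X n) h (D n)) (D (Suc n))"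
      unfolding mm_diff_right comm mm_assoc h'(2) ..
    also have "\<dots> = mm (X n) h (mm (X (Suc n)) (D n) (D (Suc n)))"
      unfolding mm_diff_left mm_assoc by simp
    also have "\<dots> = 0" unfolding DD by simp
    finally have "?P (Suc n) h'" using h'(1) by (intro conjI)
    then have "?P (Suc n) h' \<and> ?Q n h h'" using h'(2) by (rule conjI)
    then show "\<exists>h'. ?P (Suc n) h' \<and> ?Q n h h'" by (rule exI[of _ h'])
  qed
  then obtain f where "\<forall>n. ?P n (f n) \<and> ?Q n (f n) (f (Suc n))" ..
  then show ?thesis by (intro exI[of _ f]) simp
qed

end

text \<open>The comparison theorem: the identity in degree 0 is lifted degree by degree, by
  exactness of the target.\<close>

lemma chain_map:
  fixes D :: "nat \<Rightarrow> 'x \<Rightarrow> 'x \<Rightarrow> 'a::comm_ring_1" and E :: "nat \<Rightarrow> 'y \<Rightarrow> 'y \<Rightarrow> 'a"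
  assumes F: "free_res X D I p" and T: "free_res Y E I q"
  shows "\<exists>\<phi>. (\<forall>i. \<phi> i \<in> msupp (Y i) (X i)) \<and> \<phi> 0 q p = 1 \<and>
    (\<forall>i. mm (Y (Suc i)) (E i) (\<phi> (Suc i)) = mm (X i) (\<phi> i) (D i))"
proof -
  interpret F: free_res X D I p by (rule F)
  interpret T: free_res Y E I q by (rule T)
  let ?P = "\<lambda>n f. f \<in> msupp (Y n) (X n) \<and> (n = 0 \<longrightarrow> f q p = 1) \<and> (\<forall>x. T.cyc n (\<lambda>y. mm (X n) f (D n) y x))"
  let ?Q = "\<lambda>n f f'. mm (Y (Suc n)) (E n) f' = mm (X n) f (D n)"
  have fs: "(\<lambda>y. mm (X n) f (D n) y x) \<in> fsupp (Y n)" if "f \<in> msupp (Y n) (X n)" for f n x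
    using msupp_row[OF msupp_mm[OF that F.Dsupp[of n], of "X n"]] by (simp add: fsupp_def)
  have "\<exists>\<phi>. \<forall>n. ?P n (\<phi> n) \<and> ?Q n (\<phi> n) (\<phi> (Suc n))"
  proof (rule dependent_nat_choice)
    let ?f = "\<lambda>y x. if y = q \<and> x = p then 1 else 0 :: 'a"
    have s: "?f \<in> msupp (Y 0) (X 0)" by (auto simp: msupp_def F.X0 T.X0)
    have "mm (X 0) ?f (D 0) q x = D 0 p x" for x by (simp add: mm_def F.X0)
    then have "T.cyc 0 (\<lambda>y. mm (X 0) ?f (D 0) y x)" for x
      using fs[OF s] F.DI by (simp add: T.cyc_def)
    then have "?P 0 ?f" using s by simp
    then show "\<exists>f. ?P 0 f" by (rule exI[of _ ?f])
  next
    fix f n assume f: "?P n f"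
    have Bs: "mm (X n) f (D n) \<in> msupp (Y n) (X (Suc n))"
      using f by (intro msupp_mm[OF _ F.Dsupp]) (elim conjE)
    from T.lift_mat[OF Bs] f obtain f' where f': "f' \<in> msupp (Y (Suc n)) (X (Suc n))" "?Q n f f'" by blast
    have "mm (Y (Suc n)) (E n) (mm (X (Suc n)) f' (D (Suc n))) = mm (X n) f (mm (X (Suc n)) (D n) (D (Suc n)))"
      unfolding mm_assoc f'(2) ..
    then have z: "mm (Y (Suc n)) (E n) (mm (X (Suc n)) f' (D (Suc n))) = 0" unfolding F.DD by simp
    have "T.cyc (Suc n) (\<lambda>y. mm (X (Suc n)) f' (D (Suc n)) y x)" for x
    proof -
      have "(\<Sum>w\<in>Y (Suc n). E n y w * mm (X (Suc n)) f' (D (Suc n)) w x) = 0" for y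
      proof -
        have "mm (Y (Suc n)) (E n) (mm (X (Suc n)) f' (D (Suc n))) y x = 0" unfolding z by simp
        then show ?thesis by (simp only: mm_def)
      qed
      then show ?thesis using fs[OF f'(1)] by (simp add: T.cyc_def)
    qed
    then have "?P (Suc n) f'" using f'(1) by simp
    then have "?P (Suc n) f' \<and> ?Q n f f'" using f'(2) by (rule conjI)
    then show "\<exists>f'. ?P (Suc n) f' \<and> ?Q n f f'" by (rule exI[of _ f'])
  qed
  then obtain \<phi> where "\<forall>n. ?P n (\<phi> n) \<and> ?Q n (\<phi> n) (\<phi> (Suc n))" ..
  then show ?thesis by (intro exI[of _ \<phi>]) simp
qed

section \<open>Reduction to the residue field\<close>

locale ring_hom_field =
  fixes eps :: "'a::comm_ring_1 \<Rightarrow> 'k::field"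
  assumes eps_add: "eps (a + b) = eps a + eps b" and eps_mult: "eps (a * b) = eps a * eps b" and eps_1: "eps 1 = 1"
begin

lemma eps_0: "eps 0 = 0" by (metis add_left_cancel add.right_neutral eps_add)

lemma eps_diff: "eps (a - b) = eps a - eps b" using eps_add[of "a - b" b] by (simp add: algebra_simps)

lemma eps_sum: "eps (sum f S) = (\<Sum>x\<in>S. eps (f x))"
  by (induction S rule: infinite_finite_induct) (auto simp: eps_0 eps_add)

definition em :: "('y \<Rightarrow> 'x \<Rightarrow> 'a) \<Rightarrow> 'y \<Rightarrow> 'x \<Rightarrow> 'k" where
  "em A = (\<lambda>y x. eps (A y x))"

lemma em_mm: "em (mm Z A B) = mm Z (em A) (em B)"
  by (simp add: em_def mm_def eps_sum eps_mult)

lemma em_diff: "em (A - B) = em A - em B"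
  by (simp add: em_def fun_eq_iff eps_diff)

lemma em_0: "em 0 = 0"
  by (simp add: em_def fun_eq_iff eps_0)

lemma em_msupp: "A \<in> msupp Y X \<Longrightarrow> em A \<in> msupp Y X"
  by (auto simp: em_def msupp_def eps_0)

lemma em_idm: "em (idm X) = idm X"
  by (simp add: em_def idm_def fun_eq_iff eps_0 eps_1)

end

definition mv :: "'x set \<Rightarrow> ('y \<Rightarrow> 'x \<Rightarrow> 'a::comm_ring_1) \<Rightarrow> ('x \<Rightarrow> 'a) \<Rightarrow> 'y \<Rightarrow> 'a" where
  "mv X A v = (\<lambda>y. \<Sum>x\<in>X. A y x * v x)"

lemma mv_mm: "mv Z A (mv X B v) = mv X (mm Z A B) v"
proof
  fix y
  have "mv Z A (mv X B v) y = (\<Sum>z\<in>Z. \<Sum>x\<in>X. A y z * B z x * v x)"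
    by (simp add: mv_def sum_distrib_left mult.assoc)
  also have "\<dots> = (\<Sum>x\<in>X. \<Sum>z\<in>Z. A y z * B z x * v x)" by (rule sum.swap)
  also have "\<dots> = mv X (mm Z A B) v y" by (simp add: mv_def mm_def sum_distrib_right)
  finally show "mv Z A (mv X B v) y = mv X (mm Z A B) v y" .
qed

lemma mv_diff: "mv X (A - B) v = mv X A v - mv X B v"
  by (simp add: mv_def fun_eq_iff algebra_simps sum_subtractf)

lemma mv_0: "mv X 0 v = 0" and mv_vec_0: "mv X A 0 = 0"
  by (simp_all add: mv_def fun_eq_iff)

lemma mv_fsupp: "A \<in> msupp Y X \<Longrightarrow> mv Z A v \<in> fsupp Y"
  by (auto simp: mv_def fsupp_def msupp_def intro!: sum.neutral)

lemma mv_idm: "finite X \<Longrightarrow> v \<in> fsupp X \<Longrightarrow> mv X (idm X) v = v"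
proof
  fix y assume "finite X" and v: "v \<in> fsupp X"
  have "mv X (idm X) v y = (\<Sum>z\<in>X. if z = y then v y else 0)"
    unfolding mv_def idm_def by (intro sum.cong) auto
  also have "\<dots> = v y" using \<open>finite X\<close> fsuppD[OF v, of y] by auto
  finally show "mv X (idm X) v y = v y" .
qed

lemma linear_mv: "Vector_Spaces.linear fscale fscale (mv X (A :: 'y \<Rightarrow> 'x \<Rightarrow> 'k::field))"
  by (rule linear_fscaleI) (auto simp: mv_def algebra_simps sum.distrib sum_distrib_left)

lemma mv_uminus: "mv X A (- v) = - mv X A v"
  by (simp add: mv_def fun_eq_iff sum_negf)

text \<open>Cycles of the reduced complex; in degree 0 no map leaves the module, hence no
  condition.\<close>

definition hcyc :: "(nat \<Rightarrow> 'y set) \<Rightarrow> (nat \<Rightarrow> 'y \<Rightarrow> 'y \<Rightarrow> 'k::field) \<Rightarrow> nat \<Rightarrow> ('y \<Rightarrow> 'k) set" where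
  "hcyc Y E i = {v \<in> fsupp (Y i). case i of 0 \<Rightarrow> True | Suc j \<Rightarrow> mv (Y i) (E j) v = 0}"

text \<open>A resolution that becomes zero modulo \<open>eps\<close> computes the homology, modulo \<open>eps\<close>, of any other one.\<close>

theorem (in ring_hom_field) minimal_resolution_rank:
  fixes X :: "nat \<Rightarrow> 'x set" and Y :: "nat \<Rightarrow> 'y set"
  assumes F: "free_res X D I p" and T: "free_res Y E I q" and min: "\<And>i. em (D i) = 0"
  shows "fv.dim (hcyc Y (\<lambda>i. em (E i)) i) =
    fv.dim (mv (Y (Suc i)) (em (E i)) ` fsupp (Y (Suc i))) + card (X i)"
proof -
  interpret F: free_res X D I p by (rule F)
  interpret T: free_res Y E I q by (rule T)
  obtain f where f: "\<And>i. f i \<in> msupp (Y i) (X i)" "f 0 q p = 1"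
    "\<And>i. mm (Y (Suc i)) (E i) (f (Suc i)) = mm (X i) (f i) (D i)"
    using chain_map[OF F T] by blast
  obtain g where g: "\<And>i. g i \<in> msupp (X i) (Y i)" "g 0 p q = 1"
    "\<And>i. mm (X (Suc i)) (D i) (g (Suc i)) = mm (Y i) (g i) (E i)"
    using chain_map[OF T F] by blast
  let ?t = "\<lambda>i. mm (X i) (f i) (g i) - idm (Y i)"
  let ?s = "\<lambda>i. mm (Y i) (g i) (f i) - idm (X i)"
  have t0: "?t 0 = 0"
  proof (intro ext)
    fix y x show "?t 0 y x = 0 y x"
      using f(2) g(2) msupp_row[OF f(1)[of 0], of y] msupp_col[OF g(1)[of 0], of x]
      by (cases "y = q"; cases "x = q") (auto simp: mm_def F.X0 T.X0 idm_def)
  qed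
  have s0: "?s 0 = 0"
  proof (intro ext)
    fix y x show "?s 0 y x = 0 y x"
      using f(2) g(2) msupp_row[OF g(1)[of 0], of y] msupp_col[OF f(1)[of 0], of x]
      by (cases "y = p"; cases "x = p") (auto simp: mm_def F.X0 T.X0 idm_def)
  qed
  have tm: "?t i \<in> msupp (Y i) (Y i)" for i by (rule msupp_diff[OF msupp_mm[OF f(1) g(1)] idm_msupp])
  have sm: "?s i \<in> msupp (X i) (X i)" for i by (rule msupp_diff[OF msupp_mm[OF g(1) f(1)] idm_msupp])
  have tc: "mm (Y (Suc i)) (E i) (?t (Suc i)) = mm (Y i) (?t i) (E i)" for i
  proof -
    have "mm (Y (Suc i)) (E i) (mm (X (Suc i)) (f (Suc i)) (g (Suc i))) = mm (X i) (f i) (mm (X (Suc i)) (D i) (g (Suc i)))"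
      unfolding mm_assoc f(3) ..
    also have "\<dots> = mm (Y i) (mm (X i) (f i) (g i)) (E i)" unfolding g(3) mm_assoc ..
    finally show ?thesis
      unfolding mm_diff_right mm_diff_left mm_idm_left[OF T.fin T.Dsupp] mm_idm_right[OF T.fin T.Dsupp] by simp
  qed
  have sc: "mm (X (Suc i)) (D i) (?s (Suc i)) = mm (X i) (?s i) (D i)" for i
  proof -
    have "mm (X (Suc i)) (D i) (mm (Y (Suc i)) (g (Suc i)) (f (Suc i))) = mm (Y i) (g i) (mm (Y (Suc i)) (E i) (f (Suc i)))"
      unfolding mm_assoc g(3) ..
    also have "\<dots> = mm (X i) (mm (Y i) (g i) (f i)) (D i)" unfolding f(3) mm_assoc ..
    finally show ?thesis
      unfolding mm_diff_right mm_diff_left mm_idm_left[OF F.fin F.Dsupp] mm_idm_right[OF F.fin F.Dsupp] by simp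
  qed
  obtain h where h: "\<And>i. mm (Y (Suc (Suc i))) (E (Suc i)) (h (Suc i)) = ?t (Suc i) - mm (Y i) (h i) (E i)"
      and hs: "\<And>i. h i \<in> msupp (Y (Suc i)) (Y i)"
    using T.homotopy[of ?t, OF tm t0 tc] by blast
  obtain k where k: "\<And>i. mm (X (Suc (Suc i))) (D (Suc i)) (k (Suc i)) = ?s (Suc i) - mm (X i) (k i) (D i)"
    using F.homotopy[of ?s, OF sm s0 sc] by blast
  \<comment> \<open>Both terms of the homotopy between \<open>g f\<close> and the identity contain
    some \<open>D\<close>, which reduces to zero. After reduction \<open>g f\<close> is the
    identity.\<close>
  have gf: "mm (Y i) (em (g i)) (em (f i)) = idm (X i)" for i
  proof -
    have "em (?s i) = 0"
    proof (cases i)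
      case 0 then show ?thesis using s0 by (simp add: em_0)
    next
      case (Suc j)
      have "em (mm (X (Suc (Suc j))) (D (Suc j)) (k (Suc j))) = em (?s (Suc j) - mm (X j) (k j) (D j))" unfolding k ..
      then show ?thesis unfolding em_diff[of "?s (Suc j)"] em_mm[of "X (Suc (Suc j))"] em_mm[of "X j"] min using Suc by simp
    qed
    then show ?thesis unfolding em_diff em_mm em_idm by simp
  qed
  have Ef: "mm (Y (Suc i)) (em (E i)) (em (f (Suc i))) = 0" for i
    unfolding em_mm[symmetric] f(3) unfolding em_mm min by simp
  have gE: "mm (Y i) (em (g i)) (em (E i)) = 0" for i
    unfolding em_mm[symmetric] g(3)[symmetric] unfolding em_mm min by simp
  have EE: "mm (Y (Suc i)) (em (E i)) (em (E (Suc i))) = 0" for i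
    unfolding em_mm[symmetric] T.DD em_0 ..
  let ?Z = "hcyc Y (\<lambda>i. em (E i)) i"
  let ?B = "mv (Y (Suc i)) (em (E i)) ` fsupp (Y (Suc i))"
  let ?G = "mv (Y i) (em (g i))"
  have Zs: "?Z \<subseteq> fsupp (Y i)" by (auto simp: hcyc_def)
  have subZ: "fv.subspace ?Z"
  proof (cases i)
    case 0 then show ?thesis using subspace_fsupp[of "Y i"] by (simp add: hcyc_def)
  next
    case (Suc j)
    interpret l: Vector_Spaces.linear fscale fscale "mv (Y i) (em (E j))" by (rule linear_mv)
    show ?thesis unfolding fv.subspace_def hcyc_def Suc
      using subspace_fsupp[of "Y (Suc j)", where 'k='k] l.add l.scale l.zero unfolding Suc
      by (auto simp: fv.subspace_def)
  qed
  \<comment> \<open>On a cycle killed by \<open>g\<close>, the difference of \<open>f g\<close> and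
    the identity acts as -1, while the homotopy exhibits its value as a boundary.\<close>
  have ker: "{v \<in> ?Z. ?G v = 0} = ?B"
  proof (intro equalityI subsetI)
    fix v assume v: "v \<in> {v \<in> ?Z. ?G v = 0}"
    then have vs: "v \<in> fsupp (Y i)" and G0: "?G v = 0" using Zs by auto
    have tv: "mv (Y i) (em (?t i)) v = - v"
      unfolding em_diff em_mm em_idm mv_diff mv_mm[symmetric] G0 mv_vec_0 mv_idm[OF T.fin vs] by simp
    show "v \<in> ?B"
    proof (cases i)
      case 0
      then have "v = 0" using tv t0 by (simp add: em_0 mv_0)
      then show ?thesis by (intro image_eqI[of _ _ 0]) (auto simp: mv_vec_0 fsupp_def)
    next
      case (Suc j)
      have E0: "mv (Y (Suc j)) (em (E j)) v = 0" using v Suc by (simp add: hcyc_def)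
      have "em (?t (Suc j)) = em (mm (Y (Suc (Suc j))) (E (Suc j)) (h (Suc j))) + em (mm (Y j) (h j) (E j))"
        unfolding h em_diff[of "?t (Suc j)"] by simp
      then have "- v = mv (Y (Suc j)) (em (mm (Y (Suc (Suc j))) (E (Suc j)) (h (Suc j))) + em (mm (Y j) (h j) (E j))) v"
        using tv Suc by simp
      also have "\<dots> = mv (Y (Suc j)) (em (mm (Y (Suc (Suc j))) (E (Suc j)) (h (Suc j)))) v + mv (Y (Suc j)) (em (mm (Y j) (h j) (E j))) v"
        by (simp add: mv_def fun_eq_iff algebra_simps sum.distrib)
      also have "\<dots> = mv (Y (Suc (Suc j))) (em (E (Suc j))) (mv (Y (Suc j)) (em (h (Suc j))) v)"
        unfolding em_mm mv_mm[symmetric] E0 mv_vec_0 by simp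
      finally have "v = mv (Y (Suc (Suc j))) (em (E (Suc j))) (- mv (Y (Suc j)) (em (h (Suc j))) v)"
        unfolding mv_uminus by (metis minus_minus)
      moreover have "- mv (Y (Suc j)) (em (h (Suc j))) v \<in> fsupp (Y (Suc (Suc j)))"
        using mv_fsupp[OF em_msupp[OF hs[of "Suc j"]], of "Y (Suc j)" v] by (simp add: fsupp_def)
      ultimately show ?thesis unfolding Suc by (rule image_eqI)
    qed
  next
    fix v assume "v \<in> ?B"
    then obtain w where w: "w \<in> fsupp (Y (Suc i))" "v = mv (Y (Suc i)) (em (E i)) w" by (rule imageE)
    have "v \<in> fsupp (Y i)" unfolding w(2) by (rule mv_fsupp[OF em_msupp[OF T.Dsupp]])
    moreover have "?G v = 0" unfolding w(2) mv_mm gE mv_0 ..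
    moreover have "mv (Y i) (em (E j)) v = 0" if "i = Suc j" for j
      unfolding w(2) unfolding that mv_mm EE mv_0 ..
    ultimately show "v \<in> {v \<in> ?Z. ?G v = 0}" by (auto simp: hcyc_def split: nat.split)
  qed
  \<comment> \<open>Surjectivity: \<open>f\<close> sends every reduced vector to a cycle, since
    \<open>E f = f D\<close> reduces to zero, and \<open>g\<close> brings it back.\<close>
  have im: "?G ` ?Z = fsupp (X i)"
  proof (intro equalityI subsetI)
    fix u assume "u \<in> ?G ` ?Z"
    then obtain v where "u = ?G v" by (rule imageE)
    then show "u \<in> fsupp (X i)" by (simp add: mv_fsupp[OF em_msupp[OF g(1)]])
  next
    fix u :: "'x \<Rightarrow> 'k" assume u: "u \<in> fsupp (X i)"
    let ?v = "mv (X i) (em (f i)) u"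
    have "?v \<in> fsupp (Y i)" by (rule mv_fsupp[OF em_msupp[OF f(1)]])
    moreover have "mv (Y i) (em (E j)) ?v = 0" if "i = Suc j" for j unfolding that mv_mm Ef mv_0 ..
    ultimately have "?v \<in> ?Z" by (auto simp: hcyc_def split: nat.split)
    moreover have "?G ?v = u" unfolding mv_mm gf by (rule mv_idm[OF F.fin u])
    ultimately show "u \<in> ?G ` ?Z" by (intro image_eqI[of u ?G ?v]) simp_all
  qed
  show ?thesis
    using fv_rank_nullity[of ?G, OF linear_mv subZ T.fin Zs] unfolding ker im dim_fsupp[OF F.fin] .
qed

section \<open>The Taylor resolution\<close>

text \<open>The sets of generators whose least common multiple has polarization \<open>m\<close>,
  that is, the strand of multidegree \<open>m\<close> of the Taylor resolution after
  reduction.\<close>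

definition union_complex :: "nat set \<Rightarrow> (nat \<Rightarrow> 'u set) \<Rightarrow> 'u set \<Rightarrow> nat set set" where
  "union_complex A s m = {\<sigma>. \<sigma> \<subseteq> A \<and> \<Union>(s ` \<sigma>) = m}"

lemma union_complex_Pow: "union_complex A s m \<subseteq> Pow A"
  by (auto simp: union_complex_def)

lemma interval_closed_union_complex:
  assumes "finite A"
  shows "interval_closed (union_complex A s m)"
  unfolding interval_closed_def
proof (intro conjI ballI allI impI)
  show "finite (union_complex A s m)" using finite_subset[OF union_complex_Pow] assms by simp
  show "finite \<sigma>" if "\<sigma> \<in> union_complex A s m" for \<sigma>
    using that assms finite_subset[of \<sigma> A] by (simp add: union_complex_def)
  show "\<rho> \<in> union_complex A s m"
    if h: "\<tau> \<in> union_complex A s m" "\<sigma> \<in> union_complex A s m" "\<tau> \<subseteq> \<rho>" "\<rho> \<subseteq> \<sigma>" for \<tau> \<sigma> \<rho>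
  proof -
    have "\<rho> \<subseteq> A" using h by (auto simp: union_complex_def)
    moreover have "\<Union>(s ` \<tau>) \<subseteq> \<Union>(s ` \<rho>)" "\<Union>(s ` \<rho>) \<subseteq> \<Union>(s ` \<sigma>)" using h(3,4) by blast+
    ultimately show ?thesis using h(1,2) by (simp add: union_complex_def)
  qed
qed

lemma interval_closed_Pow: "finite A \<Longrightarrow> interval_closed (Pow A)"
  unfolding interval_closed_def using finite_subset by auto

text \<open>A subspace stable under the block projections is the direct sum of its blocks; the
  induction splits off one block by rank and nullity.\<close>

lemma dim_blocks:
  fixes B :: "'m \<Rightarrow> 'x set"
  assumes "finite M" "\<And>m. m \<in> M \<Longrightarrow> finite (B m)"
    and "\<And>m m'. m \<in> M \<Longrightarrow> m' \<in> M \<Longrightarrow> m \<noteq> m' \<Longrightarrow> B m \<inter> B m' = {}"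
    and "fv.subspace (V :: ('x \<Rightarrow> 'k::field) set)" "V \<subseteq> fsupp (\<Union>m\<in>M. B m)"
    and "\<And>m v. m \<in> M \<Longrightarrow> v \<in> V \<Longrightarrow> proj (B m) v \<in> V"
  shows "fv.dim V = (\<Sum>m\<in>M. fv.dim (proj (B m) ` V))"
  using assms
proof (induction M arbitrary: V rule: finite_induct)
  case empty
  have "v = 0" if "v \<in> V" for v
  proof
    fix x show "v x = 0 x" using subsetD[OF empty.prems(4) that] by (simp add: fsupp_def)
  qed
  then have "V \<subseteq> {0}" by blast
  then have "V = {0}" using empty.prems(3) fv.subspace_0 by blast
  then show ?case using fv_dim_zero by simp
next
  case (insert m M)
  let ?V = "{v\<in>V. proj (B m) v = 0}"
  have fin: "finite (\<Union>m\<in>insert m M. B m)" using insert.hyps insert.prems(1) by simp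
  have disj: "B m \<inter> B m' = {}" if "m' \<in> M" for m'
  proof -
    have "m \<noteq> m'" using that insert.hyps by auto
    then show ?thesis using insert.prems(2)[of m m'] that by simp
  qed
  interpret l: Vector_Spaces.linear fscale fscale "proj (B m) :: ('x \<Rightarrow> 'k) \<Rightarrow> _" by (rule linear_proj)
  have sub: "fv.subspace ?V"
    using insert.prems(3) unfolding fv.subspace_def by (auto simp: l.add l.scale l.zero)
  have supp: "?V \<subseteq> fsupp (\<Union>m\<in>M. B m)"
  proof
    fix v assume v: "v \<in> ?V"
    have "v x = 0" if x: "x \<notin> (\<Union>m\<in>M. B m)" for x
    proof (cases "x \<in> B m")
      case True
      have "proj (B m) v x = 0" using v by simp
      then show ?thesis using True by (simp add: proj_def)
    next
      case False
      then have "x \<notin> (\<Union>m\<in>insert m M. B m)" using x by simp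
      moreover have "v \<in> fsupp (\<Union>m\<in>insert m M. B m)" using v insert.prems(4) by auto
      ultimately show ?thesis by (rule fsuppD[rotated])
    qed
    then show "v \<in> fsupp (\<Union>m\<in>M. B m)" by (simp add: fsupp_def)
  qed
  have comm0: "proj (B m) (proj (B m') v) = 0" if "m' \<in> M" for m' and v :: "'x \<Rightarrow> 'k"
    using disj[OF that] by (auto simp: proj_def fun_eq_iff)
  have closed: "proj (B m') v \<in> ?V" if "m' \<in> M" "v \<in> V" for m' v
    using insert.prems(5)[of m' v] that comm0[OF that(1), of v] by simp
  have im: "proj (B m') ` ?V = proj (B m') ` V" if m': "m' \<in> M" for m'
  proof (intro equalityI subsetI)
    fix w assume "w \<in> proj (B m') ` V"
    then obtain v where v: "v \<in> V" "w = proj (B m') v" by (rule imageE)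
    have "w = proj (B m') (proj (B m') v)" unfolding v(2) by (simp add: proj_def fun_eq_iff)
    then show "w \<in> proj (B m') ` ?V" using closed[OF m' v(1)] by (intro image_eqI[of w _ "proj (B m') v"])
  qed auto
  have IH: "fv.dim ?V = (\<Sum>m'\<in>M. fv.dim (proj (B m') ` ?V))"
    by (rule insert.IH[OF _ _ sub supp]) (use insert.prems(1,2) closed in auto)
  have "fv.dim V = fv.dim ?V + fv.dim (proj (B m) ` V)"
    by (rule fv_rank_nullity[OF linear_proj insert.prems(3) fin insert.prems(4)])
  also have "fv.dim ?V = (\<Sum>m'\<in>M. fv.dim (proj (B m') ` V))" unfolding IH by (rule sum.cong) (simp_all add: im)
  finally show ?case using insert.hyps by simp
qed

lemma eps_hom: "ring_hom_field (\<lambda>f :: ('v, 'k::field) mpoly. lkp f 0)"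
proof
  show "lkp (a + b) 0 = lkp a 0 + lkp b 0" for a b :: "('v, 'k) mpoly" by (rule lookup_add)
  show "lkp (1 :: ('v, 'k) mpoly) 0 = 1" by simp
  fix a b :: "('v, 'k) mpoly"
  have z: "0 = l + q \<longleftrightarrow> l = 0 \<and> q = 0" for l q :: "'v \<Rightarrow>\<^sub>0 nat"
  proof
    assume e: "0 = l + q"
    have "lkp l v + lkp q v = 0" for v using e by (metis lookup_add lookup_zero)
    then show "l = 0 \<and> q = 0" by (auto intro!: poly_mapping_eqI)
  qed simp
  have "lkp (a * b) 0 = (\<Sum>l\<in>Poly_Mapping.keys a. \<Sum>q\<in>Poly_Mapping.keys b. if q = 0 then (if l = 0 then lkp a 0 * lkp b 0 else 0) else 0)"
    unfolding lookup_times_sum z by (intro sum.cong refl) auto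
  also have "\<dots> = lkp a 0 * lkp b 0" by (cases "lkp b 0 = 0") (simp_all add: in_keys_iff)
  finally show "lkp (a * b) 0 = lkp a 0 * lkp b 0" .
qed

lemma minus_one_power_single: "(-1 :: ('v, 'k::field) mpoly) ^ n = Poly_Mapping.single 0 ((-1) ^ n)"
  by (cases "even n") (simp_all add: single_uminus)

lemma inc_single: "(inc \<tau> \<sigma> :: ('v, 'k::field) mpoly) = Poly_Mapping.single 0 (inc \<tau> \<sigma>)"
  by (simp add: inc_def minus_one_power_single)

text \<open>Numbers as indices of the generators provide the orientation of sets of generators. The
  type argument fixes the coefficient field, which does not occur in \<open>A\<close> or
  \<open>al\<close>.\<close>

locale taylor =
  fixes A :: "nat set" and al :: "nat \<Rightarrow> ('v::finite \<Rightarrow>\<^sub>0 nat)" and ty :: "'k::field itself"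
  assumes finA: "finite A"
begin

text \<open>Exponent of the least common multiple; the inserted 0 gives the monomial 1 to the empty
  set.\<close>

definition lc :: "nat set \<Rightarrow> ('v \<Rightarrow>\<^sub>0 nat)" where
  "lc \<sigma> = Abs_poly_mapping (\<lambda>v. Max (insert 0 ((\<lambda>g. lkp (al g) v) ` \<sigma>)))"

lemma lookup_lc: "lkp (lc \<sigma>) v = Max (insert 0 ((\<lambda>g. lkp (al g) v) ` \<sigma>))"
  unfolding lc_def by (subst lookup_Abs_poly_mapping) auto

lemma lc_le_iff: "finite \<sigma> \<Longrightarrow> lkp (lc \<sigma>) v \<le> n \<longleftrightarrow> (\<forall>g\<in>\<sigma>. lkp (al g) v \<le> n)"
  unfolding lookup_lc by simp

lemma ple_lc: "finite \<sigma> \<Longrightarrow> ple (lc \<sigma>) \<gamma> \<longleftrightarrow> (\<forall>g\<in>\<sigma>. ple (al g) \<gamma>)"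
  unfolding ple_def by (auto simp: lc_le_iff)

lemma lc_mono: "finite \<sigma> \<Longrightarrow> \<tau> \<subseteq> \<sigma> \<Longrightarrow> ple (lc \<tau>) (lc \<sigma>)"
  using finite_subset[of \<tau> \<sigma>] lc_le_iff[of \<tau>] lc_le_iff[of \<sigma>] unfolding ple_def by blast

text \<open>Polarization: a variable of exponent n is replaced by n vertices, so that least common
  multiples become unions.\<close>

definition pol :: "nat \<Rightarrow> ('v \<times> nat) set" where
  "pol g = {(v, j). j < lkp (al g) v}"

lemma Union_pol: "finite \<sigma> \<Longrightarrow> \<Union>(pol ` \<sigma>) = {(v, j). j < lkp (lc \<sigma>) v}"
proof -
  assume f: "finite \<sigma>"
  have "(\<exists>g\<in>\<sigma>. j < lkp (al g) v) \<longleftrightarrow> j < lkp (lc \<sigma>) v" for v j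
    using lc_le_iff[OF f, of v j] by (auto simp: not_le[symmetric])
  then show ?thesis by (auto simp: pol_def)
qed

lemma lc_eq_iff:
  assumes "finite \<sigma>" "finite \<tau>"
  shows "lc \<sigma> = lc \<tau> \<longleftrightarrow> \<Union>(pol ` \<sigma>) = \<Union>(pol ` \<tau>)"
proof
  assume e: "\<Union>(pol ` \<sigma>) = \<Union>(pol ` \<tau>)"
  show "lc \<sigma> = lc \<tau>"
  proof (rule poly_mapping_eqI)
    fix v
    have "j < lkp (lc \<sigma>) v \<longleftrightarrow> j < lkp (lc \<tau>) v" for j
      using e unfolding Union_pol[OF assms(1)] Union_pol[OF assms(2)] by (auto simp: set_eq_iff)
    then show "lkp (lc \<sigma>) v = lkp (lc \<tau>) v" by (metis less_irrefl linorder_neqE_nat)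
  qed
qed (simp add: Union_pol assms)

definition Y :: "nat \<Rightarrow> nat set set" where "Y i = level (Pow A) i"

definition E :: "nat \<Rightarrow> nat set \<Rightarrow> nat set \<Rightarrow> ('v, 'k) mpoly" where
  "E i \<tau> \<sigma> = (if \<tau> \<in> Y i \<and> \<sigma> \<in> Y (Suc i) then inc \<tau> \<sigma> * mon (lc \<sigma> - lc \<tau>) else 0)"

lemma finY: "finite (Y i)" unfolding Y_def using finite_subset[OF level_subset] finA by auto

lemma Y_mem: "\<sigma> \<in> Y i \<longleftrightarrow> \<sigma> \<subseteq> A \<and> card \<sigma> = i" by (auto simp: Y_def level_def)

lemma fin_sub: "\<sigma> \<subseteq> A \<Longrightarrow> finite \<sigma>" using finA finite_subset by auto

lemma E_supp: "E i \<in> msupp (Y i) (Y (Suc i))" by (auto simp: E_def msupp_def)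

lemma inc_card: "inc \<tau> \<sigma> \<noteq> (0 :: 'b::comm_ring_1) \<Longrightarrow> finite \<tau> \<Longrightarrow> card \<sigma> = Suc (card \<tau>)"
  by (erule inc_nonzeroE) simp

lemma mon_lc_mult:
  assumes "\<tau> \<subseteq> \<rho>" "\<rho> \<subseteq> \<sigma>" "finite \<sigma>"
  shows "mon (lc \<rho> - lc \<tau>) * mon (lc \<sigma> - lc \<rho>) = (mon (lc \<sigma> - lc \<tau>) :: ('v, 'k) mpoly)"
proof -
  have "ple (lc \<tau>) (lc \<rho>)" "ple (lc \<rho>) (lc \<sigma>)" using lc_mono assms finite_subset[of \<rho> \<sigma>] by auto
  then have "lc \<rho> - lc \<tau> + (lc \<sigma> - lc \<rho>) = lc \<sigma> - lc \<tau>"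
    by (intro poly_mapping_eqI) (simp add: lookup_add lookup_minus ple_def)
  then show ?thesis by (simp add: mon_def mult_single)
qed

text \<open>The monomial quotients compose along an intermediate set, so one monomial factors out of
  the vanishing sum of products of signs.\<close>

lemma EE: "mm (Y (Suc i)) (E i) (E (Suc i)) = 0"
proof (intro ext)
  fix \<tau> \<sigma>
  show "mm (Y (Suc i)) (E i) (E (Suc i)) \<tau> \<sigma> = 0 \<tau> \<sigma>"
  proof (cases "\<tau> \<in> Y i \<and> \<sigma> \<in> Y (Suc (Suc i))")
    case False
    then show ?thesis unfolding mm_def by (auto simp: E_def intro!: sum.neutral)
  next
    case True
    then have t: "\<tau> \<subseteq> A" "card \<tau> = i" and s: "\<sigma> \<subseteq> A" by (auto simp: Y_mem)
    have "mm (Y (Suc i)) (E i) (E (Suc i)) \<tau> \<sigma> = (\<Sum>\<rho>\<in>Y (Suc i). inc \<tau> \<rho> * inc \<rho> \<sigma> * mon (lc \<sigma> - lc \<tau>))"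
      unfolding mm_def
    proof (rule sum.cong)
      fix \<rho> assume r: "\<rho> \<in> Y (Suc i)"
      have "E i \<tau> \<rho> * E (Suc i) \<rho> \<sigma> = inc \<tau> \<rho> * inc \<rho> \<sigma> * (mon (lc \<rho> - lc \<tau>) * mon (lc \<sigma> - lc \<rho>))"
        using True r by (simp add: E_def mult_ac)
      also have "\<dots> = inc \<tau> \<rho> * inc \<rho> \<sigma> * mon (lc \<sigma> - lc \<tau>)"
      proof (cases "inc \<tau> \<rho> = (0 :: ('v, 'k) mpoly) \<or> inc \<rho> \<sigma> = (0 :: ('v, 'k) mpoly)")
        case False
        then have "\<tau> \<subseteq> \<rho>" "\<rho> \<subseteq> \<sigma>" by (metis inc_nonzeroE subset_insertI)+
        then show ?thesis by (simp only: mon_lc_mult[OF _ _ fin_sub[OF s]])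
      qed auto
      finally show "E i \<tau> \<rho> * E (Suc i) \<rho> \<sigma> = inc \<tau> \<rho> * inc \<rho> \<sigma> * mon (lc \<sigma> - lc \<tau>)" .
    qed simp
    also have "\<dots> = (\<Sum>\<rho>\<in>Pow A. inc \<tau> \<rho> * inc \<rho> \<sigma> * mon (lc \<sigma> - lc \<tau>))"
    proof (rule sum.mono_neutral_left)
      show "\<forall>\<rho>\<in>Pow A - Y (Suc i). inc \<tau> \<rho> * inc \<rho> \<sigma> * mon (lc \<sigma> - lc \<tau>) = (0 :: ('v, 'k) mpoly)"
      proof
        fix \<rho> assume r: "\<rho> \<in> Pow A - Y (Suc i)"
        then have "card \<rho> \<noteq> Suc (card \<tau>)" using t by (auto simp: Y_mem)
        then have "inc \<tau> \<rho> = (0 :: ('v, 'k) mpoly)" using inc_card[of \<tau> \<rho>, where 'b="('v, 'k) mpoly"] fin_sub[OF t(1)] by blast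
        then show "inc \<tau> \<rho> * inc \<rho> \<sigma> * mon (lc \<sigma> - lc \<tau>) = (0 :: ('v, 'k) mpoly)" by simp
      qed
    qed (use finA in \<open>auto simp: Y_mem\<close>)
    also have "\<dots> = 0"
      unfolding sum_distrib_right[symmetric] using inc_inc_sum[OF interval_closed_Pow[OF finA], of \<tau> \<sigma>, where 'a="('v, 'k) mpoly"] t s by simp
    finally show ?thesis by simp
  qed
qed

section \<open>Exactness of the Taylor resolution in each multidegree\<close>

definition below :: "('v \<Rightarrow>\<^sub>0 nat) \<Rightarrow> nat set" where
  "below \<gamma> = {g\<in>A. ple (al g) \<gamma>}"

lemma below_iff: "\<sigma> \<subseteq> below \<gamma> \<longleftrightarrow> \<sigma> \<subseteq> A \<and> ple (lc \<sigma>) \<gamma>"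
proof (cases "\<sigma> \<subseteq> A")
  case True
  then show ?thesis using ple_lc[OF fin_sub[OF True], of \<gamma>] unfolding below_def by blast
qed (auto simp: below_def)

lemma fin_below: "finite (below \<gamma>)" using finA by (simp add: below_def)

text \<open>The component of \<open>w\<close> in multidegree \<open>\<gamma>\<close> as a simplicial
  chain: the basis element at \<open>\<sigma>\<close> has degree \<open>lc \<sigma>\<close>, so only
  \<open>\<gamma> - lc \<sigma>\<close> remains for the coefficient.\<close>

definition co :: "(nat set \<Rightarrow> ('v, 'k) mpoly) \<Rightarrow> ('v \<Rightarrow>\<^sub>0 nat) \<Rightarrow> nat set \<Rightarrow> 'k" where
  "co w \<gamma> \<sigma> = (if \<sigma> \<subseteq> below \<gamma> then lkp (w \<sigma>) (\<gamma> - lc \<sigma>) else 0)"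

text \<open>In a fixed multidegree the monomial factors disappear, and the Taylor strand at
  \<open>\<gamma>\<close> is the full simplex on the generators dividing
  \<open>\<gamma>\<close>.\<close>

lemma lookup_d:
  assumes w: "w \<in> fsupp (Y (Suc i))" and t: "\<tau> \<in> Y i" "\<tau> \<subseteq> below \<gamma>"
  shows "lkp (\<Sum>\<sigma>\<in>Y (Suc i). E i \<tau> \<sigma> * w \<sigma>) (\<gamma> - lc \<tau>) = bd (Pow (below \<gamma>)) (co w \<gamma>) \<tau>"
proof -
  have pt: "ple (lc \<tau>) \<gamma>" using t(2) below_iff by simp
  have tm: "lkp (E i \<tau> \<sigma> * w \<sigma>) (\<gamma> - lc \<tau>) = inc \<tau> \<sigma> * co w \<gamma> \<sigma>" if s: "\<sigma> \<in> Y (Suc i)" for \<sigma>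
  proof (cases "inc \<tau> \<sigma> = (0::'k)")
    case True
    then show ?thesis by (simp add: E_def inc_single)
  next
    case False
    then have ts: "\<tau> \<subseteq> \<sigma>" by (metis inc_nonzeroE subset_insertI)
    have sA: "\<sigma> \<subseteq> A" using s by (simp add: Y_mem)
    have le: "ple (lc \<tau>) (lc \<sigma>)" by (rule lc_mono[OF fin_sub[OF sA] ts])
    have p1: "ple (lc \<sigma> - lc \<tau>) (\<gamma> - lc \<tau>) \<longleftrightarrow> \<sigma> \<subseteq> below \<gamma>"
    proof -
      have "lkp (lc \<sigma>) v - lkp (lc \<tau>) v \<le> lkp \<gamma> v - lkp (lc \<tau>) v \<longleftrightarrow> lkp (lc \<sigma>) v \<le> lkp \<gamma> v" for v
      proof -
        have "lkp (lc \<tau>) v \<le> lkp \<gamma> v" "lkp (lc \<tau>) v \<le> lkp (lc \<sigma>) v" using pt le by (auto simp: ple_def)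
        then show ?thesis by linarith
      qed
      then have "ple (lc \<sigma> - lc \<tau>) (\<gamma> - lc \<tau>) \<longleftrightarrow> ple (lc \<sigma>) \<gamma>" by (simp add: ple_def lookup_minus)
      then show ?thesis using below_iff sA by simp
    qed
    have p2: "\<gamma> - lc \<tau> - (lc \<sigma> - lc \<tau>) = \<gamma> - lc \<sigma>"
      using le by (intro poly_mapping_eqI) (simp add: lookup_minus ple_def)
    have "E i \<tau> \<sigma> = Poly_Mapping.single (lc \<sigma> - lc \<tau>) (inc \<tau> \<sigma>)"
      using s t by (simp add: E_def inc_single mon_def mult_single)
    then show ?thesis by (simp add: lookup_single_times p1 p2 co_def)
  qed
  have "lkp (\<Sum>\<sigma>\<in>Y (Suc i). E i \<tau> \<sigma> * w \<sigma>) (\<gamma> - lc \<tau>) = (\<Sum>\<sigma>\<in>Y (Suc i). inc \<tau> \<sigma> * co w \<gamma> \<sigma>)"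
    unfolding lookup_sum by (rule sum.cong) (simp_all add: tm)
  also have "\<dots> = (\<Sum>\<sigma>\<in>Pow A. inc \<tau> \<sigma> * co w \<gamma> \<sigma>)"
    using finA fsuppD[OF w] by (intro sum.mono_neutral_left) (auto simp: Y_mem co_def)
  also have "\<dots> = (\<Sum>\<sigma>\<in>Pow (below \<gamma>). inc \<tau> \<sigma> * co w \<gamma> \<sigma>)"
    using finA by (intro sum.mono_neutral_right) (auto simp: co_def below_def)
  finally show ?thesis using t(2) by (simp add: bd_def)
qed

lemma bd_cong: "(\<And>\<sigma>. \<sigma> \<in> X \<Longrightarrow> u \<sigma> = w \<sigma>) \<Longrightarrow> bd X u = bd X w"
  unfolding bd_def by (auto intro!: ext sum.cong)

lemma cone_0: "cone h 0 = 0" by (simp add: cone_def fun_eq_iff)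

text \<open>In each multidegree the full simplex is contracted by the cone at a chosen generator
  \<open>g \<gamma>\<close>, and the solutions are assembled into polynomials. If no generator lies
  below \<open>\<gamma>\<close>, only the empty set remains, which \<open>emp\<close>
  handles.\<close>

lemma taylor_lift:
  assumes v: "v \<in> fsupp (Y i)"
    and cyc: "\<And>\<gamma>. below \<gamma> \<noteq> {} \<Longrightarrow> bd (Pow (below \<gamma>)) (co v \<gamma>) = 0"
    and emp: "\<And>\<gamma>. below \<gamma> = {} \<Longrightarrow> co v \<gamma> {} = 0"
  shows "\<exists>w\<in>fsupp (Y (Suc i)). \<forall>\<tau>. (\<Sum>\<sigma>\<in>Y (Suc i). E i \<tau> \<sigma> * w \<sigma>) = v \<tau>"
proof -
  define g where "g \<gamma> = (SOME g. g \<in> below \<gamma>)" for \<gamma>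
  have g: "g \<gamma> \<in> below \<gamma>" if "below \<gamma> \<noteq> {}" for \<gamma> unfolding g_def using that some_in_eq by blast
  define f where "f \<sigma> \<beta> = cone (g (\<beta> + lc \<sigma>)) (co v (\<beta> + lc \<sigma>)) \<sigma>" for \<sigma> \<beta>
  \<comment> \<open>Polynomials need finite support. A nonzero value at \<open>\<beta>\<close> comes
    from a term of one of finitely many \<open>v (\<sigma> - {h})\<close>, and the shift of
    exponents between the two is injective.\<close>
  have ff: "finite {\<beta>. f \<sigma> \<beta> \<noteq> 0}" if s: "\<sigma> \<subseteq> A" for \<sigma>
  proof (rule finite_subset)
    show "{\<beta>. f \<sigma> \<beta> \<noteq> 0} \<subseteq> (\<Union>h\<in>\<sigma>. (\<lambda>\<beta>. \<beta> + lc \<sigma> - lc (\<sigma> - {h})) -` Poly_Mapping.keys (v (\<sigma> - {h})))"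
    proof
      fix \<beta> assume "\<beta> \<in> {\<beta>. f \<sigma> \<beta> \<noteq> 0}"
      then have "g (\<beta> + lc \<sigma>) \<in> \<sigma>" "co v (\<beta> + lc \<sigma>) (\<sigma> - {g (\<beta> + lc \<sigma>)}) \<noteq> 0"
        by (auto simp: f_def cone_def split: if_splits)
      then show "\<beta> \<in> (\<Union>h\<in>\<sigma>. (\<lambda>\<beta>. \<beta> + lc \<sigma> - lc (\<sigma> - {h})) -` Poly_Mapping.keys (v (\<sigma> - {h})))"
        by (intro UN_I[of "g (\<beta> + lc \<sigma>)"]) (auto simp: co_def in_keys_iff split: if_splits)
    qed
    show "finite (\<Union>h\<in>\<sigma>. (\<lambda>\<beta>. \<beta> + lc \<sigma> - lc (\<sigma> - {h})) -` Poly_Mapping.keys (v (\<sigma> - {h})))"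
    proof (intro finite_UN_I fin_sub[OF s] finite_vimageI finite_keys)
      fix h
      have le: "ple (lc (\<sigma> - {h})) (lc \<sigma>)" by (rule lc_mono[OF fin_sub[OF s]]) auto
      show "inj (\<lambda>\<beta>. \<beta> + lc \<sigma> - lc (\<sigma> - {h}))"
      proof (rule injI, rule poly_mapping_eqI)
        fix x y k assume "x + lc \<sigma> - lc (\<sigma> - {h}) = y + lc \<sigma> - lc (\<sigma> - {h})"
        then have "lkp (x + lc \<sigma> - lc (\<sigma> - {h})) k = lkp (y + lc \<sigma> - lc (\<sigma> - {h})) k" by simp
        moreover have "lkp (lc (\<sigma> - {h})) k \<le> lkp (lc \<sigma>) k" using le by (simp add: ple_def)
        ultimately show "lkp x k = lkp y k" by (simp add: lookup_add lookup_minus)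
      qed
    qed
  qed
  define w where "w \<sigma> = (if \<sigma> \<in> Y (Suc i) then Abs_poly_mapping (f \<sigma>) else 0)" for \<sigma>
  have ws: "w \<in> fsupp (Y (Suc i))" by (simp add: fsupp_def w_def)
  have lw: "lkp (w \<sigma>) \<beta> = f \<sigma> \<beta>" if "\<sigma> \<in> Y (Suc i)" for \<sigma> \<beta>
    using that ff[of \<sigma>] by (simp add: w_def Y_mem)
  have cow: "co w \<gamma> \<sigma> = cone (g \<gamma>) (co v \<gamma>) \<sigma>" if s: "\<sigma> \<subseteq> below \<gamma>" for \<gamma> \<sigma>
  proof (cases "\<sigma> \<in> Y (Suc i)")
    case True
    have "\<gamma> - lc \<sigma> + lc \<sigma> = \<gamma>" using ple_diff_add s below_iff by blast
    then show ?thesis using s lw[OF True] by (simp add: co_def[of w] f_def)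
  next
    case False
    have "cone (g \<gamma>) (co v \<gamma>) \<sigma> = 0"
    proof (rule ccontr)
      assume "cone (g \<gamma>) (co v \<gamma>) \<sigma> \<noteq> 0"
      then have gs: "g \<gamma> \<in> \<sigma>" and c: "co v \<gamma> (\<sigma> - {g \<gamma>}) \<noteq> 0" by (auto simp: cone_def split: if_splits)
      from c have "v (\<sigma> - {g \<gamma>}) \<noteq> 0" by (auto simp: co_def split: if_splits)
      then have "\<sigma> - {g \<gamma>} \<in> Y i" using fsuppD[OF v] by blast
      moreover have "\<sigma> \<subseteq> A" using s below_iff by blast
      moreover have "card \<sigma> = Suc (card (\<sigma> - {g \<gamma>}))" using card.remove[OF fin_sub[OF \<open>\<sigma> \<subseteq> A\<close>] gs] .
      ultimately show False using False by (simp add: Y_mem)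
    qed
    then show ?thesis using False by (simp add: co_def w_def)
  qed
  have "(\<Sum>\<sigma>\<in>Y (Suc i). E i \<tau> \<sigma> * w \<sigma>) = v \<tau>" for \<tau>
  proof (cases "\<tau> \<in> Y i")
    case False
    then show ?thesis using fsuppD[OF v False] by (simp add: E_def)
  next
    case True
    show ?thesis
    proof (rule poly_mapping_eqI)
      fix \<beta>
      let ?c = "\<beta> + lc \<tau>"
      have tA: "\<tau> \<subseteq> A" using True by (simp add: Y_mem)
      have tb: "\<tau> \<subseteq> below ?c" unfolding below_iff using tA by (simp add: ple_def lookup_add)
      have bc: "?c - lc \<tau> = \<beta>" by simp
      have L: "lkp (\<Sum>\<sigma>\<in>Y (Suc i). E i \<tau> \<sigma> * w \<sigma>) \<beta> = bd (Pow (below ?c)) (cone (g ?c) (co v ?c)) \<tau>"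
        using lookup_d[OF ws True tb] bd_cong[of "Pow (below ?c)" "co w ?c" "cone (g ?c) (co v ?c)"] cow unfolding bc by auto
      have R: "lkp (v \<tau>) \<beta> = co v ?c \<tau>" using tb by (simp add: co_def)
      show "lkp (\<Sum>\<sigma>\<in>Y (Suc i). E i \<tau> \<sigma> * w \<sigma>) \<beta> = lkp (v \<tau>) \<beta>"
      proof (cases "below ?c = {}")
        case False
        have gb: "g ?c \<in> below ?c" by (rule g[OF False])
        have "bd (Pow (below ?c)) (cone (g ?c) (co v ?c)) \<tau> + cone (g ?c) (bd (Pow (below ?c)) (co v ?c)) \<tau> = co v ?c \<tau>"
          by (rule bd_cone) (use tb gb fin_below finite_subset[OF _ fin_below[of ?c]] in auto)
        then show ?thesis unfolding L R cyc[OF False] cone_0 by simp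
      next
        case T: True
        then have "\<tau> = {}" using tb by auto
        then have "co v ?c \<tau> = 0" using emp[OF T] by simp
        moreover have "bd (Pow (below ?c)) (cone (g ?c) (co v ?c)) \<tau> = 0"
          using T \<open>\<tau> = {}\<close> by (simp add: bd_def inc_def)
        ultimately show ?thesis unfolding L R by simp
      qed
    qed
  qed
  then show ?thesis using ws by blast
qed

text \<open>Both exactness conditions are instances of \<open>taylor_lift\<close>. An element of the
  ideal is placed on the empty set, and each of its terms has a generator below it; in higher
  degree, a cycle is a cycle in every strand.\<close>

lemma free_res_taylor: "free_res Y E (ideal_gen (mon ` al ` A)) {}"
proof
  show "finite (Y i)" for i by (rule finY)
  show "Y 0 = {{}}" using fin_sub by (auto simp: Y_mem)
  show "E i \<in> msupp (Y i) (Y (Suc i))" for i by (rule E_supp)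
  show "mm (Y (Suc i)) (E i) (E (Suc i)) = 0" for i by (rule EE)
  show "0 \<in> (ideal_gen (mon ` al ` A) :: ('v, 'k) mpoly set)" by (rule ideal_0[OF is_ideal_ideal_gen])
  have Y0: "{} \<in> Y 0" by (simp add: Y_mem)
  show "E 0 {} x \<in> ideal_gen (mon ` al ` A)" for x
  proof (cases "x \<in> Y (Suc 0)")
    case False
    then show ?thesis using ideal_0[OF is_ideal_ideal_gen] by (simp add: E_def)
  next
    case True
    then obtain h where h: "x = {h}" "h \<in> A" by (auto simp: Y_mem card_Suc_eq)
    have "ple (al h) (lc x)" using ple_lc[of x "lc x"] h by (simp add: ple_def)
    then have "ple (al h) (lc x - lc {})" by (simp add: ple_def lookup_minus lookup_lc)
    then have "mon (lc x - lc {}) \<in> (ideal_gen (mon ` al ` A) :: ('v, 'k) mpoly set)"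
      unfolding monomial_ideal_mem using h by (auto simp: mon_def)
    then show ?thesis using True Y0 ideal_mult[OF is_ideal_ideal_gen] by (simp add: E_def)
  qed
  fix f :: "('v, 'k) mpoly" assume f: "f \<in> ideal_gen (mon ` al ` A)"
  define v where "v \<sigma> = (if \<sigma> = {} then f else 0)" for \<sigma> :: "nat set"
  have v: "v \<in> fsupp (Y 0)" using Y0 by (auto simp: v_def fsupp_def)
  have "\<exists>w\<in>fsupp (Y (Suc 0)). \<forall>\<tau>. (\<Sum>\<sigma>\<in>Y (Suc 0). E 0 \<tau> \<sigma> * w \<sigma>) = v \<tau>"
  proof (rule taylor_lift[OF v])
    fix \<gamma>
    have "co v \<gamma> \<in> fsupp (level (Pow (below \<gamma>)) 0)"
      by (auto simp: co_def v_def fsupp_def level_def)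
    then show "bd (Pow (below \<gamma>)) (co v \<gamma>) = 0"
      by (rule bd_level_0[OF interval_closed_Pow[OF fin_below]])
  next
    fix \<gamma> assume b: "below \<gamma> = {}"
    have lc0: "lc {} = 0" by (rule poly_mapping_eqI) (simp add: lookup_lc)
    have "\<gamma> \<notin> Poly_Mapping.keys f"
    proof
      assume "\<gamma> \<in> Poly_Mapping.keys f"
      then obtain h where "h \<in> A" "ple (al h) \<gamma>" using f unfolding monomial_ideal_mem by blast
      then show False using b by (auto simp: below_def)
    qed
    then show "co v \<gamma> {} = 0" by (simp add: co_def v_def lc0 in_keys_iff)
  qed
  then obtain w where w: "w \<in> fsupp (Y (Suc 0))" "(\<Sum>\<sigma>\<in>Y (Suc 0). E 0 {} \<sigma> * w \<sigma>) = v {}" by blast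
  then show "\<exists>w\<in>fsupp (Y 1). (\<Sum>x\<in>Y 1. E 0 {} x * w x) = f" by (auto simp: v_def)
next
  fix i v assume v: "v \<in> fsupp (Y (Suc i))" and c: "\<And>y. (\<Sum>x\<in>Y (Suc i). E i y x * v x) = 0"
  show "\<exists>w\<in>fsupp (Y (Suc (Suc i))). \<forall>y. (\<Sum>x\<in>Y (Suc (Suc i)). E (Suc i) y x * w x) = v y"
  proof (rule taylor_lift[OF v])
    fix \<gamma>
    show "bd (Pow (below \<gamma>)) (co v \<gamma>) = 0"
    proof
      fix \<tau>
      show "bd (Pow (below \<gamma>)) (co v \<gamma>) \<tau> = 0 \<tau>"
      proof (cases "\<tau> \<in> Y i \<and> \<tau> \<subseteq> below \<gamma>")
        case True
        then show ?thesis using lookup_d[OF v, of \<tau> \<gamma>] c[of \<tau>] by simp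
      next
        case False
        have z: "inc \<tau> \<sigma> * co v \<gamma> \<sigma> = 0" if "\<tau> \<subseteq> below \<gamma>" for \<sigma>
        proof (rule ccontr)
          assume n: "inc \<tau> \<sigma> * co v \<gamma> \<sigma> \<noteq> 0"
          then have "v \<sigma> \<noteq> 0" by (auto simp: co_def split: if_splits)
          then have "\<sigma> \<in> Y (Suc i)" using fsuppD[OF v] by blast
          moreover have tA: "\<tau> \<subseteq> A" using that below_iff by blast
          moreover have "inc \<tau> \<sigma> \<noteq> (0::'k)" using n by auto
          then have "card \<sigma> = Suc (card \<tau>)" by (rule inc_card[OF _ fin_sub[OF tA]])
          ultimately have "\<tau> \<in> Y i" by (simp add: Y_mem)
          then show False using False that by simp
        qed
        have "(\<Sum>\<sigma>\<in>Pow (below \<gamma>). inc \<tau> \<sigma> * co v \<gamma> \<sigma>) = 0" if "\<tau> \<subseteq> below \<gamma>"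
          by (rule sum.neutral) (use z[OF that] in blast)
        then show ?thesis by (simp add: bd_def)
      qed
    qed
  next
    fix \<gamma>
    have "{} \<notin> Y (Suc i)" by (simp add: Y_mem)
    then show "co v \<gamma> {} = 0" using fsuppD[OF v, of "{}"] by (simp add: co_def)
  qed
qed

section \<open>The reduced Taylor resolution\<close>

interpretation e: ring_hom_field "\<lambda>f :: ('v, 'k) mpoly. lkp f 0" by (rule eps_hom)

abbreviation U :: "('v \<times> nat) set \<Rightarrow> nat set set" where "U \<equiv> union_complex A pol"

text \<open>The monomial quotient has a nonzero constant term only when it is 1, that is, when the
  two least common multiples agree.\<close>

lemma em_E: "e.em (E i) \<tau> \<sigma> = (if \<tau> \<in> Y i \<and> \<sigma> \<in> Y (Suc i) \<and> \<Union>(pol ` \<tau>) = \<Union>(pol ` \<sigma>) then inc \<tau> \<sigma> else 0)"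
proof (cases "\<tau> \<in> Y i \<and> \<sigma> \<in> Y (Suc i) \<and> inc \<tau> \<sigma> \<noteq> (0::'k)")
  case False
  then show ?thesis by (auto simp: e.em_def E_def inc_single)
next
  case True
  then have A: "\<tau> \<subseteq> A" "\<sigma> \<subseteq> A" by (auto simp: Y_mem)
  have ts: "\<tau> \<subseteq> \<sigma>" using True by (metis inc_nonzeroE subset_insertI)
  have le: "ple (lc \<tau>) (lc \<sigma>)" by (rule lc_mono[OF fin_sub[OF A(2)] ts])
  have "lc \<sigma> - lc \<tau> = 0 \<longleftrightarrow> lc \<tau> = lc \<sigma>"
    using ple_diff_add[OF le] by (metis add_0 cancel_comm_monoid_add_class.diff_cancel)
  also have "\<dots> \<longleftrightarrow> \<Union>(pol ` \<tau>) = \<Union>(pol ` \<sigma>)" by (rule lc_eq_iff[OF fin_sub[OF A(1)] fin_sub[OF A(2)]])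
  finally have z: "lc \<sigma> - lc \<tau> = 0 \<longleftrightarrow> \<Union>(pol ` \<tau>) = \<Union>(pol ` \<sigma>)" .
  have "e.em (E i) \<tau> \<sigma> = lkp (Poly_Mapping.single (lc \<sigma> - lc \<tau>) (inc \<tau> \<sigma> :: 'k)) 0"
    using True by (simp add: e.em_def E_def inc_single mon_def mult_single)
  then show ?thesis using True z by (auto simp: lookup_single when_def)
qed

lemma mv_block:
  assumes v: "v \<in> fsupp (Y (Suc i))" and t: "\<tau> \<in> U m"
  shows "mv (Y (Suc i)) (e.em (E i)) v \<tau> = bd (U m) v \<tau>"
proof -
  have tA: "\<tau> \<subseteq> A" "\<Union>(pol ` \<tau>) = m" using t by (auto simp: union_complex_def)
  have "bd (U m) v \<tau> = (\<Sum>\<sigma>\<in>U m. inc \<tau> \<sigma> * v \<sigma>)" using t by (simp add: bd_def)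
  also have "\<dots> = (\<Sum>\<sigma>\<in>Pow A. if \<sigma> \<in> U m then inc \<tau> \<sigma> * v \<sigma> else 0)"
    using finA by (intro sum.mono_neutral_cong_left) (auto simp: union_complex_def)
  also have "\<dots> = (\<Sum>\<sigma>\<in>Pow A. e.em (E i) \<tau> \<sigma> * v \<sigma>)"
  proof (rule sum.cong)
    fix \<sigma> assume s: "\<sigma> \<in> Pow A"
    show "(if \<sigma> \<in> U m then inc \<tau> \<sigma> * v \<sigma> else 0) = e.em (E i) \<tau> \<sigma> * v \<sigma>"
    proof (cases "\<sigma> \<in> Y (Suc i) \<and> inc \<tau> \<sigma> \<noteq> (0::'k)")
      case False
      then have "v \<sigma> = 0 \<or> inc \<tau> \<sigma> = (0::'k)" using fsuppD[OF v] by blast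
      then show ?thesis by (auto simp: em_E)
    next
      case True
      then have "card \<sigma> = Suc (card \<tau>)" using inc_card[OF _ fin_sub[OF tA(1)]] by blast
      then have "\<tau> \<in> Y i" using True tA by (simp add: Y_mem)
      moreover have "\<sigma> \<in> U m \<longleftrightarrow> \<Union>(pol ` \<tau>) = \<Union>(pol ` \<sigma>)" using s tA(2) by (auto simp: union_complex_def)
      ultimately show ?thesis using True by (simp add: em_E)
    qed
  qed simp
  also have "\<dots> = (\<Sum>\<sigma>\<in>Y (Suc i). e.em (E i) \<tau> \<sigma> * v \<sigma>)"
    using finA by (intro sum.mono_neutral_right) (auto simp: Y_mem em_E)
  finally show ?thesis by (simp add: mv_def)
qed

lemma U_own: "\<tau> \<subseteq> A \<Longrightarrow> \<tau> \<in> U (\<Union>(pol ` \<tau>))" by (simp add: union_complex_def)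

lemma mv_outside: "\<not> \<tau> \<subseteq> A \<Longrightarrow> mv (Y (Suc i)) (e.em (E i)) v \<tau> = 0"
  by (simp add: mv_def em_E Y_mem)

lemma level_U: "level (U m) i \<subseteq> Y i" by (auto simp: level_def union_complex_def Y_mem)

lemma mv_single_block:
  assumes v: "v \<in> fsupp (level (U m) (Suc i))"
  shows "mv (Y (Suc i)) (e.em (E i)) v = bd (U m) v"
proof
  fix \<tau>
  have v': "v \<in> fsupp (Y (Suc i))" using v fsupp_mono[OF level_U] by blast
  show "mv (Y (Suc i)) (e.em (E i)) v \<tau> = bd (U m) v \<tau>"
  proof (cases "\<tau> \<in> U m")
    case True then show ?thesis by (rule mv_block[OF v'])
  next
    case F: False
    show ?thesis
    proof (cases "\<tau> \<subseteq> A")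
      case True
      have z: "v \<sigma> = 0" if "\<sigma> \<in> U (\<Union>(pol ` \<tau>))" for \<sigma>
      proof -
        have "\<sigma> \<notin> U m" using that F True by (auto simp: union_complex_def)
        then show ?thesis using fsuppD[OF v] level_subset[of "U m" "Suc i"] by blast
      qed
      have "mv (Y (Suc i)) (e.em (E i)) v \<tau> = bd (U (\<Union>(pol ` \<tau>))) v \<tau>" by (rule mv_block[OF v' U_own[OF True]])
      also have "\<dots> = 0" using z by (simp add: bd_def)
      finally show ?thesis using F by (simp add: bd_def)
    qed (use F mv_outside in \<open>simp add: bd_def\<close>)
  qed
qed

lemma bd_proj: "bd X (proj X v) = bd X v" by (rule bd_cong) (simp add: proj_def)

lemma proj_level: "v \<in> fsupp (Y i) \<Longrightarrow> proj (U m) v \<in> fsupp (level (U m) i)"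
  by (auto simp: fsupp_def proj_def level_def Y_mem union_complex_def)

text \<open>The reduced differential preserves the union of the polarized sets, so its cycles and
  boundaries split into those of the families \<open>U m\<close>.\<close>

theorem taylor_homology:
  "int (fv.dim (hcyc Y (\<lambda>i. e.em (E i)) i)) - int (fv.dim (mv (Y (Suc i)) (e.em (E i)) ` fsupp (Y (Suc i)))) =
    (\<Sum>m\<in>Pow (\<Union>(pol ` A)). hdim TYPE('k) (U m) i)"
proof -
  let ?M = "Pow (\<Union>(pol ` A))"
  have finM: "finite ?M"
  proof -
    have "pol g = Sigma UNIV (\<lambda>v. {..<lkp (al g) v})" for g by (auto simp: pol_def)
    then have "finite (pol g)" for g by simp
    then show ?thesis using finA by simp
  qed
  have finU: "finite (U m)" for m by (rule finite_interval_closed[OF interval_closed_union_complex[OF finA]])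
  have disj: "U m \<inter> U m' = {}" if "m \<noteq> m'" for m m' using that by (auto simp: union_complex_def)
  have cover: "fsupp (Y i) \<subseteq> fsupp (\<Union>m\<in>?M. U m)" for i
  proof (rule fsupp_mono, rule subsetI)
    fix \<sigma> assume "\<sigma> \<in> Y i"
    then have s: "\<sigma> \<subseteq> A" by (simp add: Y_mem)
    show "\<sigma> \<in> (\<Union>m\<in>?M. U m)" by (rule UN_I[where a = "\<Union>(pol ` \<sigma>)"]) (use s U_own[OF s] in auto)
  qed
  let ?Z = "hcyc Y (\<lambda>i. e.em (E i)) i"
  have Zs: "?Z \<subseteq> fsupp (Y i)" by (auto simp: hcyc_def)
  have cyc_sub: "cycles (U m) i \<subseteq> ?Z" for m
  proof
    fix u :: "nat set \<Rightarrow> 'k" assume u: "u \<in> cycles (U m) i"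
    then have us: "u \<in> fsupp (level (U m) i)" and b: "bd (U m) u = 0" by (simp_all add: cycles_def)
    have "u \<in> fsupp (Y i)" using us fsupp_mono[OF level_U] by blast
    moreover have "mv (Y i) (e.em (E j)) u = 0" if "i = Suc j" for j
      using mv_single_block[of u m j] us b that by simp
    ultimately show "u \<in> ?Z" by (auto simp: hcyc_def split: nat.split)
  qed
  have proj_cyc: "proj (U m) v \<in> cycles (U m) i" if v: "v \<in> ?Z" for v m
  proof -
    have vY: "v \<in> fsupp (Y i)" using v Zs by blast
    have p: "proj (U m) v \<in> fsupp (level (U m) i)" by (rule proj_level[OF vY])
    have "bd (U m) (proj (U m) v) = 0"
    proof (cases i)
      case 0
      then show ?thesis using p bd_level_0[OF interval_closed_union_complex[OF finA]] by simp
    next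
      case (Suc j)
      have z: "mv (Y (Suc j)) (e.em (E j)) v = 0" using v Suc by (simp add: hcyc_def)
      show ?thesis
      proof
        fix \<tau> show "bd (U m) (proj (U m) v) \<tau> = 0 \<tau>"
        proof (cases "\<tau> \<in> U m")
          case True
          have "bd (U m) v \<tau> = mv (Y (Suc j)) (e.em (E j)) v \<tau>" using mv_block[of v j \<tau> m] vY Suc True by simp
          then show ?thesis unfolding bd_proj z .
        qed (simp add: bd_def)
      qed
    qed
    then show ?thesis using p by (simp add: cycles_def)
  qed
  have proj_id: "proj (U m) u = u" if "u \<in> fsupp (U m)" for u :: "nat set \<Rightarrow> 'k" and m
    using fsuppD[OF that] by (auto simp: proj_def)
  have Zim: "proj (U m) ` ?Z = cycles (U m) i" for m
  proof (intro equalityI subsetI)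
    fix u assume "u \<in> proj (U m) ` ?Z"
    then obtain v where "v \<in> ?Z" "u = proj (U m) v" by (rule imageE)
    then show "u \<in> cycles (U m) i" using proj_cyc by simp
  next
    fix u :: "nat set \<Rightarrow> 'k" assume u: "u \<in> cycles (U m) i"
    then have "u = proj (U m) u" using proj_id[of u m] cycles_fsupp[of "U m" i] by auto
    then show "u \<in> proj (U m) ` ?Z" using cyc_sub u by (intro image_eqI[of u _ u]) auto
  qed
  have subZ: "fv.subspace ?Z"
  proof (cases i)
    case 0 then show ?thesis using subspace_fsupp[of "Y i"] by (simp add: hcyc_def)
  next
    case (Suc j)
    interpret l: Vector_Spaces.linear fscale fscale "mv (Y (Suc j)) (e.em (E j))" by (rule linear_mv)
    show ?thesis unfolding fv.subspace_def hcyc_def Suc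
      using subspace_fsupp[of "Y (Suc j)", where 'k='k] l.add l.scale l.zero
      by (auto simp: fv.subspace_def)
  qed
  have dZ: "fv.dim ?Z = (\<Sum>m\<in>?M. fv.dim (cycles (U m) i :: (nat set \<Rightarrow> 'k) set))"
  proof -
    have "fv.dim ?Z = (\<Sum>m\<in>?M. fv.dim (proj (U m) ` ?Z))"
      by (rule dim_blocks[OF finM finU disj subZ order_trans[OF Zs cover] subsetD[OF cyc_sub proj_cyc]])
    then show ?thesis unfolding Zim .
  qed
  let ?B = "mv (Y (Suc i)) (e.em (E i)) ` fsupp (Y (Suc i))"
  have Bs: "?B \<subseteq> fsupp (Y i)"
    by (rule image_subsetI) (rule mv_fsupp[OF e.em_msupp[OF E_supp]])
  have proj_bd: "proj (U m) (mv (Y (Suc i)) (e.em (E i)) v) = bd (U m) (proj (U m) v)" if v: "v \<in> fsupp (Y (Suc i))" for v m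
  proof
    fix \<tau> show "proj (U m) (mv (Y (Suc i)) (e.em (E i)) v) \<tau> = bd (U m) (proj (U m) v) \<tau>"
      unfolding bd_proj using mv_block[OF v, of \<tau> m] by (cases "\<tau> \<in> U m") (simp_all add: proj_def bd_def)
  qed
  have bounds_sub: "bounds (U m) (Suc i) \<subseteq> ?B" for m
  proof
    fix u :: "nat set \<Rightarrow> 'k" assume "u \<in> bounds (U m) (Suc i)"
    then obtain v where v: "v \<in> fsupp (level (U m) (Suc i))" "u = bd (U m) v" unfolding bounds_def by (rule imageE)
    have "v \<in> fsupp (Y (Suc i))" using v(1) fsupp_mono[OF level_U] by blast
    then show "u \<in> ?B" using mv_single_block[OF v(1)] v(2) by (intro image_eqI[of u _ v]) auto
  qed
  have proj_bounds: "proj (U m) u \<in> bounds (U m) (Suc i)" if "u \<in> ?B" for u m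
  proof -
    from that obtain v where v: "v \<in> fsupp (Y (Suc i))" "u = mv (Y (Suc i)) (e.em (E i)) v" by (rule imageE)
    show ?thesis unfolding v(2) proj_bd[OF v(1)] bounds_def by (rule imageI[OF proj_level[OF v(1)]])
  qed
  have Bim: "proj (U m) ` ?B = bounds (U m) (Suc i)" for m
  proof (intro equalityI subsetI)
    fix u assume "u \<in> proj (U m) ` ?B"
    then obtain v where "v \<in> ?B" "u = proj (U m) v" by (rule imageE)
    then show "u \<in> bounds (U m) (Suc i)" using proj_bounds by simp
  next
    fix u :: "nat set \<Rightarrow> 'k" assume u: "u \<in> bounds (U m) (Suc i)"
    then have "u = proj (U m) u" using proj_id[of u m] bounds_fsupp[of "U m" "Suc i"] by auto
    moreover have "u \<in> ?B" using bounds_sub u by (rule subsetD)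
    ultimately show "u \<in> proj (U m) ` ?B" by (rule image_eqI)
  qed
  have subB: "fv.subspace ?B" by (rule fvp.linear_subspace_image[OF linear_mv subspace_fsupp])
  have dB: "fv.dim ?B = (\<Sum>m\<in>?M. fv.dim (bounds (U m) (Suc i) :: (nat set \<Rightarrow> 'k) set))"
  proof -
    have "fv.dim ?B = (\<Sum>m\<in>?M. fv.dim (proj (U m) ` ?B))"
      by (rule dim_blocks[OF finM finU disj subB order_trans[OF Bs cover] subsetD[OF bounds_sub proj_bounds]])
    then show ?thesis unfolding Bim .
  qed
  show ?thesis unfolding dZ dB hdim_def by (simp add: sum_subtractf)
qed

theorem betti_eq_hdim_sum:
  assumes F: "free_res X D (ideal_gen (mon ` al ` A) :: ('v, 'k) mpoly set) p"
    and min: "\<And>i y x. lkp (D i y x) 0 = 0"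
  shows "int (card (X i)) = (\<Sum>m\<in>Pow (\<Union>(pol ` A)). hdim TYPE('k) (union_complex A pol m) i)"
proof -
  have "e.em (D i) = 0" for i using min by (simp add: e.em_def fun_eq_iff)
  from e.minimal_resolution_rank[OF F free_res_taylor this, of i] taylor_homology[of i] show ?thesis by simp
qed

end

section \<open>Betti numbers of set families\<close>

text \<open>The kernel is the image of the connecting map, whose source is zero. Concretely, a chain
  \<open>v\<close> with boundary in \<open>Y\<close> projects to a boundary of the quotient;
  subtracting \<open>bd X u\<close> moves it into \<open>Y\<close> without changing its
  boundary.\<close>

lemma (in subcomplex) kap_eq_0:
  assumes h0: "hdim TYPE('k::field) (X - Y) i = 0"
  shows "kap TYPE('k) X Y i = 0"
proof -
  have b: "bounds (X - Y) (Suc i) = (cycles (X - Y) i :: (nat set \<Rightarrow> 'k) set)" by (rule hdim_zeroD[OF W h0])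
  have "bounds X i \<inter> fsupp Y = (bounds Y i :: (nat set \<Rightarrow> 'k) set)"
  proof (intro equalityI subsetI)
    fix y :: "nat set \<Rightarrow> 'k" assume "y \<in> bounds X i \<inter> fsupp Y"
    then have "y \<in> bd X ` fsupp (level X i)" and yY: "y \<in> fsupp Y" by (simp_all add: bounds_def)
    then obtain v where v: "v \<in> fsupp (level X i)" "y = bd X v" by (elim imageE)
    have "bd (X - Y) (proj (X - Y) v) = proj (X - Y) y" unfolding v(2) by (rule bd_quot[symmetric])
    also have "\<dots> = 0" using yY proj_eq_0_iff[OF bd_fsupp[of v]] v(2) by simp
    finally have "bd (X - Y) (proj (X - Y) v) = 0" .
    moreover have "proj (X - Y) v \<in> fsupp (level (X - Y) i)" using v(1) by (auto simp: fsupp_def proj_def level_def)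
    ultimately have "proj (X - Y) v \<in> cycles (X - Y) i" by (simp add: cycles_def)
    then have "proj (X - Y) v \<in> bd (X - Y) ` fsupp (level (X - Y) (Suc i))" unfolding b[symmetric] bounds_def .
    then obtain u where u: "u \<in> fsupp (level (X - Y) (Suc i))" "proj (X - Y) v = bd (X - Y) u" by (elim imageE)
    have uX: "u \<in> fsupp (level X (Suc i))" using u(1) by (auto simp: fsupp_def level_def)
    have pu: "proj (X - Y) u = u" using u(1) by (auto simp: fsupp_def proj_def level_def intro!: ext)
    let ?w = "v - bd X u"
    interpret l: Vector_Spaces.linear fscale fscale "bd X :: (nat set \<Rightarrow> 'k) \<Rightarrow> _" by (rule linear_bd)
    interpret p: Vector_Spaces.linear fscale fscale "proj (X - Y) :: (nat set \<Rightarrow> 'k) \<Rightarrow> _" by (rule linear_proj)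
    have wX: "?w \<in> fsupp (level X i)" using v(1) bd_fsupp_level[OF X uX] by (simp add: fsupp_def)
    have "proj (X - Y) ?w = 0" unfolding p.diff bd_quot pu u(2) by simp
    moreover have "?w \<in> fsupp X" using wX fsupp_mono[OF level_subset[of X i]] by (rule subsetD[rotated])
    ultimately have wY: "?w \<in> fsupp Y" using proj_eq_0_iff by blast
    then have "?w \<in> fsupp (level Y i)" using wX by (auto simp: fsupp_def level_def)
    moreover have "y = bd Y ?w" unfolding bd_sub[OF wY, symmetric] l.diff bd_bd[OF X] v(2) by simp
    ultimately show "y \<in> bounds Y i" unfolding bounds_def by (intro image_eqI)
  next
    fix y :: "nat set \<Rightarrow> 'k" assume "y \<in> bounds Y i"
    then have "y \<in> bd Y ` fsupp (level Y i)" by (simp add: bounds_def)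
    then obtain v where v: "v \<in> fsupp (level Y i)" "y = bd Y v" by (elim imageE)
    have vX: "v \<in> fsupp (level X i)" and vY: "v \<in> fsupp Y" using v(1) YX by (auto simp: fsupp_def level_def)
    have "y = bd X v" using v(2) bd_sub[OF vY] by simp
    then have "y \<in> bounds X i" using vX by (auto simp: bounds_def)
    moreover have "y \<in> fsupp Y" unfolding v(2) by (simp add: bd_def fsupp_def)
    ultimately show "y \<in> bounds X i \<inter> fsupp Y" by simp
  qed
  then show ?thesis by (simp add: kap_def)
qed

lemma (in subcomplex) kap_le_hdim: "kap TYPE('k::field) X Y (Suc i) \<le> hdim TYPE('k) Y i"
proof -
  have "bounds X (Suc i) \<inter> fsupp Y \<subseteq> (cycles Y i :: (nat set \<Rightarrow> 'k) set)"
  proof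
    fix y :: "nat set \<Rightarrow> 'k" assume y: "y \<in> bounds X (Suc i) \<inter> fsupp Y"
    then have "y \<in> cycles X i" using bounds_Suc_cycles[OF X, of i] by auto
    then have "y \<in> fsupp (level X i)" "bd X y = 0" by (simp_all add: cycles_def)
    moreover have yY: "y \<in> fsupp Y" using y by simp
    ultimately show "y \<in> cycles Y i" using bd_sub[OF yY] by (auto simp: cycles_def fsupp_def level_def)
  qed
  from fv_dim_mono[OF this finite_interval_closed[OF Y] cycles_fsupp] show ?thesis by (simp add: kap_def hdim_def)
qed

lemma (in subcomplex) kap_0: "kap TYPE('k::field) X Y 0 = 0"
proof -
  have b: "bounds Z 0 = {0 :: nat set \<Rightarrow> 'k}" if "interval_closed Z" for Z
  proof -
    have "0 \<in> (fsupp (level Z 0) :: (nat set \<Rightarrow> 'k) set)" by (simp add: fsupp_def)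
    then show ?thesis unfolding bounds_def using bd_level_0[OF that, where 'a='k] by (auto simp: image_iff)
  qed
  have "{0} \<inter> fsupp Y = {0 :: nat set \<Rightarrow> 'k}" by (auto simp: fsupp_def)
  then show ?thesis by (simp add: kap_def b[OF X] b[OF Y])
qed

text \<open>By the homotopy formula every cycle is the boundary of its cone.\<close>

lemma hdim_toggle:
  assumes W: "interval_closed W" and tog: "\<And>\<sigma>. \<sigma> \<in> W \<Longrightarrow> insert g \<sigma> \<in> W" "\<And>\<sigma>. \<sigma> \<in> W \<Longrightarrow> \<sigma> - {g} \<in> W"
  shows "hdim TYPE('k::field) W i = 0"
proof -
  have "cycles W i \<subseteq> (bounds W (Suc i) :: (nat set \<Rightarrow> 'k) set)"
  proof
    fix v :: "nat set \<Rightarrow> 'k" assume "v \<in> cycles W i"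
    then have v: "v \<in> fsupp (level W i)" "bd W v = 0" by (simp_all add: cycles_def)
    have c0: "cone g (0 :: nat set \<Rightarrow> 'k) = 0" by (simp add: cone_def fun_eq_iff)
    have "v = bd W (cone g v)"
    proof
      fix \<tau> show "v \<tau> = bd W (cone g v) \<tau>"
      proof (cases "\<tau> \<in> W")
        case True
        have "bd W (cone g v) \<tau> + cone g (bd W v) \<tau> = v \<tau>"
          by (rule bd_cone[OF finite_interval_closed[OF W] finite_interval_closed_elem[OF W] tog True])
        then show ?thesis unfolding v(2) c0 by simp
      next
        case False
        then show ?thesis using fsuppD[OF v(1), of \<tau>] by (simp add: bd_def level_def)
      qed
    qed
    moreover have "cone g v \<in> fsupp (level W (Suc i))"
      unfolding fsupp_def
    proof (intro CollectI allI impI, rule ccontr)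
      fix \<sigma> assume s: "\<sigma> \<notin> level W (Suc i)" and "cone g v \<sigma> \<noteq> 0"
      then have gs: "g \<in> \<sigma>" and "v (\<sigma> - {g}) \<noteq> 0" by (auto simp: cone_def split: if_splits)
      then have l: "\<sigma> - {g} \<in> level W i" using fsuppD[OF v(1)] by blast
      then have m: "\<sigma> - {g} \<in> W" "card (\<sigma> - {g}) = i" by (simp_all add: level_def)
      have "insert g (\<sigma> - {g}) \<in> W" by (rule tog(1)[OF m(1)])
      then have sW: "\<sigma> \<in> W" using gs by (simp add: insert_absorb)
      have "card \<sigma> = Suc i" using card.remove[OF finite_interval_closed_elem[OF W sW] gs] m(2) by simp
      then show False using s sW by (simp add: level_def)
    qed
    ultimately show "v \<in> bounds W (Suc i)" unfolding bounds_def by (intro image_eqI)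
  qed
  then have "cycles W i = (bounds W (Suc i) :: (nat set \<Rightarrow> 'k) set)" using bounds_Suc_cycles[OF W, of i] by (intro equalityI)
  then show ?thesis by (simp add: hdim_def)
qed

lemma hdim_discrete:
  assumes W: "interval_closed W" and z: "\<And>v. bd W v = (0 :: nat set \<Rightarrow> 'k::field)"
  shows "hdim TYPE('k) W i = int (card (level W i))"
proof -
  have b: "(bounds W (Suc i) :: (nat set \<Rightarrow> 'k) set) = {0}" "(bounds W i :: (nat set \<Rightarrow> 'k) set) = {0}"
  proof -
    have "0 \<in> (fsupp (level W j) :: (nat set \<Rightarrow> 'k) set)" for j by (simp add: fsupp_def)
    then have "(bounds W j :: (nat set \<Rightarrow> 'k) set) = {0}" for j unfolding bounds_def z by auto
    then show "(bounds W (Suc i) :: (nat set \<Rightarrow> 'k) set) = {0}" "(bounds W i :: (nat set \<Rightarrow> 'k) set) = {0}" by simp_all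
  qed
  then show ?thesis using rank_nullity_level[OF W, of i, where 'k='k] fv_dim_zero[where 'k='k and 'x="nat set"] by (simp add: hdim_def)
qed

section \<open>Multigraded Betti numbers and inversion of a variable\<close>

definition hh :: "'k::field itself \<Rightarrow> nat set \<Rightarrow> (nat \<Rightarrow> 'u set) \<Rightarrow> 'u set \<Rightarrow> nat \<Rightarrow> int" where
  "hh _ A s m i = hdim TYPE('k) (union_complex A s m) i"

abbreviation dl :: "(nat \<Rightarrow> 'u set) \<Rightarrow> 'u set \<Rightarrow> nat \<Rightarrow> 'u set" where
  "dl s U \<equiv> (\<lambda>g. s g - U)"

text \<open>If \<open>x\<close> is not in \<open>m\<close>, sets with union \<open>m\<close> use
  only generators avoiding \<open>x\<close>. So this is the kernel of the map from Tor for
  \<open>L\<close> to Tor for the contraction in multidegree \<open>m\<close>, with the index raised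
  by one.\<close>

definition kk :: "'k::field itself \<Rightarrow> nat set \<Rightarrow> (nat \<Rightarrow> 'u set) \<Rightarrow> 'u \<Rightarrow> 'u set \<Rightarrow> nat \<Rightarrow> int" where
  "kk _ A s x m i = kap TYPE('k) (union_complex A (dl s {x}) m) (union_complex A s m) i"

lemma hh_nonneg: "finite A \<Longrightarrow> hh TYPE('k::field) A s m i \<ge> 0"
  unfolding hh_def by (rule hdim_nonneg[OF interval_closed_union_complex])

lemma hh_empty:
  assumes "union_complex A s m = {}"
  shows "hh TYPE('k::field) A s m i = 0"
proof -
  have "hdim TYPE('k) {} i = int (card (level {} i))"
    by (rule hdim_discrete) (auto simp: interval_closed_def bd_def fun_eq_iff)
  then show ?thesis unfolding hh_def assms by (simp add: level_def)
qed

lemma hh_outside: "\<not> m \<subseteq> \<Union>(s ` A) \<Longrightarrow> hh TYPE('k::field) A s m i = 0"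
  by (rule hh_empty) (auto simp: union_complex_def)

lemma Union_dl: "\<Union>((\<lambda>g. s g - U) ` \<sigma>) = \<Union>(s ` \<sigma>) - U" by auto

text \<open>After deletion of \<open>x\<close>, the degree \<open>m\<close> collects the unions
  \<open>m\<close> and \<open>insert x m\<close>. The former give the subcomplex because omitting
  generators never brings in \<open>x\<close>.\<close>

lemma subcomplex_dl:
  assumes "finite A" "x \<notin> m"
  shows "subcomplex (union_complex A (dl s {x}) m) (union_complex A s m)"
    and "union_complex A (dl s {x}) m - union_complex A s m = union_complex A s (insert x m)"
proof -
  show "subcomplex (union_complex A (dl s {x}) m) (union_complex A s m)"
  proof
    show "interval_closed (union_complex A (dl s {x}) m)" by (rule interval_closed_union_complex[OF assms(1)])
    show "union_complex A s m \<subseteq> union_complex A (dl s {x}) m"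
      using assms(2) unfolding union_complex_def Union_dl by auto
    show "\<tau> \<in> union_complex A s m"
      if "\<sigma> \<in> union_complex A s m" "\<tau> \<in> union_complex A (dl s {x}) m" "\<tau> \<subseteq> \<sigma>" for \<sigma> \<tau>
    proof -
      have "\<Union>(s ` \<tau>) \<subseteq> \<Union>(s ` \<sigma>)" using that(3) by blast
      then have "x \<notin> \<Union>(s ` \<tau>)" using that(1) assms(2) by (auto simp: union_complex_def)
      then have "\<Union>(s ` \<tau>) - {x} = \<Union>(s ` \<tau>)" by simp
      then show ?thesis using that(2) unfolding union_complex_def Union_dl by simp
    qed
  qed
  have e: "\<Union>(s ` \<sigma>) - {x} = m \<and> \<Union>(s ` \<sigma>) \<noteq> m \<longleftrightarrow> \<Union>(s ` \<sigma>) = insert x m" for \<sigma> using assms(2) by auto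
  show "union_complex A (dl s {x}) m - union_complex A s m = union_complex A s (insert x m)"
  proof (rule set_eqI)
    fix \<sigma>
    have "\<sigma> \<in> union_complex A (dl s {x}) m - union_complex A s m \<longleftrightarrow> \<sigma> \<subseteq> A \<and> \<Union>(s ` \<sigma>) - {x} = m \<and> \<Union>(s ` \<sigma>) \<noteq> m"
      unfolding Diff_iff union_complex_def mem_Collect_eq Union_dl by blast
    also have "\<dots> \<longleftrightarrow> \<sigma> \<in> union_complex A s (insert x m)" unfolding e union_complex_def mem_Collect_eq ..
    finally show "\<sigma> \<in> union_complex A (dl s {x}) m - union_complex A s m \<longleftrightarrow> \<sigma> \<in> union_complex A s (insert x m)" .
  qed
qed

lemma hh_exact:
  assumes "finite A" "x \<notin> m"
  shows "hh TYPE('k::field) A s (insert x m) i + hh TYPE('k) A s m i =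
    hh TYPE('k) A (dl s {x}) m i + kk TYPE('k) A s x m i + kk TYPE('k) A s x m (Suc i)"
  using subcomplex.hdim_exact[OF subcomplex_dl(1)[OF assms], of s i, where 'k='k]
  unfolding subcomplex_dl(2)[OF assms] hh_def kk_def .

lemma kk_nonneg: "finite A \<Longrightarrow> x \<notin> m \<Longrightarrow> kk TYPE('k::field) A s x m i \<ge> 0"
  unfolding kk_def by (rule subcomplex.kap_nonneg[OF subcomplex_dl(1)])

lemma kk_0: "finite A \<Longrightarrow> x \<notin> m \<Longrightarrow> kk TYPE('k::field) A s x m 0 = 0"
  unfolding kk_def by (rule subcomplex.kap_0[OF subcomplex_dl(1)])

lemma kk_le: "finite A \<Longrightarrow> x \<notin> m \<Longrightarrow> kk TYPE('k::field) A s x m (Suc i) \<le> hh TYPE('k) A s m i"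
  unfolding kk_def hh_def by (rule subcomplex.kap_le_hdim[OF subcomplex_dl(1)])

lemma kk_eq: "finite A \<Longrightarrow> x \<notin> m \<Longrightarrow> hh TYPE('k::field) A (dl s {x}) m i = 0 \<Longrightarrow> kk TYPE('k) A s x m (Suc i) = hh TYPE('k) A s m i"
  unfolding kk_def hh_def by (rule subcomplex.kap_eq_hdim[OF subcomplex_dl(1)])

lemma Pow_insert_sum:
  assumes "finite U" "x \<notin> U"
  shows "(\<Sum>m\<in>Pow (insert x U). f m) = (\<Sum>m\<in>Pow U. f m + f (insert x m) :: 'a::comm_monoid_add)"
proof -
  have "(\<Sum>m\<in>Pow (insert x U). f m) = (\<Sum>m\<in>Pow U. f m) + (\<Sum>m\<in>insert x ` Pow U. f m)"
    unfolding Pow_insert using assms by (intro sum.union_disjoint) auto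
  also have "(\<Sum>m\<in>insert x ` Pow U. f m) = (\<Sum>m\<in>Pow U. f (insert x m))"
  proof -
    have "inj_on (insert x) (Pow U)"
    proof (rule inj_onI)
      fix a b assume "a \<in> Pow U" "b \<in> Pow U" and e: "insert x a = insert x b"
      then have "x \<notin> a" "x \<notin> b" using assms(2) by auto
      then show "a = b" using e by (metis Diff_insert_absorb)
    qed
    then show ?thesis by (simp add: sum.reindex)
  qed
  finally show ?thesis by (simp add: sum.distrib)
qed

text \<open>By the exact sequence, inverting one more \<open>x\<close> yields at most the classes at
  \<open>m\<close> and at \<open>insert x m\<close> together.\<close>

lemma hh_localize:
  assumes A: "finite A" and U: "finite U"
  shows "m \<inter> U = {} \<Longrightarrow> hh TYPE('k::field) A (dl s U) m i \<le> (\<Sum>U'\<in>Pow U. hh TYPE('k) A s (m \<union> U') i)"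
  using U
proof (induction U arbitrary: m rule: finite_induct)
  case empty
  then show ?case by simp
next
  case (insert x U)
  have xm: "x \<notin> m" and mU: "m \<inter> U = {}" "insert x m \<inter> U = {}" using insert by auto
  have "dl s (insert x U) = dl (dl s U) {x}" by (auto intro!: ext)
  then have "hh TYPE('k) A (dl s (insert x U)) m i = hh TYPE('k) A (dl (dl s U) {x}) m i" by simp
  also have "\<dots> \<le> hh TYPE('k) A (dl s U) m i + hh TYPE('k) A (dl s U) (insert x m) i"
    using hh_exact[OF A xm, of "dl s U" i, where 'k='k] kk_nonneg[OF A xm, of "dl s U" i, where 'k='k]
      kk_nonneg[OF A xm, of "dl s U" "Suc i", where 'k='k] by linarith
  also have "\<dots> \<le> (\<Sum>U'\<in>Pow U. hh TYPE('k) A s (m \<union> U') i) + (\<Sum>U'\<in>Pow U. hh TYPE('k) A s (insert x m \<union> U') i)"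
    by (rule add_mono[OF insert.IH[OF mU(1)] insert.IH[OF mU(2)]])
  also have "\<dots> = (\<Sum>U'\<in>Pow (insert x U). hh TYPE('k) A s (m \<union> U') i)"
    unfolding Pow_insert_sum[OF insert.hyps] sum.distrib by simp
  finally show ?case .
qed

definition bet :: "'k::field itself \<Rightarrow> 'u set \<Rightarrow> nat set \<Rightarrow> (nat \<Rightarrow> 'u set) \<Rightarrow> nat \<Rightarrow> int" where
  "bet _ V A s i = (\<Sum>m\<in>Pow V. hh TYPE('k) A s m i)"

text \<open>The exact sequences are summed over all \<open>m\<close> avoiding \<open>x\<close>. The
  kernel enters at \<open>i\<close> and at \<open>Suc i\<close>, which is the origin of the factor 1
  + t.\<close>

lemma bet_exact:
  assumes A: "finite A" and V: "finite V" "x \<in> V"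
  shows "bet TYPE('k::field) V A s i = bet TYPE('k) V A (dl s {x}) i +
    (\<Sum>m\<in>Pow (V - {x}). kk TYPE('k) A s x m i) + (\<Sum>m\<in>Pow (V - {x}). kk TYPE('k) A s x m (Suc i))"
proof -
  let ?V = "V - {x}"
  have V': "V = insert x ?V" "finite ?V" "x \<notin> ?V" using V by auto
  have split: "bet TYPE('k) V A t i = (\<Sum>m\<in>Pow ?V. hh TYPE('k) A t m i + hh TYPE('k) A t (insert x m) i)" for t
    unfolding bet_def by (subst V'(1)) (rule Pow_insert_sum[OF V'(2,3)])
  have "hh TYPE('k) A (dl s {x}) (insert x m) i = 0" for m
    by (rule hh_outside) auto
  then have "bet TYPE('k) V A (dl s {x}) i = (\<Sum>m\<in>Pow ?V. hh TYPE('k) A (dl s {x}) m i)"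
    unfolding split by simp
  moreover have "bet TYPE('k) V A s i = (\<Sum>m\<in>Pow ?V. hh TYPE('k) A (dl s {x}) m i + kk TYPE('k) A s x m i + kk TYPE('k) A s x m (Suc i))"
    unfolding split
  proof (rule sum.cong)
    fix m assume "m \<in> Pow ?V"
    then have "x \<notin> m" by auto
    then show "hh TYPE('k) A s m i + hh TYPE('k) A s (insert x m) i = hh TYPE('k) A (dl s {x}) m i + kk TYPE('k) A s x m i + kk TYPE('k) A s x m (Suc i)"
      using hh_exact[OF A, of x m s i, where 'k='k] by simp
  qed simp
  ultimately show ?thesis by (simp add: sum.distrib)
qed

lemma kk_sum_nonneg: "finite A \<Longrightarrow> (\<Sum>m\<in>Pow (V - {x}). kk TYPE('k::field) A s x m i) \<ge> 0"
  by (rule sum_nonneg, rule kk_nonneg) auto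

lemma bet_localize:
  assumes A: "finite A" and V: "finite V" and U: "finite U"
  shows "U \<subseteq> V \<Longrightarrow> bet TYPE('k::field) V A (dl s U) i \<le> bet TYPE('k) V A s i"
  using U
proof (induction U rule: finite_induct)
  case (insert x U)
  have "dl s (insert x U) = dl (dl s U) {x}" by (auto intro!: ext)
  then have "bet TYPE('k) V A (dl s (insert x U)) i \<le> bet TYPE('k) V A (dl s U) i"
    using bet_exact[OF A V, of x "dl s U" i, where 'k='k] insert.prems
      kk_sum_nonneg[OF A, where V=V and x=x and s="dl s U" and i=i and 'k='k]
      kk_sum_nonneg[OF A, where V=V and x=x and s="dl s U" and i="Suc i" and 'k='k] by simp
  also have "\<dots> \<le> bet TYPE('k) V A s i" using insert by simp
  finally show ?case .
qed simp

text \<open>The sets containing \<open>g'\<close> are stable under toggling \<open>g\<close>, as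
  \<open>s g\<close> is already covered; hence the quotient by the sets without \<open>g'\<close>
  has no homology.\<close>

lemma hh_redundant:
  assumes A: "finite A" and g: "g \<in> A" "g' \<in> A" "g \<noteq> g'" "s g \<subseteq> s g'"
  shows "hh TYPE('k::field) A s m i = hh TYPE('k) (A - {g'}) s m i"
proof -
  let ?X = "union_complex A s m" and ?Y = "union_complex (A - {g'}) s m"
  interpret subcomplex ?X ?Y
    by (unfold_locales, rule interval_closed_union_complex[OF A]) (auto simp: union_complex_def)
  have mem: "\<sigma> \<in> ?X - ?Y \<longleftrightarrow> \<sigma> \<subseteq> A \<and> \<Union>(s ` \<sigma>) = m \<and> g' \<in> \<sigma>" for \<sigma> by (auto simp: union_complex_def)
  have z: "hdim TYPE('k) (?X - ?Y) j = 0" for j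
  proof (rule hdim_toggle[OF W])
    fix \<sigma> assume "\<sigma> \<in> ?X - ?Y"
    then have s: "\<sigma> \<subseteq> A" "\<Union>(s ` \<sigma>) = m" "g' \<in> \<sigma>" unfolding mem by auto
    have gm: "s g \<subseteq> s g'" "s g' \<subseteq> m" using g(4) s by auto
    show "insert g \<sigma> \<in> ?X - ?Y" unfolding mem using s g(1) gm by auto
    have "g' \<in> \<sigma> - {g}" using s(3) g(3) by auto
    moreover have "\<Union>(s ` (\<sigma> - {g})) = m"
    proof
      show "\<Union>(s ` (\<sigma> - {g})) \<subseteq> m" using s(2) by auto
      show "m \<subseteq> \<Union>(s ` (\<sigma> - {g}))"
      proof
        fix v assume "v \<in> m"
        then obtain h where h: "h \<in> \<sigma>" "v \<in> s h" using s(2) by auto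
        show "v \<in> \<Union>(s ` (\<sigma> - {g}))"
        proof (cases "h = g")
          case True then show ?thesis using h gm(1) \<open>g' \<in> \<sigma> - {g}\<close> by auto
        qed (use h in auto)
      qed
    qed
    ultimately show "\<sigma> - {g} \<in> ?X - ?Y" unfolding mem using s(1) by auto
  qed
  show ?thesis using hdim_exact[of i, where 'k='k] kap_eq_0[OF z, of i] kap_eq_0[OF z, of "Suc i"] z[of i]
    unfolding hh_def by simp
qed

lemma hh_subfamily:
  assumes "finite R" "finite M" "\<And>g'. g' \<in> R \<Longrightarrow> g' \<notin> M" "\<And>g'. g' \<in> R \<Longrightarrow> \<exists>g\<in>M. s g \<subseteq> s g'"
  shows "hh TYPE('k::field) (M \<union> R) s m i = hh TYPE('k) M s m i"
  using assms
proof (induction R rule: finite_induct)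
  case (insert x R)
  obtain g where g: "g \<in> M" "s g \<subseteq> s x" using insert.prems(3) by blast
  have "hh TYPE('k) (M \<union> insert x R) s m i = hh TYPE('k) (M \<union> insert x R - {x}) s m i"
    by (rule hh_redundant[of _ g]) (use insert g in auto)
  also have "M \<union> insert x R - {x} = M \<union> R" using insert by auto
  finally show ?case using insert by simp
qed simp

text \<open>The Koszul case. One representative of each minimal set suffices, and a union of
  disjoint nonempty sets determines its members; so each multidegree contains at most one set of
  generators.\<close>

lemma hh_disjoint:
  assumes A: "finite A" and pd: "pairwise_disjoint (min_sets (s ` A))" and ne: "{} \<notin> min_sets (s ` A)"
  shows "hh TYPE('k::field) A s m i = (if \<exists>S\<subseteq>min_sets (s ` A). m = \<Union>S \<and> card S = i then 1 else 0)"
proof -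
  let ?F = "min_sets (s ` A)"
  have "\<forall>f\<in>?F. \<exists>g. g \<in> A \<and> s g = f" by (auto simp: min_sets_def)
  from bchoice[OF this] obtain r where r: "\<forall>f\<in>?F. r f \<in> A \<and> s (r f) = f" ..
  let ?M = "r ` ?F"
  have MA: "?M \<subseteq> A" using r by auto
  have finF: "finite ?F" using A by (simp add: min_sets_def)
  have "hh TYPE('k) (?M \<union> (A - ?M)) s m i = hh TYPE('k) ?M s m i"
  proof (rule hh_subfamily)
    fix g' assume "g' \<in> A - ?M"
    then obtain f where f: "f \<in> ?F" "f \<subseteq> s g'" using min_sets_below[of "s ` A" "s g'"] A by auto
    then show "\<exists>g\<in>?M. s g \<subseteq> s g'" using r by (intro bexI[of _ "r f"]) auto
  qed (use A finF in auto)
  then have red: "hh TYPE('k) A s m i = hh TYPE('k) ?M s m i" using MA by (simp add: Un_absorb1)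
  have inj: "inj_on s ?M"
  proof (rule inj_onI)
    fix a b assume "a \<in> ?M" "b \<in> ?M" and e: "s a = s b"
    then obtain f f' where f: "f \<in> ?F" "a = r f" "f' \<in> ?F" "b = r f'" by blast
    then have "s a = f" "s b = f'" using r by blast+
    then show "a = b" using f(2,4) e by simp
  qed
  have sM: "s ` ?M = ?F" using r by (auto simp: image_iff)
  have inj2: "S = S'" if S: "S \<subseteq> ?F" "S' \<subseteq> ?F" "\<Union>S = \<Union>S'" for S S'
  proof -
    have "T \<subseteq> T'" if T: "T \<subseteq> ?F" "T' \<subseteq> ?F" "\<Union>T = \<Union>T'" for T T'
    proof
      fix f assume f: "f \<in> T"
      then have "f \<noteq> {}" using T ne by auto
      then obtain v where v: "v \<in> f" by blast
      then obtain f' where f': "f' \<in> T'" "v \<in> f'" using f T(3) by blast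
      have "f = f'" by (rule pairwise_disjointD[OF pd _ _ v f'(2)]) (use f f' T in auto)
      then show "f \<in> T'" using f' by simp
    qed
    from this[OF S] this[OF S(2,1) S(3)[symmetric]] show ?thesis by (rule equalityI)
  qed
  show ?thesis
  proof (cases "\<exists>S\<subseteq>?F. m = \<Union>S")
    case False
    have "union_complex ?M s m = {}"
    proof (rule ccontr)
      assume "union_complex ?M s m \<noteq> {}"
      then obtain \<sigma> where "\<sigma> \<subseteq> ?M" "\<Union>(s ` \<sigma>) = m" by (auto simp: union_complex_def)
      then have "s ` \<sigma> \<subseteq> ?F \<and> m = \<Union>(s ` \<sigma>)" using sM by blast
      then show False using False by blast
    qed
    then have "hh TYPE('k) ?M s m i = 0" by (rule hh_empty)
    moreover have "\<not> (\<exists>S\<subseteq>?F. m = \<Union>S \<and> card S = i)" using False by blast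
    ultimately show ?thesis unfolding red by (simp only: if_False)
  next
    case True
    then obtain S where S: "S \<subseteq> ?F" "m = \<Union>S" by blast
    have rS: "s ` r ` S = S" using r S(1) by (auto simp: image_iff subset_iff)
    have X: "union_complex ?M s m = {r ` S}"
    proof (intro equalityI subsetI)
      fix \<sigma> assume "\<sigma> \<in> union_complex ?M s m"
      then have sg: "\<sigma> \<subseteq> ?M" "\<Union>(s ` \<sigma>) = m" by (auto simp: union_complex_def)
      have "s ` \<sigma> \<subseteq> ?F" using image_mono[OF sg(1), of s] sM by simp
      then have "s ` \<sigma> = S" by (rule inj2[OF _ S(1)]) (use sg S in simp)
      then have e: "s ` \<sigma> = s ` (r ` S)" using rS by simp
      have "r ` S \<subseteq> ?M" by (rule image_mono[OF S(1)])
      from inj_on_image_eq_iff[OF inj sg(1) this] e have "\<sigma> = r ` S" by (rule iffD1)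
      then show "\<sigma> \<in> {r ` S}" by simp
    next
      fix \<sigma> assume "\<sigma> \<in> {r ` S}"
      then have "\<sigma> = r ` S" by simp
      then show "\<sigma> \<in> union_complex ?M s m" unfolding union_complex_def mem_Collect_eq
        using image_mono[OF S(1), of r] rS S(2) by simp
    qed
    have cS: "card (r ` S) = card S"
    proof (rule card_image, rule inj_onI)
      fix a b assume ab: "a \<in> S" "b \<in> S" "r a = r b"
      then have "a \<in> ?F" "b \<in> ?F" using S(1) by auto
      then have e: "s (r a) = a" "s (r b) = b" using r by blast+
      show "a = b" by (rule trans[OF e(1)[unfolded ab(3), symmetric] e(2)])
    qed
    have "hdim TYPE('k) {r ` S} i = int (card (level {r ` S} i))"
    proof (rule hdim_discrete)
      have "finite S" by (rule finite_subset[OF S(1) finF])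
      then show "interval_closed {r ` S}" by (auto simp: interval_closed_def)
      show "bd {r ` S} v = 0" for v :: "nat set \<Rightarrow> 'k" by (auto simp: bd_def inc_def fun_eq_iff)
    qed
    also have "\<dots> = (if card S = i then 1 else 0)"
    proof -
      have "level {r ` S} i = (if card (r ` S) = i then {r ` S} else {})" by (auto simp: level_def)
      then show ?thesis unfolding cS by simp
    qed
    finally have "hh TYPE('k) A s m i = (if card S = i then 1 else 0)" unfolding red unfolding hh_def X .
    moreover have "(\<exists>T\<subseteq>?F. m = \<Union>T \<and> card T = i) \<longleftrightarrow> card S = i"
    proof
      assume "\<exists>T\<subseteq>?F. m = \<Union>T \<and> card T = i"
      then obtain T where T: "T \<subseteq> ?F" "m = \<Union>T" "card T = i" by blast
      have "T = S" by (rule inj2[OF T(1) S(1)]) (use T S in simp)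
      then show "card S = i" using T by simp
    qed (use S in blast)
    ultimately show ?thesis by simp
  qed
qed

lemma bet_disjoint:
  assumes A: "finite A" and pd: "pairwise_disjoint (min_sets (s ` A))" and ne: "{} \<notin> min_sets (s ` A)"
    and V: "finite V" "\<Union>(s ` A) \<subseteq> V"
  shows "bet TYPE('k::field) V A s i = int (card (min_sets (s ` A)) choose i)"
proof -
  let ?F = "min_sets (s ` A)"
  let ?S = "{S. S \<subseteq> ?F \<and> card S = i}"
  have finF: "finite ?F" using A by (simp add: min_sets_def)
  have inj: "inj_on Union ?S"
  proof (rule inj_onI)
    have "T \<subseteq> T'" if T: "T \<subseteq> ?F" "T' \<subseteq> ?F" "\<Union>T = \<Union>T'" for T T'
    proof
      fix f assume f: "f \<in> T"
      then have "f \<noteq> {}" using T ne by auto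
      then obtain v where v: "v \<in> f" by blast
      then obtain f' where f': "f' \<in> T'" "v \<in> f'" using f T(3) by blast
      have "f = f'" by (rule pairwise_disjointD[OF pd _ _ v f'(2)]) (use f f' T in auto)
      then show "f \<in> T'" using f' by simp
    qed
    note sub = this
    fix S S' assume "S \<in> ?S" "S' \<in> ?S" "\<Union>S = \<Union>S'"
    then have S: "S \<subseteq> ?F" "S' \<subseteq> ?F" "\<Union>S = \<Union>S'" by auto
    from sub[OF S] sub[OF S(2,1) S(3)[symmetric]] show "S = S'" by (rule equalityI)
  qed
  have FV: "\<Union>?F \<subseteq> V" using V(2) by (auto simp: min_sets_def)
  have "bet TYPE('k) V A s i = (\<Sum>m\<in>Pow V. if m \<in> Union ` ?S then 1 else 0)"
    unfolding bet_def hh_disjoint[OF A pd ne] by (intro sum.cong refl if_cong) (auto simp: image_iff)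
  also have "\<dots> = int (card (Union ` ?S))"
  proof -
    have "Pow V \<inter> Union ` ?S = Union ` ?S" using FV by blast
    then show ?thesis using V(1) by (simp add: sum.If_cases)
  qed
  also have "card (Union ` ?S) = card ?S" by (rule card_image[OF inj])
  also have "\<dots> = card ?F choose i" by (rule n_subsets[OF finF])
  finally show ?thesis .
qed

lemma hh_unit:
  assumes A: "finite A" and g: "g \<in> A" "s g = {}"
  shows "hh TYPE('k::field) A s m i = 0"
  unfolding hh_def by (rule hdim_toggle[OF interval_closed_union_complex[OF A], where g=g]) (use g in \<open>auto simp: union_complex_def\<close>)

text \<open>For \<open>x\<close> in \<open>m\<close> the exact sequence bounds the value at
  \<open>m\<close> in degree \<open>i\<close> by the value at \<open>m - {x}\<close> in degree
  \<open>i\<close> after inverting \<open>x\<close>, plus the value at \<open>m - {x}\<close> in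
  degree \<open>i - 1\<close>. In the extreme case \<open>i = card m\<close> the former vanishes by
  induction, and the latter supplies the generators \<open>{v}\<close> for
  \<open>v \<noteq> x\<close>.\<close>

lemma hh_degree_bound:
  assumes A: "finite A"
  shows "finite m \<Longrightarrow> hh TYPE('k::field) A s m i \<noteq> 0 \<Longrightarrow> i \<le> card m \<and> (i = card m \<longrightarrow> (\<forall>v\<in>m. {v} \<in> s ` A))"
proof (induction "card m" arbitrary: m i s rule: less_induct)
  case less
  have ne: "{} \<notin> s ` A" using hh_unit[OF A, of _ s m i] less.prems(2) by auto
  show ?case
  proof (cases "m = {}")
    case True
    have X: "union_complex A s {} = {{}}"
      using ne by (auto simp: union_complex_def)
    have "hdim TYPE('k) {{}} i = int (card (level {{}} i))"
      by (rule hdim_discrete) (auto simp: interval_closed_def bd_def inc_def fun_eq_iff)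
    then have "level {{}} i \<noteq> {}" using less.prems(2) unfolding hh_def True X by auto
    then have "i = 0" by (auto simp: level_def)
    then show ?thesis using True by simp
  next
    case False
    have step: "hh TYPE('k) A (dl s {x}) (m - {x}) i \<noteq> 0 \<or> (i \<noteq> 0 \<and> hh TYPE('k) A s (m - {x}) (i - 1) \<noteq> 0)" if x: "x \<in> m" for x
    proof -
      let ?n = "m - {x}"
      have xn: "x \<notin> ?n" and mx: "insert x ?n = m" using x by auto
      have e: "hh TYPE('k) A s m i + hh TYPE('k) A s ?n i = hh TYPE('k) A (dl s {x}) ?n i + kk TYPE('k) A s x ?n i + kk TYPE('k) A s x ?n (Suc i)"
        using hh_exact[OF A xn, of s i, where 'k='k] unfolding mx .
      have l: "kk TYPE('k) A s x ?n (Suc i) \<le> hh TYPE('k) A s ?n i" by (rule kk_le[OF A xn])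
      have pos: "hh TYPE('k) A s m i > 0" using less.prems(2) hh_nonneg[OF A, of s m i, where 'k='k] by simp
      show ?thesis
      proof (cases i)
        case 0
        then have "kk TYPE('k) A s x ?n i = 0" using kk_0[OF A xn] by simp
        then show ?thesis using e l pos by auto
      next
        case (Suc j)
        have "kk TYPE('k) A s x ?n i \<le> hh TYPE('k) A s ?n j" unfolding Suc by (rule kk_le[OF A xn])
        then show ?thesis using e l pos Suc by auto
      qed
    qed
    have cm: "card (m - {x}) < card m" "card m = Suc (card (m - {x}))" if "x \<in> m" for x
      using card.remove[OF less.prems(1) that] by auto
    have fm: "finite (m - {x})" for x using less.prems(1) by simp
    have bnd: "i \<le> card m"
    proof -
      obtain x where x: "x \<in> m" using False by blast
      show ?thesis using step[OF x] less.hyps[OF cm(1)[OF x] fm] cm(2)[OF x] by fastforce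
    qed
    moreover have "{v} \<in> s ` A" if i: "i = card m" and v: "v \<in> m" for v
    proof (cases "m = {v}")
      case True
      show ?thesis
      proof (rule ccontr)
        assume n: "{v} \<notin> s ` A"
        have "union_complex A s m = {}"
        proof (rule ccontr)
          assume "union_complex A s m \<noteq> {}"
          then obtain \<sigma> where s: "\<sigma> \<subseteq> A" "\<Union>(s ` \<sigma>) = {v}" unfolding True by (auto simp: union_complex_def)
          then obtain g where g: "g \<in> \<sigma>" "v \<in> s g" by blast
          then have "s g = {v}" using s(2) by auto
          then show False using n g s(1) by auto
        qed
        then have "hh TYPE('k) A s m i = 0" by (rule hh_empty)
        then show False using less.prems(2) by simp
      qed
    next
      case False
      then obtain x where x: "x \<in> m" "x \<noteq> v" using v by blast
      have "hh TYPE('k) A (dl s {x}) (m - {x}) i = 0"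
        using less.hyps[OF cm(1)[OF x(1)] fm, of "dl s {x}" i] cm(2)[OF x(1)] i by fastforce
      then have "hh TYPE('k) A s (m - {x}) (i - 1) \<noteq> 0" using step[OF x(1)] by auto
      from less.hyps[OF cm(1)[OF x(1)] fm this] show ?thesis using i cm(2)[OF x(1)] v x(2) by auto
    qed
    ultimately show ?thesis by blast
  qed
qed

lemma card_subsets_containing:
  assumes "finite D" "d \<notin> D"
  shows "card {B. B \<subseteq> insert d D \<and> d \<in> B \<and> card B = Suc k} = card D choose k"
proof -
  have "{B. B \<subseteq> insert d D \<and> d \<in> B \<and> card B = Suc k} = insert d ` {C. C \<subseteq> D \<and> card C = k}"
  proof (intro equalityI subsetI)
    fix B assume "B \<in> {B. B \<subseteq> insert d D \<and> d \<in> B \<and> card B = Suc k}"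
    then have B: "B \<subseteq> insert d D" "d \<in> B" "card B = Suc k" by auto
    have "finite B" by (rule finite_subset[OF B(1)]) (use assms(1) in simp)
    then have "card B = Suc (card (B - {d}))" using B(2) by (rule card.remove)
    then have "card (B - {d}) = k" using B(3) by simp
    moreover have "B - {d} \<subseteq> D" using B(1) by auto
    moreover have "B = insert d (B - {d})" using B(2) by auto
    ultimately show "B \<in> insert d ` {C. C \<subseteq> D \<and> card C = k}"
      by (intro image_eqI[of B "insert d" "B - {d}"]) simp_all
  next
    fix B assume "B \<in> insert d ` {C. C \<subseteq> D \<and> card C = k}"
    then obtain C where C: "C \<subseteq> D" "card C = k" "B = insert d C" by blast
    have "finite C" "d \<notin> C" using finite_subset[OF C(1) assms(1)] C(1) assms(2) by auto
    then show "B \<in> {B. B \<subseteq> insert d D \<and> d \<in> B \<and> card B = Suc k}" using C by auto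
  qed
  moreover have "inj_on (insert d) {C. C \<subseteq> D \<and> card C = k}"
  proof (rule inj_onI)
    fix a b assume "a \<in> {C. C \<subseteq> D \<and> card C = k}" "b \<in> {C. C \<subseteq> D \<and> card C = k}" "insert d a = insert d b"
    then have "d \<notin> a" "d \<notin> b" "insert d a = insert d b" using assms(2) by auto
    then show "a = b" by (metis Diff_insert_absorb)
  qed
  ultimately have "card {B. B \<subseteq> insert d D \<and> d \<in> B \<and> card B = Suc k} = card {C. C \<subseteq> D \<and> card C = k}"
    by (simp add: card_image)
  then show ?thesis using n_subsets[OF assms(1)] by simp
qed

lemma card_transversal:
  assumes "finite F" "{} \<notin> F"
  obtains T where "finite T" "card T \<le> card F" "\<And>f. f \<in> F \<Longrightarrow> f \<inter> T \<noteq> {}"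
proof -
  have "\<forall>f\<in>F. \<exists>v. v \<in> f" using assms(2) by (metis ex_in_conv)
  from bchoice[OF this] obtain t where t: "\<forall>f\<in>F. t f \<in> f" ..
  show ?thesis
  proof (rule that)
    show "finite (t ` F)" using assms(1) by simp
    show "card (t ` F) \<le> card F" by (rule card_image_le[OF assms(1)])
    show "f \<inter> t ` F \<noteq> {}" if "f \<in> F" for f using t that by blast
  qed
qed

lemma min_setsD: "f \<in> min_sets S \<Longrightarrow> h \<in> S \<Longrightarrow> h \<subseteq> f \<Longrightarrow> h = f"
  by (simp add: min_sets_def)

lemma min_setsI: "f \<in> S \<Longrightarrow> (\<And>h. h \<in> S \<Longrightarrow> h \<subseteq> f \<Longrightarrow> h = f) \<Longrightarrow> f \<in> min_sets S"
  by (simp add: min_sets_def)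

lemma min_sets_imageD: "a \<in> min_sets (\<phi> ` T) \<Longrightarrow> \<exists>g\<in>T. a = \<phi> g \<and> (\<forall>f\<in>T. \<phi> f \<subseteq> a \<longrightarrow> \<phi> f = a)"
  by (auto simp: min_sets_def)

lemma min_sets_imageI: "g \<in> T \<Longrightarrow> (\<And>f. f \<in> T \<Longrightarrow> \<phi> f \<subseteq> \<phi> g \<Longrightarrow> \<phi> f = \<phi> g) \<Longrightarrow> \<phi> g \<in> min_sets (\<phi> ` T)"
  by (auto simp: min_sets_def)

text \<open>Every set contains a minimal one, and deletion respects inclusion. So the contraction
  can be computed from all generators or from the minimal ones.\<close>

lemma min_sets_minus:
  assumes "finite S"
  shows "min_sets ((\<lambda>g. g - {x}) ` min_sets S) = min_sets ((\<lambda>g. g - {x}) ` S)"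
proof -
  have sub: "min_sets S \<subseteq> S" by (auto simp: min_sets_def)
  have low: "\<exists>f\<in>min_sets S. f - {x} \<subseteq> g - {x}" if g: "g \<in> S" for g
  proof -
    obtain f where "f \<in> min_sets S" "f \<subseteq> g" using min_sets_below[OF assms g] by blast
    then show ?thesis by blast
  qed
  show ?thesis
  proof (intro equalityI subsetI)
    fix a assume "a \<in> min_sets ((\<lambda>g. g - {x}) ` min_sets S)"
    from min_sets_imageD[OF this] obtain g where g: "g \<in> min_sets S" "a = g - {x}"
      and m: "\<forall>f\<in>min_sets S. f - {x} \<subseteq> a \<longrightarrow> f - {x} = a" by blast
    have "g - {x} \<in> min_sets ((\<lambda>g. g - {x}) ` S)"
    proof (rule min_sets_imageI)
      show "g \<in> S" using g(1) sub by (rule subsetD[rotated])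
      fix h assume h: "h \<in> S" "h - {x} \<subseteq> g - {x}"
      obtain f where f: "f \<in> min_sets S" "f - {x} \<subseteq> h - {x}" using low[OF h(1)] by (elim bexE)
      have "f - {x} \<subseteq> a" using order_trans[OF f(2) h(2)] unfolding g(2) .
      then have "f - {x} = a" using m f(1) by simp
      then have "g - {x} \<subseteq> h - {x}" using f(2) g(2) by simp
      then show "h - {x} = g - {x}" using h(2) by (rule order_antisym[rotated])
    qed
    then show "a \<in> min_sets ((\<lambda>g. g - {x}) ` S)" using g(2) by simp
  next
    fix a assume "a \<in> min_sets ((\<lambda>g. g - {x}) ` S)"
    from min_sets_imageD[OF this] obtain g where g: "g \<in> S" "a = g - {x}"
      and m: "\<forall>f\<in>S. f - {x} \<subseteq> a \<longrightarrow> f - {x} = a" by blast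
    obtain f where f: "f \<in> min_sets S" "f - {x} \<subseteq> g - {x}" using low[OF g(1)] by (elim bexE)
    have fa: "f - {x} = a" using m f g(2) sub by (metis subsetD)
    have "f - {x} \<in> min_sets ((\<lambda>g. g - {x}) ` min_sets S)"
    proof (rule min_sets_imageI[OF f(1)])
      fix h assume "h \<in> min_sets S" "h - {x} \<subseteq> f - {x}"
      then show "h - {x} = f - {x}" using m sub unfolding fa by (metis subsetD)
    qed
    then show "a \<in> min_sets ((\<lambda>g. g - {x}) ` min_sets S)" using fa by simp
  qed
qed

text \<open>The three shapes of lower bound for the Betti sequence; in the last two, \<open>K\<close> is the Hilbert function of the
  kernel of \<open>Tor(S/L) \<rightarrow> Tor(S/J)\<close>, where \<open>J\<close> inverts the vertex \<open>x\<close> and \<open>L\<close> omits the generators containing it.\<close>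

definition betti_shape :: "nat \<Rightarrow> (nat \<Rightarrow> int) \<Rightarrow> bool" where
  "betti_shape c b \<longleftrightarrow> (\<exists>q>c. \<forall>i. b i \<ge> int (q choose i)) \<or>
    (\<exists>K n. (\<forall>i. K i \<ge> 0) \<and> K 0 = 0 \<and> n \<ge> 1 \<and> Suc n \<ge> c \<and> (\<forall>i. b i = int (c choose i) + K i + K (Suc i)) \<and>
       ((\<forall>j. K (Suc (Suc j)) \<ge> int ((n - 1) choose j)) \<or>
        (n \<ge> 2 \<and> (\<forall>j. K (Suc (Suc j)) \<ge> 2 * int ((n - 2) choose j)))))"

section \<open>The lower bound for families of sets\<close>

lemma betti_shapeI1:
  assumes "\<And>i. K i \<ge> 0" "K 0 = 0" "n \<ge> 1" "Suc n \<ge> c" "\<And>i. b i = int (c choose i) + K i + K (Suc i)"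
    and "\<And>j. K (Suc (Suc j)) \<ge> int ((n - 1) choose j)"
  shows "betti_shape c b"
  unfolding betti_shape_def
  by (intro disjI2 exI[of _ K] exI[of _ n] conjI allI disjI1 assms)

lemma betti_shapeI2:
  assumes "\<And>i. K i \<ge> 0" "K 0 = 0" "n \<ge> 2" "Suc n \<ge> c" "\<And>i. b i = int (c choose i) + K i + K (Suc i)"
    and "\<And>j. K (Suc (Suc j)) \<ge> 2 * int ((n - 2) choose j)"
  shows "betti_shape c b"
proof -
  have n1: "n \<ge> 1" using assms(3) by simp
  have r: "n \<ge> 2 \<and> (\<forall>j. K (Suc (Suc j)) \<ge> 2 * int ((n - 2) choose j))" by (intro conjI allI assms)
  show ?thesis unfolding betti_shape_def
    by (rule disjI2, rule exI[of _ K], rule exI[of _ n], intro conjI allI assms n1, rule disjI2, rule r)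
qed

text \<open>A contraction with more than \<open>c\<close> generators has large enough binomial Betti
  numbers by itself. Otherwise it contributes (1+t)^c, and the kernel is bounded below by the
  classes seen at the cover \<open>D\<close>.\<close>

lemma bet_nearly_ci:
  fixes s :: "nat \<Rightarrow> 'u set"
  assumes A: "finite A" and fs: "\<And>g. g \<in> A \<Longrightarrow> finite (s g)" and ne: "{} \<notin> s ` A"
    and V: "finite V" "\<Union>(s ` A) \<subseteq> V"
    and nci: "nearly_ci (min_sets (s ` A))"
    and cov: "\<And>D. finite D \<Longrightarrow> (\<And>g. g \<in> A \<Longrightarrow> s g \<inter> D \<noteq> {}) \<Longrightarrow> c \<le> card D"
  shows "betti_shape c (bet TYPE('k::field) V A s)"
proof -
  let ?G = "min_sets (s ` A)"
  note neA = ne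
  interpret nearly_ci ?G by (rule nci)
  obtain x D where x: "x \<in> \<Union>?G" "{x} \<notin> ?G" and D: "min_cover ?G x D" and gd: "good x D"
    using good_vertex_exists by blast
  let ?F = "contract x ?G"
  let ?t = "dl s {x}"
  have im: "?t ` A = (\<lambda>g. g - {x}) ` (s ` A)" by auto
  have F: "?F = min_sets (?t ` A)" unfolding contract_def im by (rule min_sets_minus) (use A in simp)
  have pd: "pairwise_disjoint (min_sets (?t ` A))" using contract_disjoint[OF x] unfolding F .
  have xV: "x \<in> V" using x(1) V(2) by (auto simp: min_sets_def)
  have Gs: "?G \<subseteq> s ` A" by (auto simp: min_sets_def)
  have below: "\<exists>h\<in>?G. h \<subseteq> s g" if "g \<in> A" for g
    using min_sets_below[of "s ` A" "s g"] A that by auto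
  have single: "{v} \<in> ?G" if v: "{v} \<in> s ` A" for v
  proof -
    obtain h where h: "h \<in> ?G" "h \<subseteq> {v}" using min_sets_below[OF finite_imageI[OF A] v] by blast
    then have "h \<noteq> {}" using ne Gs by auto
    then show ?thesis using h by (metis subset_singletonD)
  qed
  have net: "{} \<notin> ?t ` A"
  proof
    assume "{} \<in> ?t ` A"
    then obtain g where g: "g \<in> A" "s g - {x} = {}" by auto
    have "s g \<noteq> {}" using neA imageI[OF g(1), of s] by metis
    then have "s g = {x}" using g(2) by blast
    then have "{x} \<in> s ` A" using imageI[OF g(1), of s] by simp
    then show False using single x(2) by blast
  qed
  have neF: "{} \<notin> min_sets (?t ` A)" using net by (auto simp: min_sets_def)
  have tV: "\<Union>(?t ` A) \<subseteq> V" using V(2) by auto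
  have finF: "finite ?F" unfolding F using A by (simp add: min_sets_def)
  have bt: "bet TYPE('k) V A ?t i = int (card ?F choose i)" for i
    unfolding F by (rule bet_disjoint[OF A pd neF V(1) tV])
  \<comment> \<open>One vertex from each generator of the contraction meets all original
    generators.\<close>
  have cF: "c \<le> card ?F"
  proof -
    obtain T where T: "finite T" "card T \<le> card ?F" "\<And>f. f \<in> ?F \<Longrightarrow> f \<inter> T \<noteq> {}"
      using card_transversal[OF finF] neF unfolding F by metis
    have "c \<le> card T"
    proof (rule cov[OF T(1)])
      fix g assume g: "g \<in> A"
      obtain f where f: "f \<in> ?F" "f \<subseteq> s g - {x}" using min_sets_below[of "?t ` A" "?t g"] A g unfolding F by auto
      then show "s g \<inter> T \<noteq> {}" using T(3)[OF f(1)] by blast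
    qed
    then show ?thesis using T(2) by simp
  qed
  let ?K = "\<lambda>i. \<Sum>m\<in>Pow (V - {x}). kk TYPE('k) A s x m i"
  have Kn: "?K i \<ge> 0" for i by (rule kk_sum_nonneg[OF A])
  have b: "bet TYPE('k) V A s i = int (card ?F choose i) + ?K i + ?K (Suc i)" for i
    using bet_exact[OF A V(1) xV, of s i, where 'k='k] bt by simp
  show ?thesis
  proof (cases "card ?F = c")
    case False
    then have "c < card ?F" using cF by simp
    moreover have "bet TYPE('k) V A s i \<ge> int (card ?F choose i)" for i using b[of i] Kn[of i] Kn[of "Suc i"] by linarith
    ultimately show ?thesis unfolding betti_shape_def by blast
  next
    case cc: True
    have K0: "?K 0 = 0" by (rule sum.neutral) (auto intro!: kk_0[OF A])
    have finD: "finite D" and xD: "x \<notin> D" using D by (auto simp: min_cover_def)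
    have Dcov: "g \<inter> D \<noteq> {}" if "g \<in> ?G" "x \<notin> g" for g using D that by (auto simp: min_cover_def)
    have Dpriv: "\<exists>g\<in>?G. x \<notin> g \<and> g \<inter> D = {d}" if "d \<in> D" for d using D that by (auto simp: min_cover_def)
    have DV: "D \<subseteq> V" using Dpriv Gs V(2) by blast
    have cD: "c \<le> Suc (card D)"
    proof -
      have "c \<le> card (insert x D)"
      proof (rule cov)
        fix g assume "g \<in> A"
        then obtain h where h: "h \<in> ?G" "h \<subseteq> s g" using below by blast
        then show "s g \<inter> insert x D \<noteq> {}" using Dcov[OF h(1)] by blast
      qed (use finD in simp)
      then show ?thesis using finD xD by simp
    qed
    let ?U = "V - {x} - D"
    have finU: "finite ?U" using V by simp
    \<comment> \<open>In degrees inside \<open>D\<close> only the generators avoiding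
      \<open>x\<close> take part. Inverting the variables in \<open>?U\<close> cuts them down to
      their traces on \<open>D\<close>, whose minimal members are the single variables because of
      the private generators.\<close>
    have loc: "hh TYPE('k) A (dl s ?U) B (card B) = 1" if B: "B \<subseteq> D" for B
    proof -
      let ?A = "{g\<in>A. x \<notin> s g}"
      let ?r = "dl s ?U"
      have fA: "finite ?A" using A by simp
      have "union_complex A ?r B = union_complex ?A ?r B"
      proof (intro equalityI subsetI)
        fix \<sigma> assume "\<sigma> \<in> union_complex A ?r B"
        then have sg: "\<sigma> \<subseteq> A" "\<Union>(?r ` \<sigma>) = B" by (simp_all add: union_complex_def)
        have "x \<notin> s g" if "g \<in> \<sigma>" for g
        proof
          assume "x \<in> s g"
          then have "x \<in> \<Union>(?r ` \<sigma>)" using that by auto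
          then show False using sg(2) B xD by auto
        qed
        then show "\<sigma> \<in> union_complex ?A ?r B" using sg by (auto simp: union_complex_def)
      qed (auto simp: union_complex_def)
      then have red: "hh TYPE('k) A ?r B (card B) = hh TYPE('k) ?A ?r B (card B)" by (simp add: hh_def)
      have rD: "?r g = s g \<inter> D" if "g \<in> ?A" for g using that V(2) DV by auto
      have hit: "s g \<inter> D \<noteq> {}" if g: "g \<in> ?A" for g
      proof -
        obtain h where h: "h \<in> ?G" "h \<subseteq> s g" using below g by blast
        then show ?thesis using Dcov[OF h(1)] g by blast
      qed
      have sing: "{d} \<in> ?r ` ?A" if d: "d \<in> D" for d
      proof -
        obtain h where h: "h \<in> ?G" "x \<notin> h" "h \<inter> D = {d}" using Dpriv[OF d] by blast
        then obtain g where g: "g \<in> A" "h = s g" using Gs by auto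
        then have "?r g = {d}" using rD[of g] h by simp
        then show ?thesis using g h by (intro image_eqI[of _ _ g]) auto
      qed
      have ms: "min_sets (?r ` ?A) = (\<lambda>d. {d}) ` D"
      proof (intro equalityI subsetI)
        fix f assume f: "f \<in> min_sets (?r ` ?A)"
        then obtain g where g: "g \<in> ?A" "f = ?r g" by (auto simp: min_sets_def)
        then obtain d where d: "d \<in> f" "d \<in> D" using hit[OF g(1)] rD[OF g(1)] by auto
        have "{d} = f" by (rule min_setsD[OF f sing[OF d(2)]]) (use d in simp)
        then show "f \<in> (\<lambda>d. {d}) ` D" using d by blast
      next
        fix f assume "f \<in> (\<lambda>d. {d}) ` D"
        then obtain d where d: "d \<in> D" "f = {d}" by blast
        have "h = {d}" if h: "h \<in> ?r ` ?A" "h \<subseteq> {d}" for h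
        proof -
          obtain g where g: "g \<in> ?A" "h = ?r g" using h(1) by blast
          have "h \<noteq> {}" using g(2) rD[OF g(1)] hit[OF g(1)] by simp
          then show ?thesis using h(2) by blast
        qed
        then show "f \<in> min_sets (?r ` ?A)" unfolding d(2) by (intro min_setsI[OF sing[OF d(1)]])
      qed
      have p: "pairwise_disjoint (min_sets (?r ` ?A))" "{} \<notin> min_sets (?r ` ?A)"
        unfolding ms by (auto simp: pairwise_disjoint_def)
      have "(\<lambda>d. {d}) ` B \<subseteq> (\<lambda>d. {d}) ` D \<and> B = \<Union>((\<lambda>d. {d}) ` B) \<and> card ((\<lambda>d. {d}) ` B) = card B"
        using B by (auto simp: card_image)
      then have "\<exists>S\<subseteq>min_sets (?r ` ?A). B = \<Union>S \<and> card S = card B" unfolding ms by blast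
      then show ?thesis unfolding red hh_disjoint[OF fA p] by simp
    qed
    \<comment> \<open>Ensures that all classes of homological degree \<open>card B\<close> in
      degrees over \<open>B\<close> belong to the kernel: either the contraction has nothing there,
      or there is no class.\<close>
    define unhit where "unhit B \<longleftrightarrow> (\<forall>U'\<in>Pow ?U. hh TYPE('k) A ?t (B \<union> U') (card B) = 0 \<or> hh TYPE('k) A s (B \<union> U') (card B) = 0)" for B
    \<comment> \<open>The Koszul class at \<open>B\<close> is accounted for by classes in the
      degrees \<open>B \<union> U'\<close>. Different pairs give different degrees, so the
      contributions to the kernel add up; the shift in \<open>kk\<close> moves degree
      \<open>i\<close> to \<open>Suc i\<close>.\<close>
    have Kbound: "?K (Suc i) \<ge> int (card {B. B \<subseteq> D \<and> card B = i \<and> unhit B})" for i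
    proof -
      let ?B = "{B. B \<subseteq> D \<and> card B = i \<and> unhit B}"
      have finB: "finite ?B" using finD by (rule finite_subset[rotated, OF finite_Pow_iff[THEN iffD2]]) auto
      let ?p = "\<lambda>(B, U'). B \<union> U'"
      have inj: "inj_on ?p (?B \<times> Pow ?U)"
      proof (rule inj_onI)
        fix a b assume ab: "a \<in> ?B \<times> Pow ?U" "b \<in> ?B \<times> Pow ?U" "?p a = ?p b"
        obtain a1 a2 b1 b2 where e: "a = (a1, a2)" "b = (b1, b2)" by (cases a, cases b)
        have s1: "a1 \<subseteq> D" "b1 \<subseteq> D" "a2 \<inter> D = {}" "b2 \<inter> D = {}" "a1 \<union> a2 = b1 \<union> b2" using ab e by auto
        have "a1 = (a1 \<union> a2) \<inter> D" "a2 = (a1 \<union> a2) - D" "b1 = (b1 \<union> b2) \<inter> D" "b2 = (b1 \<union> b2) - D" using s1 by blast+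
        then show "a = b" using s1(5) e by metis
      qed
      have x_notin: "x \<notin> B \<union> U'" if "B \<subseteq> D" "U' \<subseteq> ?U" for B U' using that xD by auto
      have "int (card ?B) = (\<Sum>B\<in>?B. 1)" by simp
      also have "\<dots> \<le> (\<Sum>B\<in>?B. \<Sum>U'\<in>Pow ?U. kk TYPE('k) A s x (B \<union> U') (Suc i))"
      proof (rule sum_mono)
        fix B assume B: "B \<in> ?B"
        have "1 = hh TYPE('k) A (dl s ?U) B i" using loc[of B] B by auto
        also have "\<dots> \<le> (\<Sum>U'\<in>Pow ?U. hh TYPE('k) A s (B \<union> U') i)" by (rule hh_localize[OF A finU]) (use B in auto)
        also have "\<dots> \<le> (\<Sum>U'\<in>Pow ?U. kk TYPE('k) A s x (B \<union> U') (Suc i))"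
        proof (rule sum_mono)
          fix U' assume U': "U' \<in> Pow ?U"
          have xn: "x \<notin> B \<union> U'" by (rule x_notin) (use B U' in auto)
          have "hh TYPE('k) A ?t (B \<union> U') i = 0 \<or> hh TYPE('k) A s (B \<union> U') i = 0" using B U' unfolding unhit_def by auto
          then show "hh TYPE('k) A s (B \<union> U') i \<le> kk TYPE('k) A s x (B \<union> U') (Suc i)"
            using kk_eq[OF A xn, where 'k='k] kk_nonneg[OF A xn, where 'k='k] by (metis order_refl)
        qed
        finally show "1 \<le> (\<Sum>U'\<in>Pow ?U. kk TYPE('k) A s x (B \<union> U') (Suc i))" .
      qed
      also have "\<dots> = (\<Sum>y\<in>?B \<times> Pow ?U. kk TYPE('k) A s x (?p y) (Suc i))"
        unfolding sum.cartesian_product by (simp add: case_prod_beta)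
      also have "\<dots> = (\<Sum>m\<in>?p ` (?B \<times> Pow ?U). kk TYPE('k) A s x m (Suc i))"
        by (subst sum.reindex[OF inj]) simp
      also have "\<dots> \<le> ?K (Suc i)"
      proof (rule sum_mono2)
        show "finite (Pow (V - {x}))" using V by simp
        show "?p ` (?B \<times> Pow ?U) \<subseteq> Pow (V - {x})"
        proof
          fix m assume "m \<in> ?p ` (?B \<times> Pow ?U)"
          then obtain B U' where "m = B \<union> U'" "B \<subseteq> D" "U' \<subseteq> ?U" by auto
          then show "m \<in> Pow (V - {x})" using DV xD by auto
        qed
        show "0 \<le> kk TYPE('k) A s x m (Suc i)" if "m \<in> Pow (V - {x}) - ?p ` (?B \<times> Pow ?U)" for m
          by (rule kk_nonneg[OF A]) (use that in auto)
      qed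
      finally show ?thesis .
    qed
    have hitE: "\<exists>S\<subseteq>?F. m = \<Union>S \<and> card S = i" if "hh TYPE('k) A ?t m i \<noteq> 0" for m i
      using that unfolding hh_disjoint[OF A pd neF] F by (auto split: if_splits)
    \<comment> \<open>With n = |D|, exactly (n-1 choose j) subsets of \<open>D\<close> of size j+1
      contain \<open>d\<close>.\<close>
    have case1: "betti_shape c (bet TYPE('k) V A s)" if d: "d \<in> D" and u: "\<And>B. B \<subseteq> D \<Longrightarrow> d \<in> B \<Longrightarrow> unhit B" for d
    proof -
      have Dd: "D = insert d (D - {d})" using d by auto
      have "?K (Suc (Suc j)) \<ge> int ((card D - 1) choose j)" for j
      proof -
        have "{B. B \<subseteq> insert d (D - {d}) \<and> d \<in> B \<and> card B = Suc j} \<subseteq> {B. B \<subseteq> D \<and> card B = Suc j \<and> unhit B}"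
          using u d by auto
        then have "card {B. B \<subseteq> insert d (D - {d}) \<and> d \<in> B \<and> card B = Suc j} \<le> card {B. B \<subseteq> D \<and> card B = Suc j \<and> unhit B}"
          using finD by (intro card_mono finite_subset[of "{B. B \<subseteq> D \<and> card B = Suc j \<and> unhit B}" "Pow D"]) auto
        moreover have "card {B. B \<subseteq> insert d (D - {d}) \<and> d \<in> B \<and> card B = Suc j} = card (D - {d}) choose j"
          by (rule card_subsets_containing) (use finD in auto)
        moreover have "card (D - {d}) = card D - 1" using d finD by simp
        ultimately show ?thesis using Kbound[of "Suc j"] by simp
      qed
      moreover have "card D \<ge> 1" using d finD by (metis card_0_eq empty_iff less_one not_le)
      ultimately show ?thesis
        by (intro betti_shapeI1[where K = ?K and n = "card D"] Kn K0 cD b[unfolded cc])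
    qed
    \<comment> \<open>A degree of the contraction contains all of \<open>f\<close> as soon as it
      contains one vertex of it. So each \<open>B\<close> with exactly one of \<open>d\<close>,
      \<open>d'\<close> qualifies, in two disjoint families of (n-2 choose j) sets of size
      j+1.\<close>
    have case2: "betti_shape c (bet TYPE('k) V A s)" if f: "f \<in> ?F" "d \<noteq> d'" "d \<in> D" "d' \<in> D" "d \<in> f" "d' \<in> f" for f d d'
    proof -
      have u: "unhit B" if B: "B \<subseteq> D" "p \<in> B" "q \<notin> B" "q \<in> D" "p \<in> f" "q \<in> f" for B p q
        unfolding unhit_def
      proof (intro ballI disjI1, rule ccontr)
        fix U' assume U': "U' \<in> Pow ?U" and h: "hh TYPE('k) A ?t (B \<union> U') (card B) \<noteq> 0"
        from hitE[OF h] obtain S where S: "S \<subseteq> ?F" "B \<union> U' = \<Union>S" by (elim exE conjE)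
        have "p \<in> \<Union>S" unfolding S(2)[symmetric] using B(2) by (rule UnI1)
        then obtain f0 where f0: "f0 \<in> S" "p \<in> f0" by (elim UnionE)
        have "f0 = f" by (rule pairwise_disjointD[OF pd[folded F] subsetD[OF S(1) f0(1)] f(1) f0(2) B(5)])
        then have "q \<in> \<Union>S" using f0(1) B(6) by (intro UnionI[of f0]) simp_all
        then have "q \<in> B \<union> U'" unfolding S(2) .
        then show False using B(3,4) U' by auto
      qed
      let ?D = "D - {d, d'}"
      have finD': "finite ?D" using finD by simp
      have cD': "card ?D = card D - 2" "card D \<ge> 2"
      proof -
        have "card {d, d'} = 2" using f(2) by simp
        moreover have "{d, d'} \<subseteq> D" using f by simp
        ultimately show "card ?D = card D - 2" "card D \<ge> 2" using card_Diff_subset[of "{d, d'}" D] card_mono[OF finD, of "{d, d'}"] by auto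
      qed
      have "?K (Suc (Suc j)) \<ge> 2 * int ((card D - 2) choose j)" for j
      proof -
        let ?S1 = "{B. B \<subseteq> insert d ?D \<and> d \<in> B \<and> card B = Suc j}"
        let ?S2 = "{B. B \<subseteq> insert d' ?D \<and> d' \<in> B \<and> card B = Suc j}"
        let ?T = "{B. B \<subseteq> D \<and> card B = Suc j \<and> unhit B}"
        have fT: "finite ?T" using finD by (intro finite_subset[of ?T "Pow D"]) auto
        have sub1: "?S1 \<subseteq> ?T"
        proof
          fix B assume B: "B \<in> ?S1"
          then have "d' \<notin> B" "B \<subseteq> D" "d \<in> B" using f by auto
          then show "B \<in> ?T" using u[of B d d'] B f by auto
        qed
        have sub2: "?S2 \<subseteq> ?T"
        proof
          fix B assume B: "B \<in> ?S2"
          then have "d \<notin> B" "B \<subseteq> D" "d' \<in> B" using f by auto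
          then show "B \<in> ?T" using u[of B d' d] B f by auto
        qed
        have dis: "?S1 \<inter> ?S2 = {}" using f(2) by auto
        have "card ?S1 + card ?S2 = card (?S1 \<union> ?S2)"
          using card_Un_disjoint[OF finite_subset[OF sub1 fT] finite_subset[OF sub2 fT] dis] by simp
        also have "\<dots> \<le> card ?T" using sub1 sub2 by (intro card_mono[OF fT]) auto
        also have "card ?S1 = card ?D choose j" by (rule card_subsets_containing[OF finD']) simp
        also have "card ?S2 = card ?D choose j" by (rule card_subsets_containing[OF finD']) simp
        finally show ?thesis using Kbound[of "Suc j"] cD'(1) by simp
      qed
      then show ?thesis
        by (intro betti_shapeI2[where K = ?K and n = "card D"] Kn K0 cD b[unfolded cc] cD'(2))
    qed
    from gd consider (a) d where "d \<in> D" "d \<notin> \<Union>?F"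
      | (b) f d d' where "f \<in> ?F" "d \<noteq> d'" "d \<in> D" "d' \<in> D" "d \<in> f" "d' \<in> f"
      | (c) d where "\<forall>f\<in>?F. \<exists>v. f = {v}" "d \<in> D" "{d} \<notin> ?G"
      unfolding good_def by blast
    then show ?thesis
    proof cases
      case a
      show ?thesis
      proof (rule case1[OF a(1)])
        fix B assume B: "B \<subseteq> D" "d \<in> B"
        show "unhit B" unfolding unhit_def
        proof (intro ballI disjI1, rule ccontr)
          fix U' assume h: "hh TYPE('k) A ?t (B \<union> U') (card B) \<noteq> 0"
          from hitE[OF h] obtain S where S: "S \<subseteq> ?F" "B \<union> U' = \<Union>S" by (elim exE conjE)
          have "d \<in> \<Union>S" unfolding S(2)[symmetric] using B(2) by (rule UnI1)
          then have "d \<in> \<Union>?F" using Union_mono[OF S(1)] by (rule subsetD[rotated])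
          then show False using a(2) by simp
        qed
      qed
    next
      case b
      then show ?thesis by (rule case2)
    next
      \<comment> \<open>When the contraction consists of variables, a class of degree
        \<open>card B\<close> at \<open>B \<union> U'\<close> forces \<open>U'\<close> to be empty;
        then \<open>hh_degree_bound\<close> demands the generator \<open>{d}\<close>.\<close>
      case c
      show ?thesis
      proof (rule case1[OF c(2)])
        fix B assume B: "B \<subseteq> D" "d \<in> B"
        show "unhit B" unfolding unhit_def
        proof (intro ballI, rule ccontr)
          fix U' assume U': "U' \<in> Pow ?U"
            and n: "\<not> (hh TYPE('k) A ?t (B \<union> U') (card B) = 0 \<or> hh TYPE('k) A s (B \<union> U') (card B) = 0)"
          then have h: "hh TYPE('k) A ?t (B \<union> U') (card B) \<noteq> 0" by simp
          from hitE[OF h] obtain S where S: "S \<subseteq> ?F" "B \<union> U' = \<Union>S" "card S = card B" by (elim exE conjE)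
          have fm: "finite (B \<union> U')" using finite_subset[OF B(1) finD] finite_subset[OF _ finU, of U'] U' by simp
          have "card (\<Union>S) \<le> card S"
          proof -
            have "finite S" by (rule finite_subset[OF S(1) finF])
            have single_elem: "f = {the_elem f}" if "f \<in> S" for f
            proof -
              have "f \<in> ?F" using S(1) that by (rule subsetD)
              from bspec[OF c(1) this] obtain v where "f = {v}" by (elim exE)
              then show ?thesis by simp
            qed
            have "\<Union>S \<subseteq> the_elem ` S"
            proof
              fix v assume "v \<in> \<Union>S"
              then obtain f where f: "f \<in> S" "v \<in> f" by (elim UnionE)
              have "v \<in> {the_elem f}" by (rule subst[where P = "\<lambda>y. v \<in> y", OF single_elem[OF f(1)] f(2)])
              then show "v \<in> the_elem ` S" using f(1) by (intro image_eqI[of v the_elem f]) simp_all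
            qed
            then have "card (\<Union>S) \<le> card (the_elem ` S)" using \<open>finite S\<close> by (intro card_mono) simp_all
            also have "\<dots> \<le> card S" by (rule card_image_le[OF \<open>finite S\<close>])
            finally show ?thesis .
          qed
          then have "card (B \<union> U') \<le> card B" using S by simp
          then have "B = B \<union> U'" by (rule card_seteq[OF fm Un_upper1])
          moreover have "hh TYPE('k) A s (B \<union> U') (card B) \<noteq> 0" using n by simp
          ultimately have "hh TYPE('k) A s B (card B) \<noteq> 0" by simp
          moreover have "finite B" by (rule finite_subset[OF B(1) finD])
          ultimately have "{d} \<in> s ` A" using hh_degree_bound[OF A, of B s "card B", where 'k='k] B(2) by blast
          then show False using single c(3) by blast
        qed
      qed
    qed
  qed
qed

text \<open>A maximal set \<open>U\<close> of variables is inverted such that the ideal remains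
  proper and does not become a complete intersection. Maximality gives \<open>nearly_ci\<close>, and
  a cover of the localized family also covers the original one, so that \<open>c\<close> is
  kept.\<close>

theorem bet_lower_bound:
  fixes s :: "nat \<Rightarrow> 'u set"
  assumes A: "finite A" and fs: "\<And>g. g \<in> A \<Longrightarrow> finite (s g)" and ne: "{} \<notin> s ` A"
    and V: "finite V" "\<Union>(s ` A) \<subseteq> V"
    and npd: "\<not> pairwise_disjoint (min_sets (s ` A))"
    and cov: "\<And>D. finite D \<Longrightarrow> (\<And>g. g \<in> A \<Longrightarrow> s g \<inter> D \<noteq> {}) \<Longrightarrow> c \<le> card D"
  shows "\<exists>b. betti_shape c b \<and> (\<forall>i. b i \<le> bet TYPE('k::field) V A s i)"
proof -
  let ?P = "\<lambda>U. U \<subseteq> V \<and> {} \<notin> dl s U ` A \<and> \<not> pairwise_disjoint (min_sets (dl s U ` A))"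
  have "finite {U. ?P U}" using V(1) by (intro finite_subset[of "{U. ?P U}" "Pow V"]) auto
  moreover have "{} \<in> {U. ?P U}" using ne npd by simp
  then have "{U. ?P U} \<noteq> {}" by (rule ex_in_conv[THEN iffD1, OF exI])
  ultimately have "\<exists>U\<in>{U. ?P U}. \<forall>U'\<in>{U. ?P U}. U \<subseteq> U' \<longrightarrow> U = U'" by (rule finite_has_maximal)
  then obtain U where U0: "U \<in> {U. ?P U}" and m0: "\<forall>U'\<in>{U. ?P U}. U \<subseteq> U' \<longrightarrow> U = U'" by (elim bexE)
  have U: "?P U" using U0 by (rule CollectD)
  have UV: "U \<subseteq> V" by (rule conjunct1[OF U])
  have UE: "{} \<notin> dl s U ` A" by (rule conjunct1[OF conjunct2[OF U]])
  have UN: "\<not> pairwise_disjoint (min_sets (dl s U ` A))" by (rule conjunct2[OF conjunct2[OF U]])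
  have max: "U = U'" if "?P U'" "U \<subseteq> U'" for U'
  proof -
    have "U' \<in> {U. ?P U}" unfolding mem_Collect_eq by (rule that(1))
    from bspec[OF m0 this] that(2) show ?thesis by (rule mp)
  qed
  let ?s = "dl s U"
  let ?G = "min_sets (?s ` A)"
  have GA: "?G \<subseteq> ?s ` A" by (auto simp: min_sets_def)
  have nci: "nearly_ci ?G"
  proof
    show "finite ?G" using A finite_subset[OF GA] by simp
    show "finite g" if "g \<in> ?G" for g
    proof -
      from subsetD[OF GA that] obtain a where "a \<in> A" "g = ?s a" by (elim imageE)
      then show ?thesis using fs[of a] by simp
    qed
    show neG: "{} \<notin> ?G" by (rule contra_subsetD[OF GA UE])
    show "g = h" if "g \<in> ?G" "h \<in> ?G" "g \<subseteq> h" for g h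
      by (rule min_setsD[OF that(2) subsetD[OF GA that(1)] that(3)])
    show "\<not> pairwise_disjoint ?G" by (rule UN)
    fix x assume x: "x \<in> \<Union>?G" "{x} \<notin> ?G"
    have im: "(\<lambda>g. g - {x}) ` (?s ` A) = dl s (insert x U) ` A"
      unfolding image_image by (rule image_cong[OF refl]) auto
    have ctr: "contract x ?G = min_sets (dl s (insert x U) ` A)"
      unfolding contract_def im[symmetric] by (rule min_sets_minus) (use A in simp)
    from x(1) obtain g0 where g0: "g0 \<in> ?G" "x \<in> g0" by (elim UnionE)
    from subsetD[OF GA g0(1)] obtain a0 where a0: "a0 \<in> A" "g0 = ?s a0" by (elim imageE)
    have xU: "x \<notin> U" using g0(2) a0(2) by simp
    have xV: "x \<in> V" using g0(2) a0 by (intro subsetD[OF V(2)] UN_I[OF a0(1)]) simp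
    have "{} \<notin> dl s (insert x U) ` A"
    proof
      assume "{} \<in> dl s (insert x U) ` A"
      then obtain g where g1: "{} = dl s (insert x U) g" and g2: "g \<in> A" by (elim imageE)
      have g: "g \<in> A" "?s g \<subseteq> {x}" using g1 g2 by auto
      obtain h where h: "h \<in> ?G" "h \<subseteq> ?s g"
        using min_sets_below[OF finite_imageI[OF A] imageI[OF g(1), of ?s]] .
      have "h \<noteq> {}" using h(1) neG by metis
      then have "h = {x}" using h(2) g(2) by blast
      then show False using h(1) x(2) by simp
    qed
    then have e: "{} \<notin> dl s (insert x U) ` A" .
    have UV': "insert x U \<subseteq> V" using UV xV by simp
    show "pairwise_disjoint (contract x ?G)"
    proof (rule ccontr)
      assume "\<not> pairwise_disjoint (contract x ?G)"
      then have "\<not> pairwise_disjoint (min_sets (dl s (insert x U) ` A))" unfolding ctr .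
      with UV' e have "?P (insert x U)" by (intro conjI)
      from max[OF this subset_insertI] have "insert x U \<subseteq> U" by (rule equalityD2)
      then show False using xU by simp
    qed
  qed
  have "betti_shape c (bet TYPE('k) V A ?s)"
  proof (rule bet_nearly_ci[OF A _ _ V(1) _ nci])
    show "finite (?s g)" if "g \<in> A" for g using fs[OF that] by simp
    show "{} \<notin> ?s ` A" by (rule UE)
    show "\<Union>(?s ` A) \<subseteq> V" using V(2) by auto
    fix D assume D: "finite D" "\<And>g. g \<in> A \<Longrightarrow> ?s g \<inter> D \<noteq> {}"
    show "c \<le> card D" by (rule cov[OF D(1)]) (use D(2) in blast)
  qed
  moreover have "bet TYPE('k) V A ?s i \<le> bet TYPE('k) V A s i" for i
    by (rule bet_localize[OF A V(1) finite_subset[OF UV V(1)] UV])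
  ultimately show ?thesis by blast
qed

section \<open>Sums of Betti numbers\<close>

lemma coeff_one_plus_power: "coeff ([:1, 1:] ^ n :: int poly) k = int (n choose k)"
proof (induction n arbitrary: k)
  case 0
  show ?case by (cases k) auto
next
  case (Suc n)
  have "[:1, 1:] * p = p + pCons 0 p" for p :: "int poly" by simp
  then have "coeff ([:1, 1:] ^ Suc n) k = coeff ([:1, 1:] ^ n :: int poly) k + coeff (pCons 0 ([:1, 1:] ^ n)) k" by simp
  also have "\<dots> = int (Suc n choose k)" unfolding Suc coeff_pCons by (cases k) (auto simp: Suc)
  finally show ?case .
qed

lemma sum_choose_atMost: "n \<le> M \<Longrightarrow> (\<Sum>i\<le>M. int (n choose i)) = 2 ^ n"
proof -
  assume "n \<le> M"
  then have "(\<Sum>i\<le>M. int (n choose i)) = (\<Sum>i\<le>n. int (n choose i))"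
    by (intro sum.mono_neutral_right) auto
  also have "\<dots> = int (\<Sum>i\<le>n. n choose i)" by simp
  also have "\<dots> = 2 ^ n" by (simp only: choose_row_sum of_nat_power of_nat_numeral)
  finally show ?thesis .
qed

lemma sum_atMost_extend: "N \<le> (M::nat) \<Longrightarrow> (\<And>i. i > N \<Longrightarrow> f i = 0) \<Longrightarrow> (\<Sum>i\<le>M. f i) = (\<Sum>i\<le>N. f i :: int)"
  by (intro sum.mono_neutral_right) auto

lemma sum_le_eqD:
  fixes f g :: "nat \<Rightarrow> int"
  assumes "finite S" "\<And>i. i \<in> S \<Longrightarrow> f i \<le> g i" "sum g S \<le> sum f S" "i \<in> S"
  shows "f i = g i"
proof (rule ccontr)
  assume "f i \<noteq> g i"
  then have "f i < g i" using assms(2)[OF assms(4)] by simp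
  then have "sum f S < sum g S" using assms by (intro sum_strict_mono_ex1) auto
  then show False using assms(3) by simp
qed

text \<open>The arithmetic of the final count with powers of two as unknowns: a = 2^c, p = 2^(n-1),
  q = 2^n, r = 2^(c-1), k the value of the kernel function at 1, s the sum of its later values, B
  the total Betti number.\<close>

lemma doubled_sum_bounds:
  fixes a k s B p q r :: int
  assumes "p \<le> s" "0 \<le> k" "2 * p = q"
  shows "a + 2 * (k + s) \<le> B \<Longrightarrow> r \<le> q \<Longrightarrow> a + r \<le> B"
    and "a + 2 * (k + s) \<le> a + r \<Longrightarrow> q \<le> r"
    and "a + 2 * (k + s) \<le> a + q \<Longrightarrow> s \<le> p" and "a + 2 * (k + s) \<le> a + q \<Longrightarrow> k = 0"
    and "a + q \<le> a + 2 * (k + s)"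
  by (insert assms) presburger+

text \<open>For L = 1 + t and T = t the last factor is 1 + 3t + 2t^2.\<close>

lemma binomial_factor_2:
  "(L ^ Suc (Suc r) + L * (T * L ^ r)) * L ^ 2 = L ^ Suc (Suc r) * (L ^ 2 + L * T)" for L T :: "'a::comm_ring_1"
  by (simp add: power2_eq_square algebra_simps)

text \<open>For the same L and T the last factor is 1 + 5t + 5t^2 + t^3.\<close>

lemma binomial_factor_3:
  "(L ^ Suc (Suc (Suc r)) + L * (T * (2 * L ^ r))) * L ^ 3 = L ^ Suc (Suc (Suc r)) * (L ^ 3 + L * T * 2)"
  for L T :: "'a::comm_ring_1"
  by (simp add: power3_eq_cube algebra_simps)

text \<open>Every value of \<open>K\<close> is counted twice, so the total is at least 2^c + 2^n
  with n at least c-1. Equality forces n = c-1, the value 0 of \<open>K\<close> at 1, equality of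
  \<open>K\<close> with its lower bound, and \<open>b = b'\<close>; this determines the
  polynomial.\<close>

lemma betti_shape_sum:
  fixes b :: "nat \<Rightarrow> nat"
  assumes sh: "betti_shape c b'" and le: "\<And>i. b' i \<le> int (b i)" and z: "\<And>i. i > N \<Longrightarrow> b i = 0" and c1: "c \<ge> 1"
  defines "P \<equiv> (\<Sum>i\<le>N. monom (int (b i)) i)"
  shows "(\<Sum>i\<le>N. b i) \<ge> 2 ^ c + 2 ^ (c - 1)"
    and "(\<Sum>i\<le>N. b i) = 2 ^ c + 2 ^ (c - 1) \<Longrightarrow>
       P * [:1, 1:] ^ 2 = [:1, 3, 2:] * [:1, 1:] ^ c \<or> P * [:1, 1:] ^ 3 = [:1, 5, 5, 1:] * [:1, 1:] ^ c"
proof -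
  let ?B = "\<Sum>i\<le>N. int (b i)"
  have B: "int (\<Sum>i\<le>N. b i) = ?B" by simp
  obtain m where m: "c = Suc m" using c1 by (cases c) auto
  have ext: "(\<Sum>i\<le>M. int (b i)) = ?B" if "N \<le> M" for M
    by (rule sum_atMost_extend[OF that]) (use z in auto)
  have coeffP: "coeff P i = int (b i)" for i
  proof -
    have "coeff P i = (\<Sum>j\<le>N. if j = i then int (b j) else 0)"
      unfolding P_def coeff_sum by (intro sum.cong) (auto simp: coeff_monom)
    then show ?thesis using z[of i] by (cases "i \<le> N") auto
  qed
  \<comment> \<open>Common treatment of both kernel alternatives: \<open>e\<close> bounds
    \<open>K\<close> from index 2 on, has total 2^(n-1), and is the coefficient sequence of
    \<open>E\<close>.\<close>
  have kernel_case: "?B \<ge> 2 ^ c + 2 ^ m \<and> (?B = 2 ^ c + 2 ^ m \<longrightarrow> C)"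
    if K: "\<forall>i. 0 \<le> K i" "K 0 = (0::int)" and n: "1 \<le> n" "c \<le> Suc n"
      and bK: "\<forall>i. b' i = int (c choose i) + K i + K (Suc i)"
      and eK: "\<And>j. e j \<le> K (Suc (Suc j))" and es: "\<And>M. n \<le> M \<Longrightarrow> (\<Sum>j\<le>M. e j) = 2 ^ (n - 1)"
      and ez: "\<And>j. n \<le> j \<Longrightarrow> e j = 0" and eE: "\<And>j. coeff E j = e j"
      and concl: "P = [:1, 1:] ^ c + [:1, 1:] * ([:0, 1:] * E) \<Longrightarrow> c = Suc n \<Longrightarrow> C"
    for K :: "nat \<Rightarrow> int" and n e E C
  proof -
    \<comment> \<open>From here on all sequences have ended: \<open>b\<close> and \<open>K\<close>
      after N, \<open>e\<close> from n on, the binomials after c.\<close>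
    let ?M = "N + n + c"
    have Kz: "K i = 0" if "i > N" for i
    proof -
      have "b' i \<le> 0" using le[of i] z[OF that] by simp
      then have "int (c choose i) + K i + K (Suc i) \<le> 0" using bK by simp
      then show ?thesis using K(1)[rule_format, of i] K(1)[rule_format, of "Suc i"] by simp
    qed
    have split: "(\<Sum>i\<le>Suc (Suc ?M). f i) = f 0 + f (Suc 0) + (\<Sum>j\<le>?M. f (Suc (Suc j)))" for f :: "nat \<Rightarrow> int"
      by (simp only: sum.atMost_Suc_shift add.assoc)
    let ?S = "\<Sum>j\<le>?M. K (Suc (Suc j))"
    have s1: "(\<Sum>i\<le>Suc (Suc ?M). K i) = K (Suc 0) + ?S" unfolding split using K(2) by simp
    have s2: "(\<Sum>i\<le>Suc (Suc ?M). K (Suc i)) = K (Suc 0) + ?S"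
    proof -
      have "(\<Sum>i\<le>Suc (Suc ?M). K (Suc i)) = (\<Sum>i\<le>?M. K (Suc (Suc i))) + K (Suc 0)"
      proof -
        have "(\<Sum>i\<le>Suc (Suc ?M). K (Suc i)) = (\<Sum>i\<le>Suc ?M. K (Suc i))" using Kz by simp
        also have "\<dots> = K (Suc 0) + (\<Sum>i\<le>?M. K (Suc (Suc i)))" by (rule sum.atMost_Suc_shift)
        finally show ?thesis by simp
      qed
      then show ?thesis by simp
    qed
    have sb: "(\<Sum>i\<le>Suc (Suc ?M). b' i) = 2 ^ c + 2 * (K (Suc 0) + ?S)"
    proof -
      have "(\<Sum>i\<le>Suc (Suc ?M). b' i) = (\<Sum>i\<le>Suc (Suc ?M). int (c choose i)) + (\<Sum>i\<le>Suc (Suc ?M). K i) + (\<Sum>i\<le>Suc (Suc ?M). K (Suc i))"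
        using bK by (simp only: sum.distrib)
      then show ?thesis unfolding s1 s2 sum_choose_atMost[of c "Suc (Suc ?M)", OF le_SucI[OF le_SucI[OF le_add2]]] by simp
    qed
    have leB: "(\<Sum>i\<le>Suc (Suc ?M). b' i) \<le> (\<Sum>i\<le>Suc (Suc ?M). int (b i))" using le by (intro sum_mono) simp
    have extB: "(\<Sum>i\<le>Suc (Suc ?M). int (b i)) = ?B" by (rule ext) simp
    have se: "(\<Sum>j\<le>?M. e j) = 2 ^ (n - 1)" by (rule es) simp
    have seK: "(\<Sum>j\<le>?M. e j) \<le> ?S" using eK by (intro sum_mono) simp
    have K1: "K (Suc 0) \<ge> 0" using K(1) by blast
    have pn: "(2::int) * 2 ^ (n - 1) = 2 ^ n" using n(1) by (cases n) auto
    have pm: "(2::int) ^ m \<le> 2 ^ n" using n(2) m by (intro power_increasing) auto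
    note arith = doubled_sum_bounds[OF seK[unfolded se] K1 pn]
    have lower: "?B \<ge> 2 ^ c + 2 ^ m" by (rule arith(1)[OF leB[unfolded sb extB] pm])
    moreover have "C" if eq: "?B = 2 ^ c + 2 ^ m"
    proof -
      have up: "2 ^ c + 2 * (K (Suc 0) + ?S) \<le> (2::int) ^ c + 2 ^ m" using leB unfolding sb extB eq .
      have "(2::int) ^ n \<le> 2 ^ m" by (rule arith(2)[OF up])
      then have "n \<le> m" by (rule power_le_imp_le_exp[rotated]) simp
      then have nm: "n = m" using n(2) m by simp
      have up': "2 ^ c + 2 * (K (Suc 0) + ?S) \<le> (2::int) ^ c + 2 ^ n" using up nm by simp
      have tot: "?S \<le> (\<Sum>j\<le>?M. e j)" unfolding se by (rule arith(3)[OF up'])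
      have K10: "K (Suc 0) = 0" by (rule arith(4)[OF up'])
      have Ke: "K (Suc (Suc j)) = e j" for j
      proof (cases "j \<le> ?M")
        case True
        show ?thesis by (rule sum_le_eqD[of "{..?M}" e, symmetric]) (use eK tot True in auto)
      next
        case False
        then show ?thesis using Kz[of "Suc (Suc j)"] ez[of j] by simp
      qed
      have bb: "int (b i) = b' i" for i
      proof (cases "i \<le> Suc (Suc ?M)")
        case True
        have "(\<Sum>i\<le>Suc (Suc ?M). int (b i)) \<le> (\<Sum>i\<le>Suc (Suc ?M). b' i)"
          unfolding sb extB eq nm[symmetric] by (rule arith(5))
        then show ?thesis by (intro sum_le_eqD[of "{..Suc (Suc ?M)}" b', symmetric]) (use le True in auto)
      next
        case False
        then have "i > N" "i > c" by simp_all
        then show ?thesis using z[of i] bK Kz[of i] Kz[of "Suc i"] by simp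
      qed
      have R: "coeff ([:0, 1:] * E) i = K (Suc i)" for i
        using K10 Ke eE by (cases i) simp_all
      have "P = [:1, 1:] ^ c + [:1, 1:] * ([:0, 1:] * E)"
      proof (rule poly_eqI)
        fix i
        have L: "[:1, 1:] * p = p + pCons 0 p" for p :: "int poly" by simp
        have "coeff (pCons 0 ([:0, 1:] * E)) i = K i" unfolding coeff_pCons using R K(2) by (cases i) simp_all
        then have "coeff ([:1, 1:] ^ c + [:1, 1:] * ([:0, 1:] * E)) i = int (c choose i) + K (Suc i) + K i"
          unfolding L coeff_add coeff_one_plus_power R by simp
        then show "coeff P i = coeff ([:1, 1:] ^ c + [:1, 1:] * ([:0, 1:] * E)) i" unfolding coeffP bb using bK by simp
      qed
      then show C by (rule concl) (use nm m in simp)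
    qed
    ultimately show ?thesis by blast
  qed
  have main: "?B \<ge> 2 ^ c + 2 ^ m \<and> (?B = 2 ^ c + 2 ^ m \<longrightarrow>
       P * [:1, 1:] ^ 2 = [:1, 3, 2:] * [:1, 1:] ^ c \<or> P * [:1, 1:] ^ 3 = [:1, 5, 5, 1:] * [:1, 1:] ^ c)"
    using sh unfolding betti_shape_def
  proof (elim disjE exE conjE)
    \<comment> \<open>Equality is impossible here: 2^q is at least 2^(c+1), which exceeds 2^c +
      2^(c-1).\<close>
    fix q assume q: "c < q" "\<forall>i. int (q choose i) \<le> b' i"
    have "(2::int) ^ q = (\<Sum>i\<le>N + q. int (q choose i))" by (rule sum_choose_atMost[symmetric]) simp
    also have "\<dots> \<le> (\<Sum>i\<le>N + q. int (b i))" using q(2) le by (intro sum_mono) (meson order_trans)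
    also have "\<dots> = ?B" by (rule ext) simp
    finally have "2 ^ q \<le> ?B" .
    moreover have "(2::int) ^ Suc c \<le> 2 ^ q" using q(1) by (intro power_increasing) auto
    moreover have "(2::int) ^ m > 0" by simp
    ultimately have "?B > 2 ^ c + 2 ^ m" unfolding m power_Suc by linarith
    then show ?thesis by simp
  next
    fix K n assume K: "\<forall>i. 0 \<le> K i" "K 0 = (0::int)" and n: "1 \<le> n" "c \<le> Suc n"
      and bK: "\<forall>i. b' i = int (c choose i) + K i + K (Suc i)" and k1: "\<forall>j. int (n - 1 choose j) \<le> K (Suc (Suc j))"
    show ?thesis
    proof (rule kernel_case[OF K n bK, of "\<lambda>j. int (n - 1 choose j)" "[:1, 1:] ^ (n - 1)"])
      show "int (n - 1 choose j) \<le> K (Suc (Suc j))" for j using k1 by blast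
      show "(\<Sum>j\<le>M. int (n - 1 choose j)) = 2 ^ (n - 1)" if "n \<le> M" for M
        by (rule sum_choose_atMost) (use that in simp)
      show "int (n - 1 choose j) = 0" if "n \<le> j" for j using that n by simp
      show "coeff ([:1, 1:] ^ (n - 1)) j = int (n - 1 choose j)" for j by (rule coeff_one_plus_power)
      assume PE: "P = [:1, 1:] ^ c + [:1, 1:] * ([:0, 1:] * [:1, 1:] ^ (n - 1))" and cn: "c = Suc n"
      obtain r where r: "n = Suc r" using n(1) by (cases n) auto
      have e: "[:1, 1:] ^ 2 + [:1, 1:] * [:0, 1:] = ([:1, 3, 2:] :: int poly)" by (simp add: power2_eq_square)
      have "P * [:1, 1:] ^ 2 = [:1, 1:] ^ c * ([:1, 1:] ^ 2 + [:1, 1:] * [:0, 1:])"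
      proof -
        have "n - 1 = r" "c = Suc (Suc r)" using r cn by simp_all
        then show ?thesis unfolding PE by (simp only: binomial_factor_2)
      qed
      then have "P * [:1, 1:] ^ 2 = [:1, 3, 2:] * [:1, 1:] ^ c" unfolding e mult.commute[of "[:1, 1:] ^ c"] .
      then show "P * [:1, 1:] ^ 2 = [:1, 3, 2:] * [:1, 1:] ^ c \<or> P * [:1, 1:] ^ 3 = [:1, 5, 5, 1:] * [:1, 1:] ^ c" by (rule disjI1)
    qed
  next
    fix K n assume K: "\<forall>i. 0 \<le> K i" "K 0 = (0::int)" and n: "1 \<le> n" "c \<le> Suc n"
      and bK: "\<forall>i. b' i = int (c choose i) + K i + K (Suc i)" and n2: "2 \<le> n" and k2: "\<forall>j. 2 * int (n - 2 choose j) \<le> K (Suc (Suc j))"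
    show ?thesis
    proof (rule kernel_case[OF K n bK, of "\<lambda>j. 2 * int (n - 2 choose j)" "2 * [:1, 1:] ^ (n - 2)"])
      define r where "r = n - 2"
      have r: "n = Suc (Suc r)" using n2 by (simp add: r_def)
      show "2 * int (n - 2 choose j) \<le> K (Suc (Suc j))" for j using k2 by blast
      show "(\<Sum>j\<le>M. 2 * int (n - 2 choose j)) = 2 ^ (n - 1)" if "n \<le> M" for M
      proof -
        have "(\<Sum>j\<le>M. 2 * int (n - 2 choose j)) = 2 * (\<Sum>j\<le>M. int (n - 2 choose j))" by (rule sum_distrib_left[symmetric])
        also have "(\<Sum>j\<le>M. int (n - 2 choose j)) = 2 ^ (n - 2)" by (rule sum_choose_atMost) (use that in simp)
        also have "2 * (2::int) ^ (n - 2) = 2 ^ (n - 1)" using r by simp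
        finally show ?thesis .
      qed
      show "2 * int (n - 2 choose j) = 0" if "n \<le> j" for j using that r by simp
      show "coeff (2 * [:1, 1:] ^ (n - 2)) j = 2 * int (n - 2 choose j)" for j
      proof -
        have "2 * [:1, 1:] ^ (n - 2) = [:1, 1:] ^ (n - 2) + ([:1, 1:] ^ (n - 2) :: int poly)" by (rule mult_2)
        then show ?thesis by (simp only: coeff_add coeff_one_plus_power mult_2)
      qed
      assume PE: "P = [:1, 1:] ^ c + [:1, 1:] * ([:0, 1:] * (2 * [:1, 1:] ^ (n - 2)))" and cn: "c = Suc n"
      have e: "[:1, 1:] ^ 3 + [:1, 1:] * [:0, 1:] * 2 = ([:1, 5, 5, 1:] :: int poly)"
        by (simp add: power3_eq_cube mult_2_right)
      have "P * [:1, 1:] ^ 3 = [:1, 1:] ^ c * ([:1, 1:] ^ 3 + [:1, 1:] * [:0, 1:] * 2)"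
      proof -
        have "n - 2 = r" "c = Suc (Suc (Suc r))" using r cn by simp_all
        then show ?thesis unfolding PE by (simp only: binomial_factor_3)
      qed
      then have "P * [:1, 1:] ^ 3 = [:1, 5, 5, 1:] * [:1, 1:] ^ c" unfolding e mult.commute[of "[:1, 1:] ^ c"] .
      then show "P * [:1, 1:] ^ 2 = [:1, 3, 2:] * [:1, 1:] ^ c \<or> P * [:1, 1:] ^ 3 = [:1, 5, 5, 1:] * [:1, 1:] ^ c" by (rule disjI2)
    qed
  qed
  show "(\<Sum>i\<le>N. b i) \<ge> 2 ^ c + 2 ^ (c - 1)"
  proof -
    have "int (2 ^ c + 2 ^ (c - 1)) \<le> int (\<Sum>i\<le>N. b i)" using main unfolding B m by simp
    then show ?thesis by (simp only: of_nat_le_iff)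
  qed
  assume "(\<Sum>i\<le>N. b i) = 2 ^ c + 2 ^ (c - 1)"
  then have "int (\<Sum>i\<le>N. b i) = int (2 ^ c + 2 ^ (c - 1))" by (simp only:)
  then have "?B = 2 ^ c + 2 ^ m" unfolding B m by simp
  then show "P * [:1, 1:] ^ 2 = [:1, 3, 2:] * [:1, 1:] ^ c \<or> P * [:1, 1:] ^ 3 = [:1, 5, 5, 1:] * [:1, 1:] ^ c" using main by blast
qed

section \<open>Monomial ideals that are not complete intersections\<close>

lemma fvec_eq: "fvec m = fsupp {..<m}"
  by (auto simp: fvec_def fsupp_def not_less)

text \<open>Translation between the two encodings: \<open>D i\<close> is \<open>d (Suc i)\<close>
  padded with zeros. Minimality becomes the vanishing of constant terms, and the first row of
  \<open>d 1\<close> provides the finite generating set.\<close>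

lemma free_res_of_min_graded:
  fixes I :: "('v::finite, 'k::field) mpoly set"
  assumes r: "min_graded_free_res I N b deg d"
  defines "D \<equiv> \<lambda>i y x. if y < b i \<and> x < b (Suc i) then d (Suc i) y x else 0"
  shows "free_res (\<lambda>i. {..<b i}) D I 0" and "lkp (D i y x) 0 = 0" and "I = ideal_gen (set (map (d 1 0) [0..<b 1])) \<or> \<not> is_ideal I"
proof -
  have b0: "b 0 = 1" using r unfolding min_graded_free_res_def by (elim conjE)
  have mx: "d i y x \<in> max_ideal" if "i \<ge> 1" "y < b (i - 1)" "x < b i" for i y x
    using r that unfolding min_graded_free_res_def by blast
  have im: "(\<lambda>v. v 0) ` (mat_apply (d 1) 1 (b 1) ` fvec (b 1)) = I"
    using r unfolding min_graded_free_res_def by (elim conjE)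
  have ex: "{v \<in> fvec (b (Suc i)). mat_apply (d (Suc i)) (b i) (b (Suc i)) v = (\<lambda>_. 0)}
              = mat_apply (d (Suc (Suc i))) (b (Suc i)) (b (Suc (Suc i))) ` fvec (b (Suc (Suc i)))" for i
  proof -
    have "\<forall>i\<ge>1. {v \<in> fvec (b i). mat_apply (d i) (b (i - 1)) (b i) v = (\<lambda>_. 0)}
              = mat_apply (d (Suc i)) (b i) (b (Suc i)) ` fvec (b (Suc i))"
      using r unfolding min_graded_free_res_def by (elim conjE)
    from this[rule_format, of "Suc i"] show ?thesis by simp
  qed
  have app: "mat_apply (d (Suc i)) (b i) (b (Suc i)) v = (\<lambda>y. \<Sum>x\<in>{..<b (Suc i)}. D i y x * v x)" for i v
  proof
    fix y show "mat_apply (d (Suc i)) (b i) (b (Suc i)) v y = (\<Sum>x\<in>{..<b (Suc i)}. D i y x * v x)"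
    proof (cases "y < b i")
      case True
      then show ?thesis unfolding mat_apply_def D_def by (simp cong: sum.cong_simp)
    next
      case False
      then show ?thesis unfolding mat_apply_def D_def by simp
    qed
  qed
  \<comment> \<open>Unit vectors extract columns; this turns exactness for vectors into statements
    about matrices.\<close>
  have unit: "(\<Sum>x\<in>{..<b (Suc i)}. D i y x * unit_fun z x) = D i y z" for i y z
  proof -
    have "(\<Sum>x\<in>{..<b (Suc i)}. D i y x * unit_fun z x) = (\<Sum>x\<in>{..<b (Suc i)}. if x = z then D i y z else 0)"
      by (rule sum.cong) (auto simp: unit_fun_def)
    also have "\<dots> = (if z < b (Suc i) then D i y z else 0)" by simp
    also have "\<dots> = D i y z" by (simp add: D_def)
    finally show ?thesis .
  qed
  have uf: "unit_fun z \<in> fsupp {..<n}" if "z < n" for z n :: nat using that by (auto simp: unit_fun_def fsupp_def)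
  have I_iff: "f \<in> I \<longleftrightarrow> (\<exists>w\<in>fsupp {..<b 1}. (\<Sum>x\<in>{..<b 1}. D 0 0 x * w x) = f)" for f
  proof -
    have "mat_apply (d 1) 1 (b 1) v 0 = (\<Sum>x\<in>{..<b 1}. D 0 0 x * v x)" for v
      using fun_cong[OF app[of 0 v], of 0] b0 by simp
    then show ?thesis unfolding im[symmetric] image_image fvec_eq by (auto simp: image_iff)
  qed
  have col: "D 0 0 x \<in> I" if "x < b 1" for x
    unfolding I_iff using uf[OF that] unit[of 0 0 x] by (intro bexI[of _ "unit_fun x"]) simp_all
  have zero: "0 \<in> I" unfolding I_iff by (intro bexI[of _ 0]) (simp_all add: fsupp_def)
  show "free_res (\<lambda>i. {..<b i}) D I 0"
  proof
    show "finite {..<b i}" for i by simp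
    show "{..<b 0} = {0}" using b0 by auto
    show "D i \<in> msupp {..<b i} {..<b (Suc i)}" for i by (simp add: D_def msupp_def)
    show "0 \<in> I" by (rule zero)
    show "D 0 0 x \<in> I" for x
    proof (cases "x < b 1")
      case False then show ?thesis using zero by (simp add: D_def)
    qed (rule col)
    show "\<exists>w\<in>fsupp {..<b 1}. (\<Sum>x\<in>{..<b 1}. D 0 0 x * w x) = f" if "f \<in> I" for f using that unfolding I_iff .
    show "mm {..<b (Suc i)} (D i) (D (Suc i)) = 0" for i
    proof (intro ext)
      fix y x
      show "mm {..<b (Suc i)} (D i) (D (Suc i)) y x = 0 y x"
      proof (cases "x < b (Suc (Suc i))")
        case False
        then show ?thesis by (simp add: mm_def D_def)
      next
        case True
        let ?w = "\<lambda>y. \<Sum>z\<in>{..<b (Suc (Suc i))}. D (Suc i) y z * unit_fun x z"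
        have "?w \<in> mat_apply (d (Suc (Suc i))) (b (Suc i)) (b (Suc (Suc i))) ` fvec (b (Suc (Suc i)))"
          unfolding app fvec_eq by (rule imageI[OF uf[OF True]])
        then have "mat_apply (d (Suc i)) (b i) (b (Suc i)) ?w = (\<lambda>_. 0)" unfolding ex[symmetric] by simp
        then have "(\<Sum>z\<in>{..<b (Suc i)}. D i y z * ?w z) = 0" unfolding app by (rule fun_cong)
        then show ?thesis unfolding unit mm_def by simp
      qed
    qed
    fix i v assume v: "v \<in> fsupp {..<b (Suc i)}" and c: "\<And>y. (\<Sum>x\<in>{..<b (Suc i)}. D i y x * v x) = 0"
    have "v \<in> {v \<in> fvec (b (Suc i)). mat_apply (d (Suc i)) (b i) (b (Suc i)) v = (\<lambda>_. 0)}"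
      unfolding app fvec_eq using v c by simp
    then have "v \<in> mat_apply (d (Suc (Suc i))) (b (Suc i)) (b (Suc (Suc i))) ` fvec (b (Suc (Suc i)))" unfolding ex .
    then obtain w where w: "w \<in> fvec (b (Suc (Suc i)))" "v = mat_apply (d (Suc (Suc i))) (b (Suc i)) (b (Suc (Suc i))) w"
      by (elim imageE)
    show "\<exists>w\<in>fsupp {..<b (Suc (Suc i))}. \<forall>y. (\<Sum>x\<in>{..<b (Suc (Suc i))}. D (Suc i) y x * w x) = v y"
      using w unfolding app fvec_eq by (intro bexI[of _ w]) simp_all
  qed
  show "lkp (D i y x) 0 = 0" using mx[of "Suc i" y x] by (simp add: D_def max_ideal_def)
  show "I = ideal_gen (set (map (d 1 0) [0..<b 1])) \<or> \<not> is_ideal I"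
  proof (cases "is_ideal I")
    case True
    have dD: "D 0 0 x = d 1 0 x" if "x < b 1" for x using that b0 by (simp add: D_def)
    let ?J = "ideal_gen (set (map (d 1 0) [0..<b 1]))"
    have "?J \<subseteq> I" by (rule ideal_gen_least[OF True]) (use col dD in auto)
    moreover have "I \<subseteq> ?J"
    proof
      fix f assume "f \<in> I"
      then obtain w where w: "(\<Sum>x\<in>{..<b 1}. D 0 0 x * w x) = f" unfolding I_iff by (elim bexE)
      have "(\<Sum>x\<in>{..<b 1}. D 0 0 x * w x) \<in> ?J"
      proof (rule ideal_sum[OF is_ideal_ideal_gen])
        fix x assume x: "x \<in> {..<b 1}"
        have "d 1 0 x \<in> ?J" using x by (intro subsetD[OF ideal_gen_superset]) auto
        then show "D 0 0 x * w x \<in> ?J" using ideal_mult[OF is_ideal_ideal_gen, of "d 1 0 x" _ "w x"] dD x by (simp add: mult.commute)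
      qed
      then show "f \<in> ?J" unfolding w .
    qed
    ultimately have "I = ?J" by (intro equalityI)
    then show ?thesis by (rule disjI1)
  qed simp
qed

text \<open>At t = 1 the two equations read 4 P(1) = 6 2^c and 8 P(1) = 12 2^c.\<close>

lemma poly_shape_sum:
  fixes b :: "nat \<Rightarrow> nat" and N c :: nat
  defines "P \<equiv> (\<Sum>i\<le>N. monom (int (b i)) i)"
  assumes eq: "P * [:1, 1:] ^ 2 = [:1, 3, 2:] * [:1, 1:] ^ c \<or> P * [:1, 1:] ^ 3 = [:1, 5, 5, 1:] * [:1, 1:] ^ c"
  shows "2 * (\<Sum>i\<le>N. b i) = 3 * 2 ^ c"
proof -
  have P1: "poly P 1 = int (\<Sum>i\<le>N. b i)" unfolding P_def by (simp add: poly_sum poly_monom)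
  have "2 * poly P 1 = 3 * 2 ^ c" using eq
  proof
    assume "P * [:1, 1:] ^ 2 = [:1, 3, 2:] * [:1, 1:] ^ c"
    then have "poly (P * [:1, 1:] ^ 2) 1 = poly ([:1, 3, 2:] * [:1, 1:] ^ c) 1" by (rule arg_cong)
    then show ?thesis unfolding poly_mult poly_power by simp
  next
    assume "P * [:1, 1:] ^ 3 = [:1, 5, 5, 1:] * [:1, 1:] ^ c"
    then have "poly (P * [:1, 1:] ^ 3) 1 = poly ([:1, 5, 5, 1:] * [:1, 1:] ^ c) 1" by (rule arg_cong)
    then show ?thesis unfolding poly_mult poly_power by simp
  qed
  then have "int (2 * (\<Sum>i\<le>N. b i)) = int (3 * 2 ^ c)" unfolding P1 by simp
  then show ?thesis by (simp only: of_nat_eq_iff)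
qed

text \<open>The value \<open>max c 1\<close> is justified because there is at least one generator,
  so every cover is nonempty; the count that follows relies on a positive value.\<close>

lemma monomial_betti_shape:
  fixes I :: "('v::finite, 'k::field) mpoly set"
  assumes mi: "monomial_ideal I" and ht: "ideal_height I = enat c" and nci: "\<not> complete_intersection I"
    and res: "min_graded_free_res I N b deg d"
  shows "\<exists>b'. betti_shape (max c 1) b' \<and> (\<forall>i. b' i \<le> int (b i))"
proof -
  have idl: "is_ideal I" using mi is_ideal_ideal_gen by (auto simp: monomial_ideal_def)
  have "I = ideal_gen (set (map (d 1 0) [0..<b 1]))" using free_res_of_min_graded(3)[OF res] idl by simp
  from monomial_ideal_finite[OF mi this] obtain Ex where Ex: "finite Ex" "I = ideal_gen (mon ` Ex)" .
  obtain xs where xs: "set xs = Ex" using finite_list[OF Ex(1)] by (elim exE)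
  define A where "A = {..<length xs}"
  define al where "al = nth xs"
  have alA: "al ` A = Ex" unfolding al_def A_def xs[symmetric] by (auto simp: set_conv_nth)
  have finA: "finite A" by (simp add: A_def)
  interpret taylor A al "TYPE('k)" by (rule taylor.intro[OF finA])
  have I: "I = ideal_gen (mon ` al ` A)" using Ex(2) alA by simp
  \<comment> \<open>The infimum over an empty set of primes is infinite, so finite height excludes
    the unit ideal.\<close>
  have proper: "I \<noteq> UNIV"
  proof
    assume "I = UNIV"
    then have e: "{Q. is_prime_ideal Q \<and> I \<subseteq> Q} = {}" by (auto simp: is_prime_ideal_def)
    have "ideal_height I = \<infinity>" unfolding ideal_height_def e by (simp add: top_enat_def)
    then show False using ht by simp
  qed
  have fp: "finite (pol g)" for g
  proof -
    have "pol g = Sigma UNIV (\<lambda>v. {..<lkp (al g) v})" by (auto simp: pol_def)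
    then show ?thesis by simp
  qed
  have ple_pol: "pol g \<subseteq> pol h \<longleftrightarrow> ple (al g) (al h)" for g h
  proof
    assume s: "pol g \<subseteq> pol h"
    show "ple (al g) (al h)" unfolding ple_def
    proof (rule allI, rule ccontr)
      fix v assume "\<not> lkp (al g) v \<le> lkp (al h) v"
      then have "(v, lkp (al h) v) \<in> pol g" by (simp add: pol_def)
      then have "(v, lkp (al h) v) \<in> pol h" using s by (rule subsetD[rotated])
      then show False by (simp add: pol_def)
    qed
  qed (auto simp: pol_def ple_def intro: less_le_trans)
  have ne: "{} \<notin> pol ` A"
  proof
    assume "{} \<in> pol ` A"
    then obtain g where g: "g \<in> A" "pol g = {}" by auto
    have "ple (al g) \<gamma>" for \<gamma>
    proof -
      have "lkp (al g) v = 0" for v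
      proof (rule ccontr)
        assume "lkp (al g) v \<noteq> 0"
        then have "(v, 0) \<in> pol g" by (simp add: pol_def)
        then show False using g(2) by simp
      qed
      then show ?thesis by (simp add: ple_def)
    qed
    then have "f \<in> I" for f unfolding I monomial_ideal_mem using g(1) by blast
    then show False using proper by blast
  qed
  \<comment> \<open>Disjoint polarized sets belong to coprime monomials, so disjoint minimal sets
    would make \<open>I\<close> a complete intersection.\<close>
  have npd: "\<not> pairwise_disjoint (min_sets (pol ` A))"
  proof
    assume pd: "pairwise_disjoint (min_sets (pol ` A))"
    let ?A = "{g\<in>A. pol g \<in> min_sets (pol ` A)}"
    have sub: "mon ` al ` ?A \<subseteq> (mon ` al ` A :: ('v, 'k) mpoly set)" by auto
    have "I = ideal_gen (mon ` al ` ?A)"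
    proof
      show "ideal_gen (mon ` al ` ?A) \<subseteq> I" unfolding I
        by (rule ideal_gen_least[OF is_ideal_ideal_gen order_trans[OF sub ideal_gen_superset]])
      show "I \<subseteq> ideal_gen (mon ` al ` ?A)"
      proof
        fix f assume f: "f \<in> I"
        show "f \<in> ideal_gen (mon ` al ` ?A)" unfolding monomial_ideal_mem
        proof
          fix \<gamma> assume "\<gamma> \<in> Poly_Mapping.keys f"
          then obtain g where g: "g \<in> A" "ple (al g) \<gamma>" using f unfolding I monomial_ideal_mem by blast
          obtain F where F: "F \<in> min_sets (pol ` A)" "F \<subseteq> pol g"
            using min_sets_below[OF finite_imageI[OF finA] imageI[OF g(1)]] .
          then have "F \<in> pol ` A" by (simp add: min_sets_def)
          then obtain h where h: "h \<in> A" "F = pol h" by (elim imageE)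
          have "ple (al h) (al g)" using F(2) ple_pol h(2) by simp
          then have "ple (al h) \<gamma>" using g(2) unfolding ple_def by (meson order_trans)
          moreover have "al h \<in> al ` ?A" using h F(1) by (intro imageI) simp
          ultimately show "\<exists>\<alpha>\<in>al ` ?A. ple \<alpha> \<gamma>" by (intro bexI)
        qed
      qed
    qed
    moreover have "complete_intersection (ideal_gen (mon ` al ` ?A) :: ('v, 'k) mpoly set)"
    proof (rule coprime_complete_intersection)
      show "finite (al ` ?A)" using finA by simp
      show "ideal_gen (mon ` al ` ?A) \<noteq> (UNIV :: ('v, 'k) mpoly set)" using proper calculation by simp
      fix \<alpha> \<beta> v assume "\<alpha> \<in> al ` ?A" "\<beta> \<in> al ` ?A" and neq: "\<alpha> \<noteq> \<beta>"
      then obtain g h where g: "g \<in> ?A" "\<alpha> = al g" and h: "h \<in> ?A" "\<beta> = al h" by (elim imageE)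
      have "pol g \<noteq> pol h"
      proof
        assume "pol g = pol h"
        then have "ple (al g) (al h)" "ple (al h) (al g)" using ple_pol by blast+
        then have "al g = al h" unfolding ple_def by (intro poly_mapping_eqI order_antisym) blast+
        then show False using neq g h by simp
      qed
      then have "(v, 0) \<notin> pol g \<or> (v, 0) \<notin> pol h"
        using pairwise_disjointD[OF pd, of "pol g" "pol h" "(v, 0)"] g h by blast
      then show "lkp \<alpha> v = 0 \<or> lkp \<beta> v = 0" unfolding g(2) h(2) by (simp add: pol_def)
    qed
    ultimately show False using nci by simp
  qed
  \<comment> \<open>Forgetting the second component of its vertices turns a cover \<open>C\<close>
    into a set of variables whose prime contains \<open>I\<close>. The height of this prime is at
    most the size of \<open>C\<close>.\<close>
  have cov: "max c 1 \<le> card C" if C: "finite C" "\<And>g. g \<in> A \<Longrightarrow> pol g \<inter> C \<noteq> {}" for C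
  proof -
    have "C \<noteq> {}"
    proof
      assume "C = {}"
      then have "A = {}" using C(2) by blast
      then show False using npd by (simp add: pairwise_disjoint_def min_sets_def)
    qed
    then have one: "1 \<le> card C" using C(1) by (simp add: Suc_le_eq card_gt_0_iff)
    have "I \<subseteq> var_prime (fst ` C)"
    proof
      fix f assume f: "f \<in> I"
      have "\<exists>v\<in>fst ` C. lkp \<gamma> v > 0" if k: "\<gamma> \<in> Poly_Mapping.keys f" for \<gamma>
      proof -
        obtain g where g: "g \<in> A" "ple (al g) \<gamma>" using f k unfolding I monomial_ideal_mem by blast
        obtain v j where vj: "(v, j) \<in> pol g" "(v, j) \<in> C" using C(2)[OF g(1)] by auto
        have "j < lkp (al g) v" using vj(1) by (simp add: pol_def)
        then have "lkp \<gamma> v > 0" using g(2) unfolding ple_def by (metis gr_zeroI le_zero_eq not_less_zero)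
        moreover have "v \<in> fst ` C" using vj(2) by (intro image_eqI[of v fst "(v, j)"]) simp_all
        ultimately show ?thesis by (intro bexI)
      qed
      then show "f \<in> var_prime (fst ` C)" unfolding var_prime_def by blast
    qed
    then have "ideal_height I \<le> prime_height (var_prime (fst ` C) :: ('v, 'k) mpoly set)"
      unfolding ideal_height_def by (intro INF_lower) (simp add: is_prime_var_prime)
    also have "\<dots> \<le> enat (card (fst ` C))" by (rule prime_height_var_prime)
    also have "\<dots> \<le> enat (card C)" using card_image_le[OF C(1), of fst] by simp
    finally show ?thesis using ht one by simp
  qed
  let ?V = "\<Union>(pol ` A)"
  have finV: "finite ?V" using finA fp by simp
  have bet: "bet TYPE('k) ?V A pol i = int (b i)" for i
    using betti_eq_hdim_sum[OF free_res_of_min_graded(1)[OF res, unfolded I] free_res_of_min_graded(2)[OF res], of i]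
    unfolding bet_def hh_def by simp
  have "\<exists>b'. betti_shape (max c 1) b' \<and> (\<forall>i. b' i \<le> bet TYPE('k) ?V A pol i)"
    by (rule bet_lower_bound[OF finA fp ne finV order_refl npd cov])
  then show ?thesis unfolding bet .
qed

text \<open>Multiplication by (1+t)^2 and (1+t)^3 clears the exponents c-2 and c-3, which would be
  truncated for small \<open>c\<close>.\<close>

theorem theorem1p1:
  fixes I :: "('v::finite, 'k::field) mpoly set"
    and c :: nat
  assumes "monomial_ideal I"
    and "ideal_height I = enat c"
    and "\<not> complete_intersection I"
  shows "\<forall>N b deg d. min_graded_free_res I N b deg d \<longrightarrow>
           (\<Sum>i\<le>N. b i) \<ge> 2 ^ c + 2 ^ (c - 1) \<and>
           ((\<Sum>i\<le>N. b i) = 2 ^ c + 2 ^ (c - 1) \<longleftrightarrow>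
              (let P = (\<Sum>i\<le>N. monom (int (b i)) i) in
                 P * [:1, 1:] ^ 2 = [:1, 3, 2:] * [:1, 1:] ^ c \<or>
                 P * [:1, 1:] ^ 3 = [:1, 5, 5, 1:] * [:1, 1:] ^ c))"
proof (intro allI impI)
  fix N and b :: "nat \<Rightarrow> nat" and deg d
  assume res: "min_graded_free_res I N b deg d"
  let ?P = "\<Sum>i\<le>N. monom (int (b i)) i"
  have z: "b i = 0" if "i > N" for i using res that unfolding min_graded_free_res_def by blast
  obtain b' where b': "betti_shape (max c 1) b'" "\<forall>i. b' i \<le> int (b i)"
    using monomial_betti_shape[OF assms res] by (elim exE conjE)
  note sum = betti_shape_sum[OF b'(1) b'(2)[rule_format] z max.cobounded2]
  have conv: "2 * (\<Sum>i\<le>N. b i) = 3 * 2 ^ c"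
    if "?P * [:1, 1:] ^ 2 = [:1, 3, 2:] * [:1, 1:] ^ c \<or> ?P * [:1, 1:] ^ 3 = [:1, 5, 5, 1:] * [:1, 1:] ^ c"
    by (rule poly_shape_sum[OF that])
  show "(\<Sum>i\<le>N. b i) \<ge> 2 ^ c + 2 ^ (c - 1) \<and>
           ((\<Sum>i\<le>N. b i) = 2 ^ c + 2 ^ (c - 1) \<longleftrightarrow>
              (let P = (\<Sum>i\<le>N. monom (int (b i)) i) in
                 P * [:1, 1:] ^ 2 = [:1, 3, 2:] * [:1, 1:] ^ c \<or>
                 P * [:1, 1:] ^ 3 = [:1, 5, 5, 1:] * [:1, 1:] ^ c))"
  proof (cases c)
    \<comment> \<open>The bound for the value 1 gives a total of at least 3, above 2^0 + 2^0.
      Neither polynomial identity can hold, as it would make twice the total equal to 3.\<close>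
    case 0
    have "3 \<le> (\<Sum>i\<le>N. b i)" using sum(1) 0 by simp
    moreover have "\<not> (?P * [:1, 1:] ^ 2 = [:1, 3, 2:] * [:1, 1:] ^ c \<or> ?P * [:1, 1:] ^ 3 = [:1, 5, 5, 1:] * [:1, 1:] ^ c)"
    proof
      assume "?P * [:1, 1:] ^ 2 = [:1, 3, 2:] * [:1, 1:] ^ c \<or> ?P * [:1, 1:] ^ 3 = [:1, 5, 5, 1:] * [:1, 1:] ^ c"
      then have "2 * (\<Sum>i\<le>N. b i) = 3" using conv 0 by simp
      then show False by presburger
    qed
    ultimately show ?thesis unfolding Let_def 0 by simp
  next
    case (Suc m)
    then have mc: "max c 1 = c" by simp
    have half: "2 * (\<Sum>i\<le>N. b i) = 3 * 2 ^ c \<Longrightarrow> (\<Sum>i\<le>N. b i) = 2 ^ c + 2 ^ (c - 1)" unfolding Suc by simp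
    show ?thesis unfolding Let_def
      using sum(1)[unfolded mc] sum(2)[unfolded mc] half conv by blast
  qed
qed

end
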